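(* Let $n\in\mathbb N$ and let $(W,S)$ be a Coxeter system with $S$ finite. Suppose that every entry of the Coxeter matrix of $(W,S)$ is either $1$, $2$, $3$ or $\infty$. Then the set $L_n(W)$ of $n$-low elements of $W$ is a finite Garside shadow in $(W,S)$.
   Context: Here $\mathbb N=\{0,1,2,\dots\}$. Let $\ell$ be the length function of $(W,S)$. For $w=uv$ in $W$ with $\ell(w)=\ell(u)+\ell(v)$, $u$ is called a prefix of $w$ and $v$ a suffix of $w$. The (right) weak order on $W$ is $u\leq_R w$ iff $u$ is a prefix of $w$. A subset $X\subseteq W$ is bounded if there is $g\in W$ with $x\leq_R g$ for all $x\in X$; every bounded $X$ has a least upper bound $\bigvee X$ for $\leq_R$, called its join. A Garside shadow in $(W,S)$ is a subset $A\subseteq W$ containing $S$ such that (i) if $X\subseteq A$ is bounded then $\bigvee X\in A$, and (ii) every suffix of an element of $A$ is in $A$. Geometric representation and roots. Fix a geometric representation of $(W,S)$: a real vector space $V$ with a symmetric bilinear form $B$, and a simple system $\Delta=\{\alpha_s : s\in S\}\subseteq V$ (finite, indexed bijectively by $S$) such that: $\sum_{\alpha\in\Delta}a_\alpha\alpha=0$ with all $a_\alpha\ge 0$ implies all $a_\alpha=0$; $B(\alpha,\beta)\in\,]-\infty,-1]\cup\{-\cos(\pi/k): k\in\mathbb N, k\geq 2\}$ for distinct $\alpha,\beta\in\Delta$; $B(\alpha,\alpha)=1$ for $\alpha\in\Delta$; and $W$ is faithfully represented in the group of linear maps preserving $B$, with $s\in S$ acting by $v\mapsto v-2B(\alpha_s,v)\alpha_s$.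 (So $B(\alpha_s,\alpha_t)=-\cos(\pi/m_{st})$ if the order $m_{st}$ of $st$ is finite, and $B(\alpha_s,\alpha_t)\le -1$ iff $m_{st}=\infty$.) For $A\subseteq V$, $\operatorname{cone}(A)$ is the set of non-negative linear combinations of vectors of $A$. The root system is $\Phi=W(\Delta)$, with positive roots $\Phi^+=\operatorname{cone}(\Delta)\cap\Phi$ and negative roots $\Phi^-=-\Phi^+$; $\Phi=\Phi^+\sqcup\Phi^-$. Put $\operatorname{cone}_\Phi(A)=\operatorname{cone}(A)\cap\Phi$. The (left) inversion set of $w\in W$ is $N(w)=\Phi^+\cap w(\Phi^-)$. $n$-small roots and $n$-low elements. For $\alpha,\beta\in\Phi^+$, $\beta$ dominates $\alpha$ (written $\alpha\preceq\beta$) if for all $w\in W$, $\beta\in N(w)$ implies $\alpha\in N(w)$; write $\alpha\prec\beta$ if moreover $\alpha\neq\beta$. The $\infty$-depth of $\beta\in\Phi^+$ is $\operatorname{dp}_\infty(\beta)=|\{\alpha\in\Phi^+ : \alpha\prec\beta\}|$. The set of $n$-small roots is $\Sigma_n=\{\beta\in\Phi^+:\operatorname{dp}_\infty(\beta)\le n\}$. An element $w\in W$ is $n$-low if $N(w)=\operatorname{cone}_\Phi(A)$ for some $A\subseteq\Sigma_n$. *)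

theory Defs
  imports
    "HOL-Analysis.Linear_Algebra"
    "HOL-Algebra.Generated_Groups"
    "HOL-Algebra.Multiplicative_Group"
    "HOL-Library.Extended_Nat"
begin

text \<open>The order of \<open>s t\<close>, as an extended natural number. The constant \<^const>\<open>group.ord\<close> is \<open>0\<close>
  on elements of infinite order.\<close>

definition coxeter_matrix :: "('w, 'm) monoid_scheme \<Rightarrow> 'w \<Rightarrow> 'w \<Rightarrow> enat" where
  "coxeter_matrix W s t =
    (let k = group.ord W (s \<otimes>\<^bsub>W\<^esub> t) in if k = 0 then \<infinity> else enat k)"

definition word_prod :: "('w, 'm) monoid_scheme \<Rightarrow> 'w list \<Rightarrow> 'w" where
  "word_prod W ws = foldr (\<otimes>\<^bsub>W\<^esub>) ws \<one>\<^bsub>W\<^esub>"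

text \<open>The congruence on words in the letters \<open>S\<close> generated by the relations \<open>(s t)^m(s,t) = 1\<close>,
  one for each pair with \<open>m(s,t)\<close> finite. In a Coxeter system \<open>m(s,s) = 1\<close>, so \<open>s s = 1\<close> is one of
  the relations and no formal inverses are needed: the words modulo this congruence form the group
  with generators \<open>S\<close> and these relations.\<close>

inductive coxeter_equiv :: "('w, 'm) monoid_scheme \<Rightarrow> 'w set \<Rightarrow> 'w list \<Rightarrow> 'w list \<Rightarrow> bool"
  for W S where
  refl: "coxeter_equiv W S us us"
| sym: "coxeter_equiv W S us vs \<Longrightarrow> coxeter_equiv W S vs us"
| trans: "coxeter_equiv W S us vs \<Longrightarrow> coxeter_equiv W S vs ws \<Longrightarrow> coxeter_equiv W S us ws"
| relator: "s \<in> S \<Longrightarrow> t \<in> S \<Longrightarrow> coxeter_matrix W s t = enat k \<Longrightarrow>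
    coxeter_equiv W S (us @ concat (replicate k [s, t]) @ vs) (us @ vs)"

locale coxeter_system = group W for W :: "('w, 'm) monoid_scheme" (structure) +
  fixes S :: "'w set"
  assumes S_subset: "S \<subseteq> carrier W"
    and S_generates: "generate W S = carrier W"
    and S_order_two: "s \<in> S \<Longrightarrow> ord s = 2"
    and presentation: "us \<in> lists S \<Longrightarrow> vs \<in> lists S \<Longrightarrow> word_prod W us = word_prod W vs \<Longrightarrow>
      coxeter_equiv W S us vs"

context coxeter_system
begin

definition cox_length :: "'w \<Rightarrow> nat" where
  "cox_length w = (LEAST k. \<exists>ws \<in> lists S. length ws = k \<and> word_prod W ws = w)"

definition is_prefix :: "'w \<Rightarrow> 'w \<Rightarrow> bool" where
  "is_prefix u w \<longleftrightarrow> u \<in> carrier W \<and>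
    (\<exists>v \<in> carrier W. w = u \<otimes> v \<and> cox_length w = cox_length u + cox_length v)"

definition is_suffix :: "'w \<Rightarrow> 'w \<Rightarrow> bool" where
  "is_suffix v w \<longleftrightarrow> v \<in> carrier W \<and>
    (\<exists>u \<in> carrier W. w = u \<otimes> v \<and> cox_length w = cox_length u + cox_length v)"

text \<open>The library supremum with respect to this order is the join.\<close>

definition right_weak_order :: "'w gorder" where
  "right_weak_order = \<lparr>carrier = carrier W, eq = (=), le = is_prefix\<rparr>"

definition bounded_above :: "'w set \<Rightarrow> bool" where
  "bounded_above X \<longleftrightarrow> Upper right_weak_order X \<noteq> {}"

definition garside_shadow :: "'w set \<Rightarrow> bool" where
  "garside_shadow A \<longleftrightarrow> S \<subseteq> A \<and> A \<subseteq> carrier W \<and>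
    (\<forall>X \<subseteq> A. bounded_above X \<longrightarrow> \<Squnion>\<^bsub>right_weak_order\<^esub> X \<in> A) \<and>
    (\<forall>w \<in> A. \<forall>v. is_suffix v w \<longrightarrow> v \<in> A)"

end

definition nonneg_cone :: "'v::real_vector set \<Rightarrow> 'v set" where
  "nonneg_cone A = {\<Sum>v\<in>F. c v *\<^sub>R v | F c. finite F \<and> F \<subseteq> A \<and> (\<forall>v\<in>F. 0 \<le> c v)}"

definition orthogonal_group :: "('v::real_vector \<Rightarrow> 'v \<Rightarrow> real) \<Rightarrow> ('v \<Rightarrow> 'v) monoid" where
  "orthogonal_group B =
    \<lparr>carrier = {f. linear f \<and> bij f \<and> (\<forall>u v. B (f u) (f v) = B u v)},
     mult = (\<circ>), one = id\<rparr>"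

locale geometric_representation = coxeter_system W S
  for W :: "('w, 'm) monoid_scheme" (structure) and S :: "'w set" +
  fixes B :: "'v::real_vector \<Rightarrow> 'v \<Rightarrow> real"
    and \<alpha> :: "'w \<Rightarrow> 'v"
    and \<rho> :: "'w \<Rightarrow> 'v \<Rightarrow> 'v"
  assumes finite_S: "finite S"
    and B_bilinear: "bilinear B"
    and B_symmetric: "B u v = B v u"
    and simple_inj: "inj_on \<alpha> S"
    and simple_positively_independent:
      "(\<And>s. s \<in> S \<Longrightarrow> 0 \<le> a s) \<Longrightarrow> (\<Sum>s\<in>S. a s *\<^sub>R \<alpha> s) = 0 \<Longrightarrow> s \<in> S \<Longrightarrow> a s = 0"
    and simple_unit: "s \<in> S \<Longrightarrow> B (\<alpha> s) (\<alpha> s) = 1"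
    and simple_product: "s \<in> S \<Longrightarrow> t \<in> S \<Longrightarrow> s \<noteq> t \<Longrightarrow>
      B (\<alpha> s) (\<alpha> t) \<in> {..-1} \<union> {- cos (pi / real k) | k :: nat. 2 \<le> k}"
    and rep_hom: "\<rho> \<in> hom W (orthogonal_group B)"
    and rep_faithful: "inj_on \<rho> (carrier W)"
    and rep_simple: "s \<in> S \<Longrightarrow> \<rho> s v = v - (2 * B (\<alpha> s) v) *\<^sub>R \<alpha> s"
begin

definition roots :: "'v set" where
  "roots = {\<rho> w (\<alpha> s) | w s. w \<in> carrier W \<and> s \<in> S}"

definition pos_roots :: "'v set" where
  "pos_roots = nonneg_cone (\<alpha> ` S) \<inter> roots"

definition neg_roots :: "'v set" where
  "neg_roots = uminus ` pos_roots"

definition root_cone :: "'v set \<Rightarrow> 'v set" where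
  "root_cone A = nonneg_cone A \<inter> roots"

definition inversion_set :: "'w \<Rightarrow> 'v set" where
  "inversion_set w = pos_roots \<inter> \<rho> w ` neg_roots"

definition dominates :: "'v \<Rightarrow> 'v \<Rightarrow> bool" where
  "dominates \<beta> \<gamma> \<longleftrightarrow>
    (\<forall>w \<in> carrier W. \<beta> \<in> inversion_set w \<longrightarrow> \<gamma> \<in> inversion_set w)"

definition strictly_dominated :: "'v \<Rightarrow> 'v set" where
  "strictly_dominated \<beta> = {\<gamma> \<in> pos_roots. dominates \<beta> \<gamma> \<and> \<gamma> \<noteq> \<beta>}"

text \<open>Valued in \<^typ>\<open>enat\<close> so that no infinite set is counted as having cardinality \<open>0\<close>.\<close>

definition inf_depth :: "'v \<Rightarrow> enat" where
  "inf_depth \<beta> =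
    (if finite (strictly_dominated \<beta>) then enat (card (strictly_dominated \<beta>)) else \<infinity>)"

definition small_roots :: "nat \<Rightarrow> 'v set" where
  "small_roots n = {\<beta> \<in> pos_roots. inf_depth \<beta> \<le> enat n}"

definition low_elements :: "nat \<Rightarrow> 'w set" where
  "low_elements n =
    {w \<in> carrier W. \<exists>A \<subseteq> small_roots n. inversion_set w = root_cone A}"

end

end

theory Submission
  imports Defs
begin

text \<open>Write \<open>N(w)\<close> for the inversion set of \<open>w\<close>, and call an inversion \<open>\<beta>\<close> of \<open>w\<close> decomposable when
  some other inversion \<open>a\<close> of \<open>w\<close> has \<open>- s\<^sub>\<beta> a\<close> in \<open>N(w)\<close> too; then \<open>\<beta>\<close> is a positive multiple of
  \<open>a + (- s\<^sub>\<beta> a)\<close>. The whole proof rests on the fact that the indecomposable inversions are exactly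
  the ones that every set \<open>A\<close> with \<open>N(w) = cone\<^sub>\<Phi>(A)\<close> has to contain, and that they suffice
  (\<open>cone_combination_decomposable\<close>, \<open>minimal_generators\<close>). So \<open>w\<close> is \<open>n\<close>-low iff its indecomposable
  inversions are \<open>n\<close>-small. A second description comes from counting inversions of \<open>s\<^sub>\<beta> w\<close>:
  \<open>\<beta>\<close> is indecomposable iff multiplication by \<open>s\<^sub>\<beta>\<close> lowers the length by exactly one
  (\<open>decomposable_iff_length\<close>).

  \<^bold>\<open>Joins.\<close> If \<open>X\<close> is bounded, its join \<open>j\<close> exists and \<open>N(j)\<close> is \<open>cone\<^sub>\<Phi>\<close> of the union of the
  \<open>N(x)\<close> (\<open>join_inversion_set\<close>), so generating sets of the \<open>N(x)\<close> unite to one of \<open>N(j)\<close>. For two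
  elements below \<open>g\<close> this is an induction on the length of \<open>g\<close>: remove a common first letter, and if
  there is none, first join both elements with the longest element of a finite dihedral parabolic
  subgroup.

  \<^bold>\<open>Finiteness.\<close> An \<open>n\<close>-low element is determined by a set of \<open>n\<close>-small roots, so it is enough that
  these are finitely many. They are reached from the simple roots by simple reflections with
  negative product, through \<open>n\<close>-small roots only. By Koenig's lemma an infinite number of them would
  give an infinite path. Its depths are bounded, so in the long run every product on the path
  is larger than \<open>-1\<close>. This is where the entries \<open>1, 2, 3, \<infinity>\<close> come in: products of roots with
  absolute value below \<open>1\<close> can only be \<open>0\<close> or \<open>\<plusminus>1/2\<close> (\<open>simple_root_product_crystallographic\<close>). Hence the
  products with the simple roots that occur infinitely often take finitely many values, they repeat,
  and two roots at which they agree have product \<open>1\<close>. Then one of the two strictly dominates the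
  other although their depths are equal (\<open>finite_small_roots\<close>).

  \<^bold>\<open>Suffixes.\<close> It is enough to remove one first letter \<open>s\<close> from a low element \<open>w\<close>. Let \<open>\<beta>\<close> be an
  indecomposable inversion of \<open>s w\<close>. If \<open>s \<beta>\<close> is indecomposable for \<open>w\<close>, it is small, and so is
  \<open>\<beta>\<close> unless \<open>\<beta>\<close> dominates \<open>\<alpha>\<^sub>s\<close>, which is ruled out by the possible values of their product. Otherwise the
  inversions of \<open>w\<close> in the plane of \<open>\<alpha>\<^sub>s\<close> and \<open>\<beta>\<close> start with \<open>\<alpha>\<^sub>s, s \<beta>, \<dots>\<close>; let \<open>\<delta>\<close> be the last one.
  Comparing lengths along \<open>s\<^sub>\<beta> s w < s\<^sub>\<delta> w < w\<close> shows that \<open>\<delta>\<close> is indecomposable, hence small. If the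
  plane contains finitely many roots, then it is of type \<open>A\<^sub>2\<close> and \<open>\<delta> = \<beta>\<close>; if it contains infinitely
  many, then \<open>\<delta>\<close> dominates \<open>s \<beta>\<close>, and \<open>\<beta>\<close> has no larger depth
  (\<open>low_elements_generators_small\<close>).\<close>

section \<open>Convex cones\<close>

lemma zero_mem_nonneg_cone: "0 \<in> nonneg_cone A"
  unfolding nonneg_cone_def by (rule CollectI, rule exI[of _ "{}"]) auto

lemma nonneg_cone_insert_term:
  assumes "x \<in> nonneg_cone A" "a \<in> A" "0 \<le> c"
  shows "c *\<^sub>R a + x \<in> nonneg_cone A"
proof -
  obtain F d where F: "finite F" "F \<subseteq> A" "\<forall>v\<in>F. 0 \<le> d v" "x = (\<Sum>v\<in>F. d v *\<^sub>R v)"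
    using assms(1) unfolding nonneg_cone_def by blast
  define e where "e v = (if v \<in> F then d v else 0) + (if v = a then c else 0)" for v
  have "(\<Sum>v\<in>insert a F. e v *\<^sub>R v)
      = (\<Sum>v\<in>insert a F. (if v \<in> F then d v else 0) *\<^sub>R v)
        + (\<Sum>v\<in>insert a F. (if v = a then c else 0) *\<^sub>R v)"
    by (simp add: e_def scaleR_add_left sum.distrib)
  also have "(\<Sum>v\<in>insert a F. (if v \<in> F then d v else 0) *\<^sub>R v) = (\<Sum>v\<in>F. d v *\<^sub>R v)"
    by (rule sum.mono_neutral_cong_right) (use F in auto)
  also have "(\<Sum>v\<in>insert a F. (if v = a then c else 0) *\<^sub>R v) = (\<Sum>v\<in>{a}. c *\<^sub>R v)"
    by (rule sum.mono_neutral_cong_right) (use F in auto)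
  finally have "c *\<^sub>R a + x = (\<Sum>v\<in>insert a F. e v *\<^sub>R v)"
    using F(4) by simp
  moreover have "finite (insert a F)" "insert a F \<subseteq> A" "\<forall>v\<in>insert a F. 0 \<le> e v"
    using F assms by (auto simp: e_def)
  ultimately show ?thesis unfolding nonneg_cone_def by blast
qed

lemma nonneg_cone_induct [consumes 1, case_names zero add_term]:
  assumes "x \<in> nonneg_cone A" and "P 0"
    and "\<And>a c x. a \<in> A \<Longrightarrow> 0 \<le> c \<Longrightarrow> x \<in> nonneg_cone A \<Longrightarrow> P x \<Longrightarrow> P (c *\<^sub>R a + x)"
  shows "P x"
proof -
  obtain F d where F: "finite F" "F \<subseteq> A" "\<forall>v\<in>F. 0 \<le> d v" "x = (\<Sum>v\<in>F. d v *\<^sub>R v)"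
    using assms(1) unfolding nonneg_cone_def by blast
  have "P (\<Sum>v\<in>F. d v *\<^sub>R v) \<and> (\<Sum>v\<in>F. d v *\<^sub>R v) \<in> nonneg_cone A"
    using F(1-3)
  proof (induction F)
    case empty
    then show ?case using assms(2) zero_mem_nonneg_cone by simp
  next
    case (insert a F)
    then show ?case using assms(3)[of a "d a"] nonneg_cone_insert_term by auto
  qed
  then show ?thesis using F(4) by simp
qed

lemma nonneg_cone_superset: "a \<in> A \<Longrightarrow> a \<in> nonneg_cone A"
  using nonneg_cone_insert_term[OF zero_mem_nonneg_cone, of a A 1] by simp

lemma nonneg_cone_add:
  assumes "x \<in> nonneg_cone A" "y \<in> nonneg_cone A"
  shows "x + y \<in> nonneg_cone A"
  using assms(1)
proof (induction rule: nonneg_cone_induct)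
  case (add_term a c x)
  then show ?case using nonneg_cone_insert_term[of "x + y" A a c] by (simp add: add.assoc)
qed (use assms in simp)

lemma nonneg_cone_scale:
  assumes "x \<in> nonneg_cone A" "0 \<le> r"
  shows "r *\<^sub>R x \<in> nonneg_cone A"
  using assms(1)
proof (induction rule: nonneg_cone_induct)
  case (add_term a c x)
  then show ?case using nonneg_cone_insert_term[of "r *\<^sub>R x" A a "r * c"] assms(2)
    by (simp add: scaleR_add_right)
qed (simp add: zero_mem_nonneg_cone)

lemma nonneg_cone_image:
  assumes "x \<in> nonneg_cone A" "linear f" "\<And>a. a \<in> A \<Longrightarrow> f a \<in> nonneg_cone D"
  shows "f x \<in> nonneg_cone D"
  using assms(1)
proof (induction rule: nonneg_cone_induct)
  case zero
  then show ?case using linear_0[OF assms(2)] zero_mem_nonneg_cone by simp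
next
  case (add_term a c x)
  then show ?case
    by (simp add: linear_add[OF assms(2)] linear_scale[OF assms(2)] assms(3)
        nonneg_cone_add nonneg_cone_scale)
qed

lemma nonneg_cone_subset: "A \<subseteq> nonneg_cone D \<Longrightarrow> nonneg_cone A \<subseteq> nonneg_cone D"
  using nonneg_cone_image[of _ A "\<lambda>x. x" D] linear_id by (auto simp: id_def)

lemma nonneg_cone_mono: "A \<subseteq> D \<Longrightarrow> nonneg_cone A \<subseteq> nonneg_cone D"
  using nonneg_cone_subset nonneg_cone_superset by blast

lemma nonneg_cone_split:
  assumes "x \<in> nonneg_cone A"
  shows "\<exists>r y. 0 \<le> r \<and> y \<in> nonneg_cone (A - {b}) \<and> x = r *\<^sub>R b + y"
  using assms
proof (induction rule: nonneg_cone_induct)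
  case zero
  then show ?case using zero_mem_nonneg_cone by (intro exI[of _ 0]) auto
next
  case (add_term a c x)
  then obtain r y where ry: "0 \<le> r" "y \<in> nonneg_cone (A - {b})" "x = r *\<^sub>R b + y" by blast
  show ?case
  proof (cases "a = b")
    case True
    then show ?thesis using ry add_term by (intro exI[of _ "c + r"] exI[of _ y]) (auto simp: scaleR_add_left)
  next
    case False
    then show ?thesis using ry add_term nonneg_cone_insert_term[of y "A - {b}" a c]
      by (intro exI[of _ r] exI[of _ "c *\<^sub>R a + y"]) auto
  qed
qed

section \<open>Length\<close>

context coxeter_system
begin

lemma S_carrier [simp]: "s \<in> S \<Longrightarrow> s \<in> carrier W"
  using S_subset by blast

lemma S_square [simp]: "s \<in> S \<Longrightarrow> s \<otimes> s = \<one>"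
  using pow_ord_eq_1[of s] S_order_two[of s] by (simp add: numeral_2_eq_2)

lemma S_inv [simp]: "s \<in> S \<Longrightarrow> inv s = s"
  using inv_equality S_square S_carrier by blast

lemma S_cancel_left [simp]: "s \<in> S \<Longrightarrow> w \<in> carrier W \<Longrightarrow> s \<otimes> (s \<otimes> w) = w"
  by (simp add: m_assoc[symmetric])

lemma S_cancel_right [simp]: "s \<in> S \<Longrightarrow> w \<in> carrier W \<Longrightarrow> w \<otimes> s \<otimes> s = w"
  by (simp add: m_assoc)

lemma word_prod_Nil [simp]: "word_prod W [] = \<one>"
  and word_prod_Cons [simp]: "word_prod W (s # ws) = s \<otimes> word_prod W ws"
  by (simp_all add: word_prod_def)

lemma word_prod_closed [simp]: "ws \<in> lists S \<Longrightarrow> word_prod W ws \<in> carrier W"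
  by (induction ws) auto

lemma word_prod_append:
  "us \<in> lists S \<Longrightarrow> vs \<in> lists S \<Longrightarrow> word_prod W (us @ vs) = word_prod W us \<otimes> word_prod W vs"
  by (induction us) (auto simp: m_assoc)

lemma exists_word:
  assumes "w \<in> carrier W"
  shows "\<exists>ws\<in>lists S. word_prod W ws = w"
proof -
  have "w \<in> generate W S" using assms S_generates by simp
  then show ?thesis
  proof (induction rule: generate.induct)
    case one
    then show ?case by (intro bexI[of _ "[]"]) auto
  next
    case (incl h)
    then show ?case by (intro bexI[of _ "[h]"]) auto
  next
    case (inv h)
    then show ?case by (intro bexI[of _ "[h]"]) auto
  next
    case (eng g h)
    then obtain us vs where "us \<in> lists S" "vs \<in> lists S"
      "word_prod W us = g" "word_prod W vs = h" by blast
    then show ?case using word_prod_append by (intro bexI[of _ "us @ vs"]) auto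
  qed
qed

lemma exists_reduced_word:
  assumes "w \<in> carrier W"
  shows "\<exists>ws\<in>lists S. length ws = cox_length w \<and> word_prod W ws = w"
  unfolding cox_length_def
  by (rule LeastI_ex) (use exists_word[OF assms] in blast)

lemma cox_length_le: "ws \<in> lists S \<Longrightarrow> cox_length (word_prod W ws) \<le> length ws"
  unfolding cox_length_def by (rule Least_le) blast

lemma cox_length_one [simp]: "cox_length \<one> = 0"
  using cox_length_le[of "[]"] by simp

lemma cox_length_eq_0: "w \<in> carrier W \<Longrightarrow> cox_length w = 0 \<Longrightarrow> w = \<one>"
  using exists_reduced_word by fastforce

lemma cox_length_mult_le:
  assumes "u \<in> carrier W" "v \<in> carrier W"
  shows "cox_length (u \<otimes> v) \<le> cox_length u + cox_length v"
proof -
  obtain us vs where "us \<in> lists S" "length us = cox_length u" "word_prod W us = u"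
    "vs \<in> lists S" "length vs = cox_length v" "word_prod W vs = v"
    using exists_reduced_word assms by meson
  then show ?thesis using cox_length_le[of "us @ vs"] word_prod_append[of us vs] by simp
qed

lemma cox_length_generator: "s \<in> S \<Longrightarrow> cox_length s \<le> 1"
  using cox_length_le[of "[s]"] by simp

lemma cox_length_mult_right_le:
  "w \<in> carrier W \<Longrightarrow> s \<in> S \<Longrightarrow> cox_length (w \<otimes> s) \<le> Suc (cox_length w)"
  using cox_length_mult_le[of w s] cox_length_generator[of s] by simp

lemma cox_length_mult_left_le:
  "w \<in> carrier W \<Longrightarrow> s \<in> S \<Longrightarrow> cox_length (s \<otimes> w) \<le> Suc (cox_length w)"
  using cox_length_mult_le[of s w] cox_length_generator[of s] by simp

lemma exists_first_letter:
  assumes "w \<in> carrier W" "w \<noteq> \<one>"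
  shows "\<exists>s\<in>S. \<exists>v\<in>carrier W. w = s \<otimes> v \<and> cox_length w = Suc (cox_length v)"
proof -
  obtain ws where ws: "ws \<in> lists S" "length ws = cox_length w" "word_prod W ws = w"
    using exists_reduced_word assms by blast
  then obtain s us where su: "ws = s # us" using assms(2) by (cases ws) auto
  let ?v = "word_prod W us"
  have "s \<in> S" "?v \<in> carrier W" "w = s \<otimes> ?v" using ws su by auto
  moreover have "cox_length ?v \<le> length us" using cox_length_le ws su by simp
  moreover have "cox_length w \<le> Suc (cox_length ?v)"
    using cox_length_mult_left_le calculation by simp
  ultimately show ?thesis using ws su by (metis le_antisym length_Cons not_less_eq_eq)
qed

lemma exists_last_letter:
  assumes "w \<in> carrier W" "w \<noteq> \<one>"
  shows "\<exists>s\<in>S. \<exists>v\<in>carrier W. w = v \<otimes> s \<and> cox_length w = Suc (cox_length v)"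
proof -
  obtain ws where ws: "ws \<in> lists S" "length ws = cox_length w" "word_prod W ws = w"
    using exists_reduced_word assms by blast
  then obtain s us where su: "ws = us @ [s]" using assms(2) by (cases ws rule: rev_cases) auto
  let ?v = "word_prod W us"
  have "s \<in> S" "?v \<in> carrier W" "w = ?v \<otimes> s" using ws su word_prod_append[of us "[s]"] by auto
  moreover have "cox_length ?v \<le> length us" using cox_length_le ws su by simp
  moreover have "cox_length w \<le> Suc (cox_length ?v)"
    using cox_length_mult_right_le calculation by simp
  ultimately show ?thesis using ws su
    by (metis le_antisym length_append_singleton not_less_eq_eq)
qed

end

section \<open>The geometric representation\<close>

context geometric_representation
begin

lemma B_simps [simp]:
  "B (x + y) z = B x z + B y z" "B z (x + y) = B z x + B z y"
  "B (x - y) z = B x z - B y z" "B z (x - y) = B z x - B z y"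
  "B (r *\<^sub>R x) z = r * B x z" "B z (r *\<^sub>R x) = r * B z x"
  "B (- x) z = - B x z" "B z (- x) = - B z x"
  "B 0 z = 0" "B z 0 = 0"
  using B_bilinear
  by (simp_all add: bilinear_ladd bilinear_radd bilinear_lsub bilinear_rsub bilinear_lmul
      bilinear_rmul bilinear_lneg bilinear_rneg bilinear_lzero bilinear_rzero)

lemma rep_in: "w \<in> carrier W \<Longrightarrow> \<rho> w \<in> carrier (orthogonal_group B)"
  using rep_hom by (auto simp: hom_def)

lemma rep_linear: "w \<in> carrier W \<Longrightarrow> linear (\<rho> w)"
  and rep_bij: "w \<in> carrier W \<Longrightarrow> bij (\<rho> w)"
  and rep_B [simp]: "w \<in> carrier W \<Longrightarrow> B (\<rho> w u) (\<rho> w v) = B u v"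
  using rep_in by (auto simp: orthogonal_group_def)

lemma rep_simps [simp]:
  assumes "w \<in> carrier W"
  shows "\<rho> w (x + y) = \<rho> w x + \<rho> w y" "\<rho> w (x - y) = \<rho> w x - \<rho> w y"
    "\<rho> w (- x) = - \<rho> w x" "\<rho> w (r *\<^sub>R x) = r *\<^sub>R \<rho> w x" "\<rho> w 0 = 0"
  using rep_linear[OF assms]
  by (simp_all add: linear_add linear_diff linear_neg linear_scale linear_0)

lemma rep_mult: "u \<in> carrier W \<Longrightarrow> v \<in> carrier W \<Longrightarrow> \<rho> (u \<otimes> v) x = \<rho> u (\<rho> v x)"
  using rep_hom by (auto simp: hom_def orthogonal_group_def)

lemma rep_one [simp]: "\<rho> \<one> x = x"
proof -
  have "\<rho> \<one> (\<rho> \<one> x) = \<rho> \<one> x" using rep_mult[of \<one> \<one>] by simp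
  then show ?thesis using rep_bij[of \<one>] by (auto simp: bij_def inj_def)
qed

lemma rep_inv_left [simp]: "w \<in> carrier W \<Longrightarrow> \<rho> (inv w) (\<rho> w x) = x"
  and rep_inv_right [simp]: "w \<in> carrier W \<Longrightarrow> \<rho> w (\<rho> (inv w) x) = x"
  using rep_mult[of "inv w" w x] rep_mult[of w "inv w" x] by simp_all

lemma rep_eq_iff [simp]: "w \<in> carrier W \<Longrightarrow> \<rho> w x = \<rho> w y \<longleftrightarrow> x = y"
  by (metis rep_inv_left)

lemma rep_eqI:
  assumes "u \<in> carrier W" "v \<in> carrier W" "\<And>x. \<rho> u x = \<rho> v x"
  shows "u = v"
  using rep_faithful assms by (auto simp: inj_on_def)

lemma rep_S_twice [simp]: "s \<in> S \<Longrightarrow> \<rho> s (\<rho> s x) = x"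
  using rep_inv_left[of s x] by simp

lemma rep_S_self [simp]: "s \<in> S \<Longrightarrow> \<rho> s (\<alpha> s) = - \<alpha> s"
  by (simp add: rep_simple simple_unit scaleR_2)

abbreviation pos_cone :: "'v set" where
  "pos_cone \<equiv> nonneg_cone (\<alpha> ` S)"

lemma simple_pos_cone: "s \<in> S \<Longrightarrow> \<alpha> s \<in> pos_cone"
  by (simp add: nonneg_cone_superset)

lemma pos_cone_sum:
  assumes "x \<in> pos_cone"
  shows "\<exists>a. (\<forall>s\<in>S. 0 \<le> a s) \<and> x = (\<Sum>s\<in>S. a s *\<^sub>R \<alpha> s)"
  using assms
proof (induction rule: nonneg_cone_induct)
  case zero
  then show ?case by (intro exI[of _ "\<lambda>_. 0"]) simp
next
  case (add_term v c x)
  then obtain a t where a: "\<forall>s\<in>S. 0 \<le> a s" "x = (\<Sum>s\<in>S. a s *\<^sub>R \<alpha> s)" and t: "t \<in> S" "v = \<alpha> t"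
    by blast
  have "(\<Sum>s\<in>S. (a s + (if s = t then c else 0)) *\<^sub>R \<alpha> s)
    = x + (\<Sum>s\<in>S. (if s = t then c *\<^sub>R \<alpha> s else 0))"
    unfolding a(2) scaleR_add_left sum.distrib by (intro arg_cong2[of _ _ _ _ "(+)"] sum.cong) auto
  also have "\<dots> = c *\<^sub>R v + x" using t finite_S by simp
  finally show ?case using a(1) add_term(2)
    by (intro exI[of _ "\<lambda>s. a s + (if s = t then c else 0)"]) auto
qed

text \<open>Positive independence of the simple roots, in the form in which it is used throughout: the cone
  that they span contains no line.\<close>

lemma pos_cone_salient:
  assumes "x \<in> pos_cone" "y \<in> pos_cone" "x + y = 0"
  shows "x = 0"
proof -
  obtain a b where a: "\<forall>s\<in>S. 0 \<le> a s" "x = (\<Sum>s\<in>S. a s *\<^sub>R \<alpha> s)"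
    and b: "\<forall>s\<in>S. 0 \<le> b s" "y = (\<Sum>s\<in>S. b s *\<^sub>R \<alpha> s)"
    using pos_cone_sum assms by meson
  have "(\<Sum>s\<in>S. (a s + b s) *\<^sub>R \<alpha> s) = 0"
    using assms(3) a(2) b(2) by (simp add: scaleR_add_left sum.distrib)
  then have "a s + b s = 0" if "s \<in> S" for s
    using simple_positively_independent[of "\<lambda>s. a s + b s" s] a(1) b(1) that by auto
  then have "a s = 0" if "s \<in> S" for s using a(1) b(1) that
    by (metis add_nonneg_eq_0_iff)
  then show ?thesis using a(2) by simp
qed

lemma pos_cone_neg_eq_0: "x \<in> pos_cone \<Longrightarrow> - x \<in> pos_cone \<Longrightarrow> x = 0"
  using pos_cone_salient[of x "- x"] by simp

lemma simple_B_le_0: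
  assumes "s \<in> S" "t \<in> S" "s \<noteq> t"
  shows "B (\<alpha> s) (\<alpha> t) \<le> 0"
proof -
  have "0 \<le> cos (pi / real k)" if "2 \<le> k" for k
    by (rule cos_ge_zero)
      (use that pi_gt_zero in \<open>auto simp: field_simps intro: order_trans[of _ 0]\<close>)
  then show ?thesis using simple_product[OF assms] by auto
qed

text \<open>Twice the negative of the form is the natural parameter of a pair of simple roots: the
  reflection in one sends the other, \<open>\<beta>\<close>, to \<open>\<beta>\<close> plus that multiple of the first.\<close>

definition bond :: "'w \<Rightarrow> 'w \<Rightarrow> real" where
  "bond s t = - 2 * B (\<alpha> s) (\<alpha> t)"

lemma bond_sym: "bond s t = bond t s"
  by (simp add: bond_def B_symmetric)

lemma bond_nonneg: "s \<in> S \<Longrightarrow> t \<in> S \<Longrightarrow> s \<noteq> t \<Longrightarrow> 0 \<le> bond s t"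
  using simple_B_le_0 by (simp add: bond_def)

lemma simple_B_bond: "B (\<alpha> s) (\<alpha> t) = - bond s t / 2"
  by (simp add: bond_def)

lemma rep_simple_bond: "s \<in> S \<Longrightarrow> \<rho> s (\<alpha> t) = \<alpha> t + bond s t *\<^sub>R \<alpha> s"
  by (simp add: rep_simple bond_def)

lemma simple_combination_eq_0:
  assumes "s \<in> S" "t \<in> S" "0 < a" "0 \<le> b"
  shows "a *\<^sub>R \<alpha> s + b *\<^sub>R \<alpha> t \<noteq> 0"
proof
  assume "a *\<^sub>R \<alpha> s + b *\<^sub>R \<alpha> t = 0"
  then have "a *\<^sub>R \<alpha> s = 0"
    using pos_cone_salient nonneg_cone_scale simple_pos_cone assms by (meson less_imp_le)
  then have "\<alpha> s = 0" using assms by simp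
  then show False using simple_unit[OF assms(1)] by simp
qed

text \<open>Comparing the two sides of the braid relation on a simple root gives a multiple of
  \<open>2 \<alpha>\<^sub>t + c \<alpha>\<^sub>s\<close>, where \<open>c\<close> is the bond; this vector is not zero because \<open>c \<ge> 0\<close>. The simple roots need not
  be linearly independent, so coefficients cannot be compared.\<close>

lemma bond_order_two:
  assumes "s \<in> S" "t \<in> S" "s \<noteq> t" "ord (s \<otimes> t) = 2"
  shows "bond s t = 0" "s \<otimes> t = t \<otimes> s"
proof -
  have "(s \<otimes> t) \<otimes> (s \<otimes> t) = \<one>"
    using pow_ord_eq_1[of "s \<otimes> t"] assms by (simp add: numeral_2_eq_2)
  then have "inv (s \<otimes> t) = s \<otimes> t" using inv_equality assms by simp
  then show st: "s \<otimes> t = t \<otimes> s" using assms by (simp add: inv_mult_group)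
  show "bond s t = 0"
  proof (rule ccontr)
    let ?c = "bond s t"
    assume "?c \<noteq> 0"
    then have "?c > 0" using bond_nonneg assms by (simp add: order_less_le)
    have "\<rho> s (\<rho> t (\<alpha> s)) = \<rho> t (\<rho> s (\<alpha> s))"
      using rep_mult assms st by (metis S_carrier)
    then have "?c *\<^sub>R (2 *\<^sub>R \<alpha> t + ?c *\<^sub>R \<alpha> s) = 0"
      using assms by (simp add: rep_simple_bond bond_sym[of t s] algebra_simps scaleR_2)
    then show False using \<open>?c > 0\<close> simple_combination_eq_0[of t s 2 ?c] assms by simp
  qed
qed

lemma bond_order_three:
  assumes "s \<in> S" "t \<in> S" "s \<noteq> t" "ord (s \<otimes> t) = 3"
  shows "bond s t = 1" "s \<otimes> t \<otimes> s = t \<otimes> s \<otimes> t"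
proof -
  have "(s \<otimes> t) \<otimes> (s \<otimes> t) \<otimes> (s \<otimes> t) = \<one>"
    using pow_ord_eq_1[of "s \<otimes> t"] assms by (simp add: numeral_3_eq_3)
  then have "(s \<otimes> t \<otimes> s) \<otimes> (t \<otimes> s \<otimes> t) = \<one>" using assms by (simp add: m_assoc)
  then have "s \<otimes> t \<otimes> s = inv (t \<otimes> s \<otimes> t)" using inv_equality assms by (metis S_carrier m_closed)
  then show st: "s \<otimes> t \<otimes> s = t \<otimes> s \<otimes> t" using assms by (simp add: inv_mult_group m_assoc)
  let ?c = "bond s t"
  have "\<rho> s (\<rho> t (\<rho> s (\<alpha> s))) = \<rho> t (\<rho> s (\<rho> t (\<alpha> s)))"
    using rep_mult assms st by (metis S_carrier m_closed)
  moreover have "(?c * ?c - 1) *\<^sub>R (2 *\<^sub>R \<alpha> s + ?c *\<^sub>R \<alpha> t)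
      = \<rho> t (\<rho> s (\<rho> t (\<alpha> s))) - \<rho> s (\<rho> t (\<rho> s (\<alpha> s)))"
    using assms by (simp add: rep_simple_bond bond_sym[of t s] algebra_simps scaleR_2)
  ultimately have "(?c * ?c - 1) *\<^sub>R (2 *\<^sub>R \<alpha> s + ?c *\<^sub>R \<alpha> t) = 0" by simp
  then have "?c * ?c = 1"
    using simple_combination_eq_0[of s t 2 ?c] bond_nonneg assms by auto
  then show "?c = 1" using bond_nonneg[OF assms(1-3)]
    by (metis abs_of_nonneg abs_square_eq_1 power2_eq_square)
qed

text \<open>If the form were \<open>- cos (\<pi> / k)\<close>, then \<open>s t\<close> would rotate the plane of the two simple roots
  through \<open>2 \<pi> / k\<close> and fix its orthogonal complement, so it would have finite order by
  faithfulness.\<close>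

lemma bond_order_infinite:
  assumes "s \<in> S" "t \<in> S" "s \<noteq> t" "ord (s \<otimes> t) = 0"
  shows "2 \<le> bond s t"
proof (rule ccontr)
  assume "\<not> 2 \<le> bond s t"
  then obtain k :: nat where k: "2 \<le> k" "B (\<alpha> s) (\<alpha> t) = - cos (pi / real k)"
    using simple_product[OF assms(1-3)] by (auto simp: bond_def)
  define \<theta> where "\<theta> = pi / real k"
  have c: "bond s t = 2 * cos \<theta>" "bond t s = 2 * cos \<theta>"
    using k by (auto simp: bond_def \<theta>_def B_symmetric[of "\<alpha> t"])
  have "0 < \<theta>" "\<theta> < pi" using k by (auto simp: \<theta>_def field_simps)
  then have sin_pos: "sin \<theta> > 0" by (rule sin_gt_zero)
  \<comment> \<open>Up to the factor \<open>sin \<theta>\<close>, the unit vector at angle \<open>\<phi>\<close> from \<open>\<alpha>\<^sub>s\<close>.\<close>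
  define p where "p \<phi> = sin (\<phi> + \<theta>) *\<^sub>R \<alpha> s + sin \<phi> *\<^sub>R \<alpha> t" for \<phi>
  have trig: "2 * cos \<theta> * sin (x + \<theta>) - sin x = sin (x + 2 * \<theta>)" for x
  proof -
    have twice: "x + 2 * \<theta> = (x + \<theta>) + \<theta>" by simp
    have "sin x = sin (x + \<theta>) * cos \<theta> - cos (x + \<theta>) * sin \<theta>"
      using sin_diff[of "x + \<theta>" \<theta>] by simp
    moreover have "sin (x + 2 * \<theta>) = sin (x + \<theta>) * cos \<theta> + cos (x + \<theta>) * sin \<theta>"
      unfolding twice by (rule sin_add)
    ultimately show ?thesis by (simp only:) (simp only: mult.commute mult_2 distrib_left, simp)
  qed
  let ?g = "s \<otimes> t"
  have step: "\<rho> ?g (p \<phi>) = p (\<phi> + 2 * \<theta>)" for \<phi>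
  proof -
    have "\<rho> t (p \<phi>) = sin (\<phi> + \<theta>) *\<^sub>R \<alpha> s + (2 * cos \<theta> * sin (\<phi> + \<theta>) - sin \<phi>) *\<^sub>R \<alpha> t"
      using assms by (simp add: p_def rep_simple_bond c algebra_simps)
    also have "\<dots> = sin (\<phi> + \<theta>) *\<^sub>R \<alpha> s + sin (\<phi> + 2 * \<theta>) *\<^sub>R \<alpha> t"
      by (simp only: trig)
    finally have "\<rho> s (\<rho> t (p \<phi>)) = (2 * cos \<theta> * sin ((\<phi> + \<theta>) + \<theta>) - sin (\<phi> + \<theta>)) *\<^sub>R \<alpha> s
        + sin (\<phi> + 2 * \<theta>) *\<^sub>R \<alpha> t"
      using assms by (simp add: rep_simple_bond c algebra_simps)
    also have "\<dots> = p (\<phi> + 2 * \<theta>)"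
      by (simp only: trig p_def) (simp add: algebra_simps)
    finally show ?thesis using assms by (simp add: rep_mult)
  qed
  have g: "?g \<in> carrier W" using assms by simp
  have iter: "\<rho> (?g [^] (j::nat)) (p \<phi>) = p (\<phi> + 2 * real j * \<theta>)" for j \<phi>
  proof (induction j arbitrary: \<phi>)
    case (Suc j)
    then show ?case using g step[of \<phi>] by (simp add: rep_mult algebra_simps)
  qed simp
  have period: "\<rho> (?g [^] k) (p \<phi>) = p \<phi>" for \<phi>
  proof -
    have "\<phi> + 2 * real k * \<theta> = \<phi> + 2 * pi" using k by (simp add: \<theta>_def)
    moreover have "p (\<phi> + 2 * pi) = p \<phi>"
      using sin_periodic[of "\<phi> + \<theta>"] sin_periodic[of \<phi>] by (simp add: p_def algebra_simps)
    ultimately show ?thesis by (simp only: iter)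
  qed
  have "\<rho> (?g [^] k) (\<alpha> s) = \<alpha> s"
    using period[of 0] sin_pos g by (simp add: p_def)
  note fix_s = this
  have fix_t: "\<rho> (?g [^] k) (\<alpha> t) = \<alpha> t"
    using period[of "- \<theta>"] sin_pos g by (simp add: p_def)
  have fixed: "\<rho> (?g [^] (j::nat)) x = x" if "B (\<alpha> s) x = 0" "B (\<alpha> t) x = 0" for x j
    by (induction j) (use that assms in \<open>simp_all add: rep_mult rep_simple\<close>)
  \<comment> \<open>The form is nondegenerate on the plane, with Gram determinant \<open>sin\<^sup>2 \<theta>\<close>.\<close>
  have decompose: "\<exists>a b y. x = a *\<^sub>R \<alpha> s + b *\<^sub>R \<alpha> t + y \<and> B (\<alpha> s) y = 0 \<and> B (\<alpha> t) y = 0" for x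
  proof -
    define D where "D = 1 - cos \<theta> * cos \<theta>"
    have "D = sin \<theta> * sin \<theta>" using sin_squared_eq[of \<theta>] by (simp add: D_def power2_eq_square)
    then have D: "D \<noteq> 0" using sin_pos by simp
    define X Y a b where "X = B (\<alpha> s) x" "Y = B (\<alpha> t) x"
      "a = (X + cos \<theta> * Y) / D" "b = (Y + cos \<theta> * X) / D"
    have "X - (a - b * cos \<theta>) = 0" "Y - (b - a * cos \<theta>) = 0"
      using D unfolding X_Y_a_b_def(3,4)
      by (simp_all add: field_simps) (simp_all add: D_def algebra_simps)
    moreover have "B (\<alpha> s) (\<alpha> t) = - cos \<theta>" "B (\<alpha> t) (\<alpha> s) = - cos \<theta>"
      using k(2) B_symmetric[of "\<alpha> t" "\<alpha> s"] by (simp_all add: \<theta>_def)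
    ultimately have "B (\<alpha> s) (x - a *\<^sub>R \<alpha> s - b *\<^sub>R \<alpha> t) = 0"
      "B (\<alpha> t) (x - a *\<^sub>R \<alpha> s - b *\<^sub>R \<alpha> t) = 0"
      using assms by (simp_all add: simple_unit X_Y_a_b_def(1,2))
    then show ?thesis by (intro exI[of _ a] exI[of _ b] exI[of _ "x - a *\<^sub>R \<alpha> s - b *\<^sub>R \<alpha> t"]) simp
  qed
  have "\<rho> (?g [^] k) x = x" for x
  proof -
    obtain a b y where "x = a *\<^sub>R \<alpha> s + b *\<^sub>R \<alpha> t + y" "B (\<alpha> s) y = 0" "B (\<alpha> t) y = 0"
      using decompose by blast
    then show ?thesis using fix_s fix_t fixed[of y k] g by simp
  qed
  then have "?g [^] k = \<one>" using rep_eqI[of "?g [^] k" \<one>] g by simp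
  then have "ord ?g dvd k" using pow_eq_id g by simp
  then show False using assms(4) k by simp
qed

end

section \<open>Positive and negative roots\<close>

text \<open>The setting of the theorem as a locale. The restriction on the entries leaves three values for a
  bond between distinct generators: \<open>0\<close>, \<open>1\<close>, or at least \<open>2\<close>.\<close>

locale three_infinity_representation = geometric_representation W S B \<alpha> \<rho>
  for W :: "('w, 'm) monoid_scheme" (structure) and S :: "'w set"
    and B :: "'v::real_vector \<Rightarrow> 'v \<Rightarrow> real" and \<alpha> :: "'w \<Rightarrow> 'v" and \<rho> :: "'w \<Rightarrow> 'v \<Rightarrow> 'v" +
  assumes entries: "s \<in> S \<Longrightarrow> t \<in> S \<Longrightarrow> coxeter_matrix W s t \<in> {1, 2, 3, \<infinity>}"
begin

lemma bond_cases:
  assumes "s \<in> S" "t \<in> S" "s \<noteq> t"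
  obtains "bond s t = 0" "s \<otimes> t = t \<otimes> s"
  | "bond s t = 1" "s \<otimes> t \<otimes> s = t \<otimes> s \<otimes> t"
  | "2 \<le> bond s t"
proof -
  have "ord (s \<otimes> t) \<noteq> 1"
  proof
    assume "ord (s \<otimes> t) = 1"
    then have "s \<otimes> t = \<one>" using pow_ord_eq_1[of "s \<otimes> t"] assms by simp
    then have "inv t = s" using inv_equality[of s t] assms by (simp del: S_inv)
    then show False using assms by simp
  qed
  moreover have "ord (s \<otimes> t) \<in> {0, 1, 2, 3}"
    using entries[OF assms(1,2)]
    by (auto simp: coxeter_matrix_def Let_def numeral_eq_enat one_enat_def split: if_splits)
  ultimately show ?thesis
    using that bond_order_two bond_order_three bond_order_infinite assms by blast
qed

text \<open>The basic link between length and positivity. A last letter \<open>t\<close> of \<open>w\<close> is stripped off. When the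
  bond of \<open>s\<close> and \<open>t\<close> is \<open>0\<close> or \<open>1\<close>, at most two letters of the dihedral subgroup have to go
  before induction applies. For an infinite bond an unbounded alternating word may have to go, and the
  second statement is an invariant for this: stripping \<open>t\<close> turns \<open>a \<alpha>\<^sub>s + b \<alpha>\<^sub>t\<close> into
  \<open>(a c - b) \<alpha>\<^sub>t + a \<alpha>\<^sub>s\<close>, and with \<open>c \<ge> 2\<close> the letter that was not stripped keeps the smaller
  coefficient.\<close>

lemma length_increasing_positive:
  assumes "w \<in> carrier W"
  shows "(\<forall>s\<in>S. cox_length w \<le> cox_length (w \<otimes> s) \<longrightarrow> \<rho> w (\<alpha> s) \<in> pos_cone) \<and>
    (\<forall>s\<in>S. \<forall>t\<in>S. \<forall>a b. s \<noteq> t \<and> 2 \<le> bond s t \<and> 0 \<le> b \<and> b \<le> a \<and>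
      cox_length w \<le> cox_length (w \<otimes> s) \<longrightarrow> \<rho> w (a *\<^sub>R \<alpha> s + b *\<^sub>R \<alpha> t) \<in> pos_cone)"
  using assms
proof (induction "cox_length w" arbitrary: w rule: less_induct)
  case less
  let ?l = cox_length
  have w: "w \<in> carrier W" by (rule less.prems)
  have IH1: "\<rho> v (\<alpha> s) \<in> pos_cone"
    if "v \<in> carrier W" "?l v < ?l w" "s \<in> S" "?l v \<le> ?l (v \<otimes> s)" for v s
    using less.hyps[of v] that by blast
  have IH2: "\<rho> v (a *\<^sub>R \<alpha> s + b *\<^sub>R \<alpha> t) \<in> pos_cone"
    if "v \<in> carrier W" "?l v < ?l w" "s \<in> S" "?l v \<le> ?l (v \<otimes> s)" "t \<in> S" "s \<noteq> t"
      "2 \<le> bond s t" "0 \<le> b" "b \<le> a" for v s t a b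
    using less.hyps[of v] that by blast
  have descend: "\<rho> w (a *\<^sub>R \<alpha> s + b *\<^sub>R \<alpha> t) \<in> pos_cone"
    if st: "s \<in> S" "t \<in> S" "s \<noteq> t" "2 \<le> bond s t" "0 \<le> b" "b \<le> a" "?l (w \<otimes> t) < ?l w"
    for s t a b
  proof -
    have "2 * a \<le> bond s t * a" using st by (intro mult_right_mono) auto
    then have "\<rho> (w \<otimes> t) ((a * bond s t - b) *\<^sub>R \<alpha> t + a *\<^sub>R \<alpha> s) \<in> pos_cone"
      using IH2[of "w \<otimes> t" t s a "a * bond s t - b"] w st by (simp add: bond_sym[of t s] mult.commute)
    moreover have "\<rho> t (a *\<^sub>R \<alpha> s + b *\<^sub>R \<alpha> t) = (a * bond s t - b) *\<^sub>R \<alpha> t + a *\<^sub>R \<alpha> s"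
      using st by (simp add: rep_simple_bond bond_sym[of t s] algebra_simps)
    moreover have "\<rho> w (a *\<^sub>R \<alpha> s + b *\<^sub>R \<alpha> t) = \<rho> (w \<otimes> t) (\<rho> t (a *\<^sub>R \<alpha> s + b *\<^sub>R \<alpha> t))"
      using rep_mult[of w t] rep_S_twice[OF st(2)] w st(2) by simp
    ultimately show ?thesis by simp
  qed
  have ascend: "\<rho> w (\<alpha> s) \<in> pos_cone" if s: "s \<in> S" "?l w \<le> ?l (w \<otimes> s)" for s
  proof (cases "w = \<one>")
    case True
    then show ?thesis using s simple_pos_cone by simp
  next
    case False
    obtain t v where t: "t \<in> S" and v: "v \<in> carrier W" and wv: "w = v \<otimes> t" and l: "?l w = Suc (?l v)"
      using exists_last_letter[OF w False] by blast
    have "s \<noteq> t" using s t v wv l by auto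
    have ws: "\<rho> w (\<alpha> s) = \<rho> v (\<alpha> s) + bond s t *\<^sub>R \<rho> v (\<alpha> t)"
      using wv v t by (simp add: rep_mult rep_simple_bond bond_sym[of s])
    have vt: "\<rho> v (\<alpha> t) \<in> pos_cone" using IH1[of v t] v t l wv by simp
    show ?thesis
      using s(1) t \<open>s \<noteq> t\<close>
    proof (cases rule: bond_cases)
      case 1
      have "?l v \<le> ?l (v \<otimes> s)"
      proof (rule ccontr)
        assume "\<not> ?l v \<le> ?l (v \<otimes> s)"
        moreover have "w \<otimes> s = v \<otimes> s \<otimes> t" using wv v s t 1 by (simp add: m_assoc)
        moreover have "?l (v \<otimes> s \<otimes> t) \<le> Suc (?l (v \<otimes> s))"
          using cox_length_mult_right_le v s t by simp
        ultimately show False using s l by simp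
      qed
      then show ?thesis using ws 1 IH1[of v s] v s l by simp
    next
      case 2
      show ?thesis
      proof (cases "?l v \<le> ?l (v \<otimes> s)")
        case True
        then show ?thesis using ws 2 IH1[of v s] v s l vt by (simp add: nonneg_cone_add)
      next
        case False
        let ?u = "v \<otimes> s"
        \<comment> \<open>Here \<open>w = u s t\<close>. If \<open>u\<close> ended in \<open>t\<close>, then \<open>w\<close> would end in \<open>t s t = s t s\<close>, against the choice of \<open>s\<close>.\<close>
        have u: "?u \<in> carrier W" using v s by simp
        have "\<rho> w (\<alpha> s) = \<rho> ?u (\<alpha> t)"
          using ws 2 v s t by (simp add: rep_mult rep_simple_bond)
        moreover have "?l ?u \<le> ?l (?u \<otimes> t)"
        proof (rule ccontr)
          assume *: "\<not> ?l ?u \<le> ?l (?u \<otimes> t)"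
          let ?x = "?u \<otimes> t"
          have x: "?x \<in> carrier W" using u t by simp
          have "?x \<otimes> s \<otimes> t = v \<otimes> (s \<otimes> t \<otimes> s) \<otimes> t" using v s t by (simp add: m_assoc)
          also have "\<dots> = w \<otimes> s" using v s t wv 2 by (simp add: m_assoc)
          finally have "?l (w \<otimes> s) \<le> Suc (Suc (?l ?x))"
            using cox_length_mult_right_le[of ?x s] cox_length_mult_right_le[of "?x \<otimes> s" t] x s t
            by simp
          then show False using * False s l by simp
        qed
        ultimately show ?thesis using IH1[of ?u t] u t False l by simp
      qed
    next
      case 3
      then show ?thesis using descend[of s t 0 1] s t v wv l \<open>s \<noteq> t\<close> by simp
    qed
  qed
  moreover have "\<rho> w (a *\<^sub>R \<alpha> s + b *\<^sub>R \<alpha> t) \<in> pos_cone"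
    if "s \<in> S" "t \<in> S" "s \<noteq> t" "2 \<le> bond s t" "0 \<le> b" "b \<le> a" "?l w \<le> ?l (w \<otimes> s)" for s t a b
  proof (cases "?l w \<le> ?l (w \<otimes> t)")
    case True
    then show ?thesis using ascend that w by (simp add: nonneg_cone_add nonneg_cone_scale)
  next
    case False
    then show ?thesis using descend that by simp
  qed
  ultimately show ?case by blast
qed

lemma root_in_pos_cone_or_neg:
  assumes "\<beta> \<in> roots"
  shows "\<beta> \<in> pos_cone \<or> - \<beta> \<in> pos_cone"
proof -
  obtain w s where ws: "w \<in> carrier W" "s \<in> S" "\<beta> = \<rho> w (\<alpha> s)"
    using assms by (auto simp: roots_def)
  show ?thesis
  proof (cases "cox_length w \<le> cox_length (w \<otimes> s)")
    case True
    then show ?thesis using length_increasing_positive ws by blast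
  next
    case False
    then have "\<rho> (w \<otimes> s) (\<alpha> s) \<in> pos_cone"
      using length_increasing_positive[of "w \<otimes> s"] ws by simp
    then show ?thesis using ws by (simp add: rep_mult)
  qed
qed

lemma simple_root: "s \<in> S \<Longrightarrow> \<alpha> s \<in> roots"
  unfolding roots_def by (rule CollectI, rule exI[of _ \<one>]) auto

lemma rep_root:
  assumes "w \<in> carrier W" "\<beta> \<in> roots"
  shows "\<rho> w \<beta> \<in> roots"
proof -
  obtain u s where us: "u \<in> carrier W" "s \<in> S" "\<beta> = \<rho> u (\<alpha> s)"
    using assms by (auto simp: roots_def)
  then have "\<rho> w \<beta> = \<rho> (w \<otimes> u) (\<alpha> s)" using assms by (simp add: rep_mult)
  then show ?thesis using us assms(1) m_closed unfolding roots_def by blast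
qed

lemma neg_root: "\<beta> \<in> roots \<Longrightarrow> - \<beta> \<in> roots"
proof -
  assume "\<beta> \<in> roots"
  then obtain w s where ws: "w \<in> carrier W" "s \<in> S" "\<beta> = \<rho> w (\<alpha> s)" by (auto simp: roots_def)
  then have "- \<beta> = \<rho> (w \<otimes> s) (\<alpha> s)" by (simp add: rep_mult)
  then show "- \<beta> \<in> roots" using ws m_closed S_carrier unfolding roots_def by blast
qed

lemma neg_root_iff [simp]: "- \<beta> \<in> roots \<longleftrightarrow> \<beta> \<in> roots"
  using neg_root[of \<beta>] neg_root[of "- \<beta>"] by auto

lemma root_unit: "\<beta> \<in> roots \<Longrightarrow> B \<beta> \<beta> = 1"
  by (auto simp: roots_def simple_unit)

lemma root_nonzero: "\<beta> \<in> roots \<Longrightarrow> \<beta> \<noteq> 0"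
  using root_unit by fastforce

lemma pos_root_root: "\<beta> \<in> pos_roots \<Longrightarrow> \<beta> \<in> roots"
  and pos_root_cone: "\<beta> \<in> pos_roots \<Longrightarrow> \<beta> \<in> pos_cone"
  and pos_rootI: "\<beta> \<in> roots \<Longrightarrow> \<beta> \<in> pos_cone \<Longrightarrow> \<beta> \<in> pos_roots"
  by (auto simp: pos_roots_def)

lemma simple_pos_root: "s \<in> S \<Longrightarrow> \<alpha> s \<in> pos_roots"
  by (simp add: pos_rootI simple_root simple_pos_cone)

lemma pos_or_neg: "\<beta> \<in> roots \<Longrightarrow> \<beta> \<in> pos_roots \<or> - \<beta> \<in> pos_roots"
  using root_in_pos_cone_or_neg[of \<beta>] pos_rootI[of \<beta>] pos_rootI[of "- \<beta>"] by auto

lemma not_pos_and_neg: "\<beta> \<in> pos_roots \<Longrightarrow> - \<beta> \<in> pos_roots \<Longrightarrow> False"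
  using pos_cone_neg_eq_0 pos_root_cone pos_root_root root_nonzero by blast

lemma neg_pos_iff: "\<beta> \<in> roots \<Longrightarrow> - \<beta> \<in> pos_roots \<longleftrightarrow> \<beta> \<notin> pos_roots"
  using pos_or_neg not_pos_and_neg by blast

text \<open>Roots have norm one, so a ray contains at most one positive root.\<close>

lemma proportional_pos_roots:
  assumes "\<beta> \<in> pos_roots" "\<gamma> \<in> pos_roots" "\<beta> = r *\<^sub>R \<gamma>"
  shows "\<beta> = \<gamma>"
proof -
  have "r * r = 1"
    using assms root_unit[of \<beta>] root_unit[of \<gamma>] pos_root_root by simp
  then have "r = 1 \<or> r = -1" by (simp add: square_eq_1_iff)
  then show ?thesis using assms not_pos_and_neg[of \<gamma>] by auto
qed

text \<open>A simple root is not a non-negative combination of the others, as it would have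
  non-positive product with itself.\<close>

lemma simple_reflection_permutes:
  assumes s: "s \<in> S" and \<beta>: "\<beta> \<in> pos_roots" "\<beta> \<noteq> \<alpha> s"
  shows "\<rho> s \<beta> \<in> pos_roots"
proof (rule ccontr)
  assume "\<rho> s \<beta> \<notin> pos_roots"
  then have neg: "- \<rho> s \<beta> \<in> pos_cone"
    using pos_or_neg rep_root s \<beta> pos_root_root pos_root_cone by (metis S_carrier)
  obtain r y where y: "0 \<le> r" "y \<in> nonneg_cone (\<alpha> ` S - {\<alpha> s})" "\<beta> = r *\<^sub>R \<alpha> s + y"
    using nonneg_cone_split pos_root_cone[OF \<beta>(1)] by blast
  obtain r' y' where y': "0 \<le> r'" "y' \<in> nonneg_cone (\<alpha> ` S - {\<alpha> s})" "- \<rho> s \<beta> = r' *\<^sub>R \<alpha> s + y'"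
    using nonneg_cone_split neg by blast
  have cone: "y \<in> pos_cone" "y' \<in> pos_cone" "y + y' \<in> nonneg_cone (\<alpha> ` S - {\<alpha> s})"
    using y y' nonneg_cone_mono[of "\<alpha> ` S - {\<alpha> s}" "\<alpha> ` S"] nonneg_cone_add by auto
  define k where "k = 2 * B (\<alpha> s) \<beta> - r - r'"
  have sum: "y + y' = k *\<^sub>R \<alpha> s"
  proof -
    have "\<beta> - \<rho> s \<beta> = (2 * B (\<alpha> s) \<beta>) *\<^sub>R \<alpha> s" using s by (simp add: rep_simple)
    moreover have "\<beta> - \<rho> s \<beta> = (r *\<^sub>R \<alpha> s + y) + (r' *\<^sub>R \<alpha> s + y')"
      unfolding y(3)[symmetric] y'(3)[symmetric] by simp
    ultimately show ?thesis unfolding k_def by (simp add: algebra_simps)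
  qed
  have "B (\<alpha> s) z \<le> 0" if "z \<in> nonneg_cone (\<alpha> ` S - {\<alpha> s})" for z
    using that
  proof (induction rule: nonneg_cone_induct)
    case (add_term a c x)
    then obtain t where t: "t \<in> S" "a = \<alpha> t" "t \<noteq> s" by blast
    then have "c * B (\<alpha> s) a \<le> 0" using simple_B_le_0 s add_term by (simp add: mult_nonneg_nonpos)
    then show ?case using add_term by simp
  qed simp
  then have "k \<le> 0" using cone(3) sum simple_unit[OF s] by fastforce
  then have "- (y + y') \<in> pos_cone"
    using sum nonneg_cone_scale[OF simple_pos_cone[OF s], of "- k"] by simp
  then have "y + y' = 0" using pos_cone_neg_eq_0 nonneg_cone_add cone by blast
  then have "y = 0" using pos_cone_salient cone by blast
  then have "\<beta> = r *\<^sub>R \<alpha> s" using y by simp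
  then show False using proportional_pos_roots \<beta> simple_pos_root s by blast
qed

lemma exists_positive_simple_product:
  assumes "\<beta> \<in> pos_roots"
  shows "\<exists>r\<in>S. 0 < B (\<alpha> r) \<beta>"
proof (rule ccontr)
  assume neg: "\<not> ?thesis"
  have "B z \<beta> \<le> 0" if "z \<in> pos_cone" for z
    using that
  proof (induction rule: nonneg_cone_induct)
    case (add_term a c x)
    then have "c * B a \<beta> \<le> 0" using neg by (intro mult_nonneg_nonpos) (auto simp: not_less)
    then show ?case using add_term by simp
  qed simp
  then show False using assms root_unit pos_root_cone pos_root_root by fastforce
qed

section \<open>Inversion sets\<close>

lemma mem_inversion_set:
  assumes "w \<in> carrier W"
  shows "\<beta> \<in> inversion_set w \<longleftrightarrow> \<beta> \<in> pos_roots \<and> - \<rho> (inv w) \<beta> \<in> pos_roots"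
proof -
  have "\<beta> \<in> \<rho> w ` neg_roots \<longleftrightarrow> - \<rho> (inv w) \<beta> \<in> pos_roots"
  proof
    assume "\<beta> \<in> \<rho> w ` neg_roots"
    then show "- \<rho> (inv w) \<beta> \<in> pos_roots" using assms by (auto simp: neg_roots_def)
  next
    assume "- \<rho> (inv w) \<beta> \<in> pos_roots"
    then show "\<beta> \<in> \<rho> w ` neg_roots"
      using assms image_eqI[of _ uminus "- \<rho> (inv w) \<beta>" pos_roots]
      by (intro image_eqI[of _ _ "\<rho> (inv w) \<beta>"]) (auto simp: neg_roots_def)
  qed
  then show ?thesis by (simp add: inversion_set_def)
qed

lemma inversion_set_pos: "\<beta> \<in> inversion_set w \<Longrightarrow> \<beta> \<in> pos_roots"
  by (simp add: inversion_set_def)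

lemma inversion_set_root: "\<beta> \<in> inversion_set w \<Longrightarrow> \<beta> \<in> roots"
  using inversion_set_pos pos_root_root by blast

lemma mem_inversion_set_not_pos:
  assumes "w \<in> carrier W" "\<beta> \<in> pos_roots"
  shows "\<beta> \<in> inversion_set w \<longleftrightarrow> \<rho> (inv w) \<beta> \<notin> pos_roots"
  using assms mem_inversion_set neg_pos_iff rep_root pos_root_root by simp

lemma inversion_set_one [simp]: "inversion_set \<one> = {}"
  using mem_inversion_set_not_pos[of \<one>] inversion_set_pos by fastforce

lemma inversion_set_root_cone:
  assumes w: "w \<in> carrier W" and A: "A \<subseteq> inversion_set w"
  shows "root_cone A \<subseteq> inversion_set w"
proof
  fix \<beta> assume "\<beta> \<in> root_cone A"
  then have \<beta>: "\<beta> \<in> nonneg_cone A" "\<beta> \<in> roots" by (auto simp: root_cone_def)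
  have "\<beta> \<in> pos_cone"
    using \<beta>(1) A nonneg_cone_subset[of A "\<alpha> ` S"] inversion_set_pos pos_root_cone by blast
  moreover have "(\<lambda>v. - \<rho> (inv w) v) \<beta> \<in> pos_cone"
    by (rule nonneg_cone_image[OF \<beta>(1)])
      (use A mem_inversion_set[OF w] pos_root_cone w in \<open>auto intro!: linearI\<close>)
  ultimately show "\<beta> \<in> inversion_set w"
    using \<beta>(2) w rep_root by (simp add: mem_inversion_set pos_rootI)
qed

lemma inversion_set_left:
  assumes w: "w \<in> carrier W" and s: "s \<in> S"
  shows "\<gamma> \<in> inversion_set (s \<otimes> w) \<longleftrightarrow>
    (if \<gamma> = \<alpha> s then \<alpha> s \<notin> inversion_set w else \<gamma> \<in> pos_roots \<and> \<rho> s \<gamma> \<in> inversion_set w)"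
proof -
  have eq: "\<rho> (inv (s \<otimes> w)) \<gamma> = \<rho> (inv w) (\<rho> s \<gamma>)"
    using w s by (simp add: inv_mult_group rep_mult)
  show ?thesis
  proof (cases "\<gamma> = \<alpha> s")
    case True
    have "\<gamma> \<in> inversion_set (s \<otimes> w) \<longleftrightarrow> \<rho> (inv w) (\<alpha> s) \<in> pos_roots"
      using True eq mem_inversion_set[of "s \<otimes> w" \<gamma>] w s simple_pos_root by simp
    then show ?thesis using True mem_inversion_set_not_pos w s simple_pos_root by simp
  next
    case False
    then show ?thesis
      using eq mem_inversion_set[of "s \<otimes> w" \<gamma>] mem_inversion_set[of w "\<rho> s \<gamma>"] w s
        simple_reflection_permutes[of s \<gamma>] by auto
  qed
qed

lemma inversion_set_right:
  assumes w: "w \<in> carrier W" and s: "s \<in> S" and pos: "\<rho> w (\<alpha> s) \<in> pos_roots"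
  shows "inversion_set (w \<otimes> s) = insert (\<rho> w (\<alpha> s)) (inversion_set w)"
    and "\<rho> w (\<alpha> s) \<notin> inversion_set w"
proof -
  show "\<rho> w (\<alpha> s) \<notin> inversion_set w"
    using mem_inversion_set_not_pos w s pos simple_pos_root by simp
  have "\<gamma> \<in> inversion_set (w \<otimes> s) \<longleftrightarrow> \<gamma> = \<rho> w (\<alpha> s) \<or> \<gamma> \<in> inversion_set w"
    if \<gamma>: "\<gamma> \<in> pos_roots" for \<gamma>
  proof -
    define \<delta> where "\<delta> = \<rho> (inv w) \<gamma>"
    have \<delta>: "\<gamma> = \<rho> w \<delta>" "\<delta> \<in> roots" using w \<gamma> rep_root pos_root_root by (auto simp: \<delta>_def)
    have eq: "\<rho> (inv (w \<otimes> s)) \<gamma> = \<rho> s \<delta>" using w s by (simp add: inv_mult_group rep_mult \<delta>_def)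
    show ?thesis
    proof (cases "\<delta> \<in> pos_roots")
      case True
      then show ?thesis using \<gamma> \<delta> eq w s mem_inversion_set_not_pos[of "w \<otimes> s" \<gamma>]
          mem_inversion_set_not_pos[of w \<gamma>] simple_reflection_permutes[of s \<delta>]
          not_pos_and_neg[OF simple_pos_root[OF s]]
        by (auto simp flip: \<delta>_def)
    next
      case False
      then have neg: "- \<delta> \<in> pos_roots" using \<delta> pos_or_neg by blast
      have "- \<delta> \<noteq> \<alpha> s" using \<delta> \<gamma> pos w not_pos_and_neg by (metis rep_simps(3))
      then have "- \<rho> s \<delta> \<in> pos_roots" using simple_reflection_permutes[OF s neg] s by simp
      then show ?thesis using \<gamma> \<delta> eq w s neg mem_inversion_set[of "w \<otimes> s" \<gamma>]
          mem_inversion_set[of w \<gamma>] by (simp flip: \<delta>_def)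
    qed
  qed
  then show "inversion_set (w \<otimes> s) = insert (\<rho> w (\<alpha> s)) (inversion_set w)"
    using inversion_set_pos pos by blast
qed

text \<open>Along a reduced word each new letter adds one inversion.\<close>

lemma inversion_set_finite_card:
  assumes "w \<in> carrier W"
  shows "finite (inversion_set w) \<and> card (inversion_set w) = cox_length w"
  using assms
proof (induction "cox_length w" arbitrary: w)
  case 0
  then have "w = \<one>" using cox_length_eq_0[of w] by simp
  then show ?case by simp
next
  case (Suc k)
  then have "w \<noteq> \<one>" by auto
  then obtain t v where t: "t \<in> S" "v \<in> carrier W" "w = v \<otimes> t" "cox_length w = Suc (cox_length v)"
    using exists_last_letter Suc.prems by blast
  then have "\<rho> v (\<alpha> t) \<in> pos_roots"
    using length_increasing_positive[of v] rep_root simple_root pos_rootI by auto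
  then show ?case using inversion_set_right[of v t] t Suc by simp
qed

lemma finite_inversion_set: "w \<in> carrier W \<Longrightarrow> finite (inversion_set w)"
  and card_inversion_set: "w \<in> carrier W \<Longrightarrow> card (inversion_set w) = cox_length w"
  using inversion_set_finite_card by auto

lemma inversion_set_left_insert:
  assumes w: "w \<in> carrier W" and s: "s \<in> S" and asc: "\<alpha> s \<notin> inversion_set w"
  shows "inversion_set (s \<otimes> w) = insert (\<alpha> s) (\<rho> s ` inversion_set w)"
    and "cox_length (s \<otimes> w) = Suc (cox_length w)"
proof -
  have img: "\<gamma> \<in> \<rho> s ` inversion_set w \<longleftrightarrow> \<rho> s \<gamma> \<in> inversion_set w" for \<gamma>
    using s by (metis image_iff rep_S_twice)
  have "\<alpha> s \<notin> \<rho> s ` inversion_set w"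
    using img[of "\<alpha> s"] rep_S_self[OF s] inversion_set_pos[of "- \<alpha> s" w]
      not_pos_and_neg[OF simple_pos_root[OF s]] by auto
  moreover show eq: "inversion_set (s \<otimes> w) = insert (\<alpha> s) (\<rho> s ` inversion_set w)"
  proof (rule Set.set_eqI)
    fix \<gamma>
    have "\<gamma> \<in> pos_roots" if "\<rho> s \<gamma> \<in> inversion_set w"
      using simple_reflection_permutes[OF s inversion_set_pos[OF that]] that asc rep_S_twice[OF s]
      by metis
    then show "\<gamma> \<in> inversion_set (s \<otimes> w) \<longleftrightarrow> \<gamma> \<in> insert (\<alpha> s) (\<rho> s ` inversion_set w)"
      unfolding inversion_set_left[OF w s, of \<gamma>] insert_iff img using asc by metis
  qed
  moreover have "inj_on (\<rho> s) (inversion_set w)" using s by (auto simp: inj_on_def)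
  ultimately show "cox_length (s \<otimes> w) = Suc (cox_length w)"
    using card_inversion_set[of w] card_inversion_set[of "s \<otimes> w"] finite_inversion_set[of w] w s
    by (simp add: card_image)
qed

lemma inversion_set_generator: "s \<in> S \<Longrightarrow> inversion_set s = {\<alpha> s}"
  using inversion_set_left_insert(1)[of \<one> s] by simp

lemma descent_iff:
  assumes w: "w \<in> carrier W" and s: "s \<in> S"
  shows "\<alpha> s \<in> inversion_set w \<longleftrightarrow> \<alpha> s \<notin> inversion_set (s \<otimes> w)"
  using inversion_set_left[OF w s, of "\<alpha> s"] by auto

lemma exists_descent:
  assumes w: "w \<in> carrier W" "w \<noteq> \<one>"
  shows "\<exists>s\<in>S. \<alpha> s \<in> inversion_set w"
proof -
  obtain s v where s: "s \<in> S" "v \<in> carrier W" "w = s \<otimes> v" "cox_length w = Suc (cox_length v)"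
    using exists_first_letter[OF w] by blast
  have "\<alpha> s \<notin> inversion_set v"
  proof
    assume "\<alpha> s \<in> inversion_set v"
    then have "cox_length v = Suc (cox_length w)"
      using inversion_set_left_insert(2)[of "s \<otimes> v" s] descent_iff[of v s] s by simp
    then show False using s by simp
  qed
  then show ?thesis using inversion_set_left[of v s "\<alpha> s"] s by auto
qed

lemma descent_length:
  assumes "w \<in> carrier W" "s \<in> S" "\<alpha> s \<in> inversion_set w"
  shows "cox_length w = Suc (cox_length (s \<otimes> w))"
    and "inversion_set w = insert (\<alpha> s) (\<rho> s ` inversion_set (s \<otimes> w))"
  using inversion_set_left_insert[of "s \<otimes> w" s] descent_iff[of w s] assms by auto

lemma prefix_inversion_set_subset:
  assumes "is_prefix u w" "w \<in> carrier W"
  shows "inversion_set u \<subseteq> inversion_set w"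
proof -
  obtain v where v: "u \<in> carrier W" "v \<in> carrier W" "w = u \<otimes> v"
      "cox_length w = cox_length u + cox_length v"
    using assms by (auto simp: is_prefix_def)
  then show ?thesis
  proof (induction "cox_length v" arbitrary: v w)
    case 0
    then have "v = \<one>" using cox_length_eq_0[of v] by simp
    then show ?case using 0 by simp
  next
    case (Suc k)
    then have "v \<noteq> \<one>" by auto
    then obtain t x where t: "t \<in> S" "x \<in> carrier W" "v = x \<otimes> t" "cox_length v = Suc (cox_length x)"
      using exists_last_letter Suc by blast
    have ux: "u \<otimes> x \<in> carrier W" and w: "w = (u \<otimes> x) \<otimes> t" using Suc t by (auto simp: m_assoc)
    have "cox_length (u \<otimes> x) = cox_length u + cox_length x"
      using cox_length_mult_le[of u x] cox_length_mult_right_le[OF ux t(1)] Suc t w by simp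
    then have "inversion_set u \<subseteq> inversion_set (u \<otimes> x)" and "cox_length (u \<otimes> x) \<le> cox_length w"
      using Suc(1)[of x "u \<otimes> x"] Suc t by auto
    moreover have "inversion_set (u \<otimes> x) \<subseteq> inversion_set w"
      using inversion_set_right(1)[OF ux t(1)] length_increasing_positive[OF ux] rep_root[OF ux]
        simple_root pos_rootI calculation(2) t(1) w by auto
    ultimately show ?case by blast
  qed
qed

text \<open>A first letter of \<open>u\<close> is an inversion of \<open>w\<close>, hence also a first letter of \<open>w\<close>; removing it from
  both reduces the claim to shorter elements.\<close>

lemma inversion_set_subset_prefix:
  assumes "u \<in> carrier W" "w \<in> carrier W" "inversion_set u \<subseteq> inversion_set w"
  shows "is_prefix u w"
  using assms
proof (induction "cox_length u" arbitrary: u w)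
  case 0
  then have "u = \<one>" using cox_length_eq_0 by auto
  then show ?case using 0 by (simp add: is_prefix_def)
next
  case (Suc k)
  then have "u \<noteq> \<one>" by auto
  then obtain s where s: "s \<in> S" "\<alpha> s \<in> inversion_set u" using exists_descent Suc by blast
  then have sw: "\<alpha> s \<in> inversion_set w" using Suc by blast
  have "\<gamma> \<in> inversion_set (s \<otimes> w)" if "\<gamma> \<in> inversion_set (s \<otimes> u)" for \<gamma>
    using that inversion_set_left[of u s \<gamma>] inversion_set_left[of w s \<gamma>] s sw Suc
    by (auto split: if_splits)
  then have "is_prefix (s \<otimes> u) (s \<otimes> w)"
    using Suc(1)[of "s \<otimes> u" "s \<otimes> w"] descent_length(1)[of u s] s Suc(2-) by auto
  then obtain v where v: "v \<in> carrier W" "s \<otimes> w = s \<otimes> u \<otimes> v"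
      "cox_length (s \<otimes> w) = cox_length (s \<otimes> u) + cox_length v"
    by (auto simp: is_prefix_def)
  have "w = s \<otimes> (s \<otimes> w)" using s Suc by simp
  also have "\<dots> = u \<otimes> v" using v s Suc by (simp add: m_assoc)
  finally have "w = u \<otimes> v" .
  moreover have "cox_length w = cox_length u + cox_length v"
    using v descent_length(1)[of u s] descent_length(1)[of w s] s sw Suc by simp
  ultimately show ?case using v Suc unfolding is_prefix_def by blast
qed

lemma prefix_iff_inversion_set_subset:
  "u \<in> carrier W \<Longrightarrow> w \<in> carrier W \<Longrightarrow> is_prefix u w \<longleftrightarrow> inversion_set u \<subseteq> inversion_set w"
  using prefix_inversion_set_subset inversion_set_subset_prefix by blast

lemma inversion_set_inj:
  assumes "u \<in> carrier W" "w \<in> carrier W" "inversion_set u = inversion_set w"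
  shows "u = w"
proof -
  obtain v where "v \<in> carrier W" "w = u \<otimes> v" "cox_length w = cox_length u + cox_length v"
    using inversion_set_subset_prefix[of u w] assms by (auto simp: is_prefix_def)
  moreover have "cox_length w = cox_length u" using card_inversion_set assms by metis
  ultimately show ?thesis using cox_length_eq_0 assms by auto
qed

section \<open>Reflections\<close>

definition reflection :: "'v \<Rightarrow> 'w" where
  "reflection \<beta> = (SOME g. g \<in> carrier W \<and> (\<forall>v. \<rho> g v = v - (2 * B \<beta> v) *\<^sub>R \<beta>))"

lemma reflection_exists:
  assumes "\<beta> \<in> roots"
  shows "\<exists>g\<in>carrier W. \<forall>v. \<rho> g v = v - (2 * B \<beta> v) *\<^sub>R \<beta>"
proof -
  obtain w s where ws: "w \<in> carrier W" "s \<in> S" "\<beta> = \<rho> w (\<alpha> s)" using assms by (auto simp: roots_def)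
  have "\<rho> (w \<otimes> s \<otimes> inv w) v = v - (2 * B \<beta> v) *\<^sub>R \<beta>" for v
  proof -
    have "B (\<alpha> s) (\<rho> (inv w) v) = B \<beta> v"
      using rep_B[of w "\<alpha> s" "\<rho> (inv w) v"] ws by simp
    then show ?thesis using ws by (simp add: rep_mult rep_simple)
  qed
  then show ?thesis using ws by (intro bexI[of _ "w \<otimes> s \<otimes> inv w"]) auto
qed

lemma reflection_closed [simp]: "\<beta> \<in> roots \<Longrightarrow> reflection \<beta> \<in> carrier W"
  and rep_reflection: "\<beta> \<in> roots \<Longrightarrow> \<rho> (reflection \<beta>) v = v - (2 * B \<beta> v) *\<^sub>R \<beta>"
  using reflection_exists[of \<beta>] someI_ex[of "\<lambda>g. g \<in> carrier W \<and> (\<forall>v. \<rho> g v = v - (2 * B \<beta> v) *\<^sub>R \<beta>)"]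
  unfolding reflection_def by blast+

lemma rep_reflection_twice [simp]:
  assumes "\<beta> \<in> roots"
  shows "\<rho> (reflection \<beta>) (\<rho> (reflection \<beta>) v) = v"
proof -
  have "2 * B \<beta> (v - (2 * B \<beta> v) *\<^sub>R \<beta>) = - (2 * B \<beta> v)" using assms by (simp add: root_unit)
  then show ?thesis using assms by (simp only: rep_reflection) simp
qed

lemma reflection_square [simp]: "\<beta> \<in> roots \<Longrightarrow> reflection \<beta> \<otimes> reflection \<beta> = \<one>"
  by (rule rep_eqI) (simp_all add: rep_mult)

lemma reflection_inv [simp]: "\<beta> \<in> roots \<Longrightarrow> inv (reflection \<beta>) = reflection \<beta>"
  using inv_equality reflection_square by simp

lemma reflection_simple [simp]: "s \<in> S \<Longrightarrow> reflection (\<alpha> s) = s"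
  by (rule rep_eqI) (simp_all add: rep_reflection simple_root rep_simple)

lemma reflected_root: "\<beta> \<in> roots \<Longrightarrow> \<gamma> \<in> roots \<Longrightarrow> \<gamma> - (2 * B \<beta> \<gamma>) *\<^sub>R \<beta> \<in> roots"
  using rep_root[of "reflection \<beta>" \<gamma>] by (simp add: rep_reflection)

lemma reflection_self: "\<beta> \<in> roots \<Longrightarrow> \<rho> (reflection \<beta>) \<beta> = - \<beta>"
  by (simp add: rep_reflection root_unit scaleR_2)

lemma rep_B_left: "w \<in> carrier W \<Longrightarrow> B (\<rho> w x) y = B x (\<rho> (inv w) y)"
  using rep_B[of w x "\<rho> (inv w) y"] by simp

lemma reflection_rep:
  assumes "w \<in> carrier W" "\<beta> \<in> roots"
  shows "reflection (\<rho> w \<beta>) = w \<otimes> reflection \<beta> \<otimes> inv w"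
  by (rule rep_eqI)
    (use assms in \<open>simp_all add: rep_root rep_mult rep_reflection rep_B_left\<close>)

lemma reflection_neg: "\<beta> \<in> roots \<Longrightarrow> reflection (- \<beta>) = reflection \<beta>"
  by (rule rep_eqI) (simp_all add: rep_reflection)

section \<open>Decomposable inversions\<close>

text \<open>The inversions of \<open>w\<close> that \<open>s\<^sub>\<beta>\<close> sends to negatives of inversions of \<open>w\<close>; \<open>\<beta>\<close> itself is always one.\<close>

definition opposite_inversions :: "'v \<Rightarrow> 'w \<Rightarrow> 'v set" where
  "opposite_inversions \<beta> w =
    {a \<in> inversion_set w. - \<rho> (reflection \<beta>) a \<in> inversion_set w}"

definition decomposable :: "'v \<Rightarrow> 'w \<Rightarrow> bool" where
  "decomposable \<beta> w \<longleftrightarrow>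
    (\<exists>a\<in>inversion_set w. a \<noteq> \<beta> \<and> - \<rho> (reflection \<beta>) a \<in> inversion_set w)"

text \<open>Let \<open>I = N(s\<^sub>\<beta>)\<close>, with the involution \<open>\<iota> = - s\<^sub>\<beta>\<close>. Outside \<open>I\<close>, the map \<open>s\<^sub>\<beta>\<close> is a bijection from the
  inversions of \<open>w\<close> to those of \<open>s\<^sub>\<beta> w\<close>. Inside \<open>I\<close>, the inversions of \<open>s\<^sub>\<beta> w\<close> are the roots whose
  \<open>\<iota>\<close>-image is no inversion of \<open>w\<close>. As \<open>\<gamma> + \<iota> \<gamma>\<close> is a multiple of the inversion \<open>\<beta>\<close>, at least one of
  \<open>\<gamma>, \<iota> \<gamma>\<close> is an inversion of \<open>w\<close>, so \<open>I\<close> is the union of \<open>P = N(w) \<inter> I\<close> and \<open>\<iota>(P)\<close>. Counting gives the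
  formula, the overlap \<open>P \<inter> \<iota>(P)\<close> being the set of opposite inversions.\<close>

lemma length_reflection_mult:
  assumes w: "w \<in> carrier W" and \<beta>: "\<beta> \<in> inversion_set w"
  shows "cox_length (reflection \<beta> \<otimes> w) + card (opposite_inversions \<beta> w) = cox_length w"
proof -
  define r R where "r = reflection \<beta>" and "R = \<rho> r"
  define \<iota> where "\<iota> v = - R v" for v
  have root: "\<beta> \<in> roots" and r: "r \<in> carrier W" "inv r = r"
    using \<beta> inversion_set_root by (auto simp: r_def)
  have RR: "R (R v) = v" "\<iota> (\<iota> v) = v" for v using root r by (auto simp: r_def R_def \<iota>_def)
  have Rroot: "R v \<in> roots" if "v \<in> roots" for v using that r rep_root by (simp add: R_def)
  have inj: "inj_on R A" "inj_on \<iota> A" for A by (rule inj_on_inverseI, rule RR)+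
  define N I where "N = inversion_set w" and "I = inversion_set r"
  define M where "M = inversion_set (r \<otimes> w)"
  have I: "\<gamma> \<in> I \<longleftrightarrow> \<gamma> \<in> pos_roots \<and> \<iota> \<gamma> \<in> pos_roots" for \<gamma>
    using mem_inversion_set[of r \<gamma>] r by (simp add: I_def \<iota>_def R_def)
  have I_iff: "\<gamma> \<in> I \<longleftrightarrow> \<gamma> \<in> pos_roots \<and> R \<gamma> \<notin> pos_roots" for \<gamma>
    using I[of \<gamma>] neg_pos_iff[of "R \<gamma>"] Rroot[of \<gamma>] pos_root_root[of \<gamma>] by (auto simp: \<iota>_def)
  have M: "\<gamma> \<in> M \<longleftrightarrow> \<gamma> \<in> pos_roots \<and> - \<rho> (inv w) (R \<gamma>) \<in> pos_roots" for \<gamma>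
    using mem_inversion_set[of "r \<otimes> w" \<gamma>] r w
    by (simp add: M_def inv_mult_group rep_mult R_def)
  have N: "\<gamma> \<in> N \<longleftrightarrow> \<gamma> \<in> pos_roots \<and> - \<rho> (inv w) \<gamma> \<in> pos_roots" for \<gamma>
    using mem_inversion_set[of w \<gamma>] w by (simp add: N_def)
  have fin: "finite N" "finite I" "finite M" using finite_inversion_set r w by (auto simp: N_def I_def M_def)
  have "M - I = R ` (N - I)"
  proof (rule Set.set_eqI)
    fix \<gamma>
    have "\<gamma> \<in> R ` (N - I) \<longleftrightarrow> R \<gamma> \<in> N - I" using RR(1) by (metis image_iff)
    also have "\<dots> \<longleftrightarrow> \<gamma> \<in> M - I"
      using M[of \<gamma>] N[of "R \<gamma>"] I_iff[of \<gamma>] I_iff[of "R \<gamma>"] RR(1)[of \<gamma>] by auto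
    finally show "\<gamma> \<in> M - I \<longleftrightarrow> \<gamma> \<in> R ` (N - I)" by simp
  qed
  then have 1: "card (M - I) = card (N - I)" using inj card_image by metis
  define P where "P = N \<inter> I"
  have im: "\<gamma> \<in> \<iota> ` P \<longleftrightarrow> \<iota> \<gamma> \<in> P" for \<gamma> using RR(2) by (metis image_iff)
  have "\<gamma> \<in> M \<inter> I \<longleftrightarrow> \<gamma> \<in> I - \<iota> ` P" for \<gamma>
  proof (cases "\<gamma> \<in> I")
    case True
    then have pos: "\<gamma> \<in> pos_roots" "\<iota> \<gamma> \<in> pos_roots" "\<iota> \<gamma> \<in> I" using I RR(2) by auto
    have "\<gamma> \<in> M \<longleftrightarrow> \<rho> (inv w) (\<iota> \<gamma>) \<in> pos_roots" using M pos w by (simp add: \<iota>_def)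
    also have "\<dots> \<longleftrightarrow> \<iota> \<gamma> \<notin> N"
      using mem_inversion_set_not_pos[OF w pos(2)] by (simp add: N_def)
    finally show ?thesis using True pos im by (simp add: P_def)
  qed simp
  then have 2: "M \<inter> I = I - \<iota> ` P" by blast
  have "\<gamma> \<in> P \<union> \<iota> ` P" if \<gamma>: "\<gamma> \<in> I" for \<gamma>
  proof (rule ccontr)
    assume "\<not> ?thesis"
    then have out: "\<gamma> \<notin> N" "\<iota> \<gamma> \<notin> N" using \<gamma> im[of \<gamma>] I RR(2) by (auto simp: P_def)
    have pos: "\<gamma> \<in> pos_roots" "\<iota> \<gamma> \<in> pos_roots" using \<gamma> I by auto
    define k where "k = 2 * B \<beta> \<gamma>"
    have sum: "\<gamma> + \<iota> \<gamma> = k *\<^sub>R \<beta>" using root by (simp add: \<iota>_def R_def r_def rep_reflection k_def)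
    have wpos: "\<rho> (inv w) \<gamma> \<in> pos_cone" "\<rho> (inv w) (\<iota> \<gamma>) \<in> pos_cone"
      using out pos mem_inversion_set_not_pos[OF w] pos_root_cone by (auto simp: N_def)
    have \<beta>pos: "\<beta> \<in> pos_cone" "- \<rho> (inv w) \<beta> \<in> pos_cone"
      using \<beta> mem_inversion_set[OF w] pos_root_cone by auto
    show False
    proof (cases "0 \<le> k")
      case True
      have "\<rho> (inv w) \<gamma> + \<rho> (inv w) (\<iota> \<gamma>) = k *\<^sub>R \<rho> (inv w) \<beta>"
        using arg_cong[OF sum, of "\<rho> (inv w)"] w by simp
      then have "\<rho> (inv w) \<gamma> + (\<rho> (inv w) (\<iota> \<gamma>) + k *\<^sub>R (- \<rho> (inv w) \<beta>)) = 0"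
        by (simp add: add_diff_eq)
      moreover have "\<rho> (inv w) (\<iota> \<gamma>) + k *\<^sub>R (- \<rho> (inv w) \<beta>) \<in> pos_cone"
        by (intro nonneg_cone_add nonneg_cone_scale wpos \<beta>pos True)
      ultimately have "\<rho> (inv w) \<gamma> = 0" using pos_cone_salient wpos(1) by blast
      then have "\<rho> w (\<rho> (inv w) \<gamma>) = 0" using w by (simp del: rep_inv_right)
      then have "\<gamma> = 0" using w by simp
      then show False using pos(1) pos_root_root root_nonzero by blast
    next
      case False
      have "\<gamma> + (\<iota> \<gamma> + (- k) *\<^sub>R \<beta>) = 0" using sum by (simp add: add_diff_eq)
      moreover have "\<iota> \<gamma> + (- k) *\<^sub>R \<beta> \<in> pos_cone"
        by (intro nonneg_cone_add nonneg_cone_scale \<beta>pos) (use pos pos_root_cone False in auto)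
      ultimately have "\<gamma> = 0" using pos_cone_salient pos(1) pos_root_cone by blast
      then show False using pos(1) pos_root_root root_nonzero by blast
    qed
  qed
  moreover have "P \<union> \<iota> ` P \<subseteq> I" using im I RR(2) by (auto simp: P_def)
  ultimately have "I = P \<union> \<iota> ` P" by blast
  moreover have finP: "finite P" using fin by (simp add: P_def)
  moreover have cP: "card (\<iota> ` P) = card P" using inj card_image by metis
  ultimately have 3: "card I + card (P \<inter> \<iota> ` P) = 2 * card P"
    using card_Un_Int[of P "\<iota> ` P"] by simp
  have 4: "P \<inter> \<iota> ` P = opposite_inversions \<beta> w"
  proof -
    have "\<gamma> \<in> P \<inter> \<iota> ` P \<longleftrightarrow> \<gamma> \<in> N \<and> \<iota> \<gamma> \<in> N" for \<gamma>
      using im[of \<gamma>] I[of \<gamma>] I[of "\<iota> \<gamma>"] RR(2)[of \<gamma>] N[of \<gamma>] N[of "\<iota> \<gamma>"]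
      by (auto simp: P_def)
    then show ?thesis unfolding opposite_inversions_def N_def \<iota>_def R_def r_def by blast
  qed
  have "card M = card (M - I) + card (M \<inter> I)" "card N = card (N - I) + card P"
    using fin card_Int_Diff[of M I] card_Int_Diff[of N I] by (simp_all add: P_def)
  moreover have "card (M \<inter> I) + card P = card I"
    using 2 cP finP fin card_Diff_subset[of "\<iota> ` P" I] card_mono[of I "\<iota> ` P"] \<open>P \<union> \<iota> ` P \<subseteq> I\<close> by simp
  ultimately have "card M + card (opposite_inversions \<beta> w) = card N" using 1 3 4 by simp
  then show ?thesis using card_inversion_set r w by (simp add: M_def N_def r_def)
qed

lemma self_opposite: "\<beta> \<in> inversion_set w \<Longrightarrow> \<beta> \<in> opposite_inversions \<beta> w"
  using reflection_self inversion_set_root by (simp add: opposite_inversions_def)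

lemma length_reflection_less:
  assumes "w \<in> carrier W" "\<beta> \<in> inversion_set w"
  shows "cox_length (reflection \<beta> \<otimes> w) < cox_length w"
proof -
  have "finite (opposite_inversions \<beta> w)"
    using finite_inversion_set[OF assms(1)] by (simp add: opposite_inversions_def)
  then have "0 < card (opposite_inversions \<beta> w)"
    using self_opposite[OF assms(2)] by (auto simp: card_gt_0_iff)
  then show ?thesis using length_reflection_mult[OF assms] by simp
qed

lemma decomposable_iff_length:
  assumes "w \<in> carrier W" "\<beta> \<in> inversion_set w"
  shows "decomposable \<beta> w \<longleftrightarrow> cox_length w \<noteq> Suc (cox_length (reflection \<beta> \<otimes> w))"
proof -
  have "finite (opposite_inversions \<beta> w)"
    using finite_inversion_set[OF assms(1)] by (simp add: opposite_inversions_def)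
  then have "card (opposite_inversions \<beta> w) = 1 \<longleftrightarrow> opposite_inversions \<beta> w = {\<beta>}"
    using self_opposite[OF assms(2)] by (auto simp: card_1_singleton_iff)
  also have "\<dots> \<longleftrightarrow> \<not> decomposable \<beta> w"
    using self_opposite[OF assms(2)] by (auto simp: decomposable_def opposite_inversions_def)
  finally show ?thesis using length_reflection_mult[OF assms] by auto
qed

text \<open>Suppose that \<open>\<beta>\<close> is an indecomposable inversion and a non-negative combination of other inversions
  \<open>a\<close>. For each \<open>a\<close> either \<open>s\<^sub>\<beta> a\<close> is positive, or \<open>- s\<^sub>\<beta> a\<close> is positive and no inversion. Collect the
  terms of the first kind in \<open>P\<close> and the others in \<open>Q\<close>. With \<open>p = 2 B \<beta> P\<close> and \<open>q = 2 B \<beta> Q\<close> one has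
  \<open>p + q = 2\<close>. If \<open>p \<ge> 1\<close>, positivity of \<open>s\<^sub>\<beta> P = P - p (P + Q)\<close> is absurd; if \<open>q \<ge> 1\<close>, apply
  \<open>- w\<^sup>-\<^sup>1\<close>, which is positive on all inversions of \<open>w\<close>, and argue in the same way with the roles of
  \<open>P\<close> and \<open>Q\<close> exchanged.\<close>

lemma cone_combination_decomposable:
  assumes w: "w \<in> carrier W" and \<beta>: "\<beta> \<in> inversion_set w"
    and A: "A \<subseteq> inversion_set w" "\<beta> \<in> nonneg_cone A" "\<beta> \<notin> A"
  shows "decomposable \<beta> w"
proof (rule ccontr)
  assume indec: "\<not> decomposable \<beta> w"
  let ?R = "\<rho> (reflection \<beta>)" and ?v = "\<lambda>x. - \<rho> (inv w) x"
  have root: "\<beta> \<in> roots" using \<beta> inversion_set_root by blast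
  define C where "C x \<longleftrightarrow> x \<in> pos_cone" for x
  have C: "C 0" "\<And>x y. C x \<Longrightarrow> C y \<Longrightarrow> C (x + y)" "\<And>r x. C x \<Longrightarrow> 0 \<le> r \<Longrightarrow> C (r *\<^sub>R x)"
    "\<And>x y. C x \<Longrightarrow> C y \<Longrightarrow> x + y = 0 \<Longrightarrow> x = 0"
    unfolding C_def using zero_mem_nonneg_cone nonneg_cone_add nonneg_cone_scale pos_cone_salient
    by blast+
  have "\<exists>P Q. x = P + Q \<and> C P \<and> C Q \<and> C (?v P) \<and> C (?v Q) \<and> C (?R P) \<and> C (?v (?R Q))"
    if "x \<in> nonneg_cone A" for x
    using that
  proof (induction rule: nonneg_cone_induct)
    case zero
    show ?case using C(1) root w by (intro exI[of _ 0]) simp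
  next
    case (add_term a c x)
    then obtain P Q where PQ: "x = P + Q" "C P" "C Q" "C (?v P)" "C (?v Q)" "C (?R P)" "C (?v (?R Q))"
      by blast
    have a: "a \<in> inversion_set w" "a \<noteq> \<beta>" using add_term A by auto
    have Ca: "C a" "C (?v a)" using a mem_inversion_set[OF w] pos_root_cone by (auto simp: C_def)
    have Ra: "?R a \<in> roots" using a inversion_set_root rep_root root by simp
    have comb: "C (c *\<^sub>R p + q)" if "C p" "C q" for p q using that C(2,3) add_term(2) by blast
    have eqs: "?v (c *\<^sub>R a + z) = c *\<^sub>R ?v a + ?v z" "?R (c *\<^sub>R a + z) = c *\<^sub>R ?R a + ?R z"
      "?v (c *\<^sub>R ?R a + z) = c *\<^sub>R ?v (?R a) + ?v z" for z
      using w root by simp_all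
    show ?case
    proof (cases "?R a \<in> pos_roots")
      case True
      then have "C (?R a)" using pos_root_cone by (simp add: C_def)
      then have "C (c *\<^sub>R a + P)" "C (?v (c *\<^sub>R a + P))" "C (?R (c *\<^sub>R a + P))"
        unfolding eqs using comb PQ Ca by blast+
      then show ?thesis using PQ by (intro exI[of _ "c *\<^sub>R a + P"] exI[of _ Q]) simp
    next
      case False
      then have "- ?R a \<in> pos_roots" using Ra pos_or_neg by blast
      moreover have "- ?R a \<notin> inversion_set w" using indec a by (auto simp: decomposable_def)
      ultimately have "\<rho> (inv w) (- ?R a) \<in> pos_roots" using mem_inversion_set_not_pos[OF w] by blast
      then have "C (?v (?R a))" using pos_root_cone w by (simp add: C_def)
      then have "C (c *\<^sub>R a + Q)" "C (?v (c *\<^sub>R a + Q))" "C (?v (?R (c *\<^sub>R a + Q)))"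
        unfolding eqs using comb PQ Ca by blast+
      then show ?thesis using PQ by (intro exI[of _ P] exI[of _ "c *\<^sub>R a + Q"]) simp
    qed
  qed
  then obtain P Q where PQ: "\<beta> = P + Q" "C P" "C Q" "C (?v P)" "C (?v Q)" "C (?R P)" "C (?v (?R Q))"
    using A(2) by blast
  have contradiction: False
    if "C X" "C Y" "X + Y \<noteq> 0" "C (X - p *\<^sub>R (X + Y))" "p + q = 2" "1 \<le> p"
      "Y = 0 \<Longrightarrow> p = 2" for X Y p q
  proof -
    have "C ((p - 1) *\<^sub>R X)" "C (p *\<^sub>R Y)" using that C(3) by auto
    moreover have "(X - p *\<^sub>R (X + Y)) + ((p - 1) *\<^sub>R X + p *\<^sub>R Y) = 0"
      by (simp add: algebra_simps)
    ultimately have "X - p *\<^sub>R (X + Y) = 0" using C(2,4) that(4) by blast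
    then have sum: "p *\<^sub>R Y + (p - 1) *\<^sub>R X = 0" by (simp add: algebra_simps)
    then have "p *\<^sub>R Y = 0" using C(4) \<open>C (p *\<^sub>R Y)\<close> \<open>C ((p - 1) *\<^sub>R X)\<close> by blast
    then have "Y = 0" using that by simp
    then have "X = 0" using sum that by simp
    then show False using that \<open>Y = 0\<close> by simp
  qed
  define p q where "p = 2 * B \<beta> P" "q = 2 * B \<beta> Q"
  have pq: "p + q = 2" using PQ(1) root_unit[OF root] B_simps(2)[of \<beta> P Q] by (simp add: p_q_def)
  have \<beta>0: "\<beta> \<noteq> 0" using root root_nonzero by blast
  have unit: "B \<beta> \<beta> = 1" using root root_unit by blast
  show False
  proof (cases "1 \<le> p")
    case True
    have "?R P = P - p *\<^sub>R (P + Q)" using rep_reflection[OF root, of P] PQ(1) by (simp add: p_q_def)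
    moreover have "Q = 0 \<Longrightarrow> p = 2" using pq by (simp add: p_q_def)
    ultimately show False using contradiction[of P Q p q] PQ \<beta>0 pq True by simp
  next
    case False
    have "?v (?R Q) = ?v Q - q *\<^sub>R (?v Q + ?v P)"
    proof -
      have RQ: "?R Q = Q - q *\<^sub>R (P + Q)"
        unfolding p_q_def PQ(1)[symmetric] by (rule rep_reflection[OF root])
      show ?thesis unfolding RQ using w by (simp add: algebra_simps)
    qed
    moreover have "?v P = 0 \<Longrightarrow> q = 2"
    proof -
      assume "?v P = 0"
      then have "\<rho> w (\<rho> (inv w) P) = 0" using w by (simp del: rep_inv_right)
      then show "q = 2" using w pq by (simp add: p_q_def)
    qed
    moreover have "?v Q + ?v P \<noteq> 0"
    proof
      assume "?v Q + ?v P = 0"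
      then have "\<rho> (inv w) P + \<rho> (inv w) Q = 0"
        by (metis add.commute add.inverse_inverse minus_add_distrib neg_equal_0_iff_equal)
      then have "\<rho> (inv w) \<beta> = 0" using PQ(1) w by simp
      then have "\<rho> w (\<rho> (inv w) \<beta>) = 0" using w by (simp del: rep_inv_right)
      then show False using \<beta>0 w by simp
    qed
    ultimately show False using contradiction[of "?v Q" "?v P" q p] PQ pq False by simp
  qed
qed

text \<open>A generating set of least cardinality works: a decomposable member \<open>\<beta>\<close> is a multiple of \<open>a + a'\<close> for
  two inversions \<open>a, a'\<close>. Writing both in terms of the generators and solving for \<open>\<beta>\<close> would make
  \<open>\<beta>\<close> redundant, or place \<open>a\<close> on the ray of \<open>\<beta>\<close>.\<close>

lemma minimal_generators:
  assumes w: "w \<in> carrier W"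
  obtains A where "A \<subseteq> inversion_set w" "inversion_set w \<subseteq> nonneg_cone A"
    "\<And>\<beta>. \<beta> \<in> A \<Longrightarrow> \<not> decomposable \<beta> w"
proof -
  let ?N = "inversion_set w"
  define gen where "gen A \<longleftrightarrow> A \<subseteq> ?N \<and> ?N \<subseteq> nonneg_cone A" for A
  have "gen ?N" using nonneg_cone_superset by (auto simp: gen_def)
  then obtain A where A: "gen A" and minimal: "\<And>D. gen D \<Longrightarrow> card A \<le> card D"
    using ex_has_least_nat[of gen ?N card] by blast
  have "\<not> decomposable \<beta> w" if \<beta>: "\<beta> \<in> A" for \<beta>
  proof
    assume "decomposable \<beta> w"
    then obtain a where a: "a \<in> ?N" "a \<noteq> \<beta>" "- \<rho> (reflection \<beta>) a \<in> ?N"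
      by (auto simp: decomposable_def)
    define a' where "a' = - \<rho> (reflection \<beta>) a"
    have \<beta>N: "\<beta> \<in> ?N" using A \<beta> by (auto simp: gen_def)
    define k where "k = 2 * B \<beta> a"
    have sum: "a + a' = k *\<^sub>R \<beta>" using \<beta>N inversion_set_root by (simp add: a'_def rep_reflection k_def)
    obtain x y where xy: "0 \<le> x" "y \<in> nonneg_cone (A - {\<beta>})" "a = x *\<^sub>R \<beta> + y"
      using nonneg_cone_split a A unfolding gen_def by blast
    obtain x' y' where xy': "0 \<le> x'" "y' \<in> nonneg_cone (A - {\<beta>})" "a' = x' *\<^sub>R \<beta> + y'"
      using nonneg_cone_split a A unfolding gen_def a'_def by blast
    have "A \<subseteq> pos_cone" using A inversion_set_pos pos_root_cone by (auto simp: gen_def)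
    then have ypos: "y \<in> pos_cone" "y' \<in> pos_cone" "\<beta> \<in> pos_cone"
      using xy xy' \<beta> nonneg_cone_subset[of "A - {\<beta>}" "\<alpha> ` S"] by auto
    define m where "m = k - x - x'"
    have m: "m *\<^sub>R \<beta> = y + y'" using sum xy(3) xy'(3) by (simp add: m_def algebra_simps)
    show False
    proof (cases "0 < m")
      case True
      have "(1 / m) *\<^sub>R (y + y') \<in> nonneg_cone (A - {\<beta>})"
        using True xy xy' by (intro nonneg_cone_scale nonneg_cone_add) auto
      moreover have "(1 / m) *\<^sub>R (y + y') = \<beta>" using True m[symmetric] by simp
      ultimately have "a \<in> nonneg_cone (A - {\<beta>})" if "a \<in> A" for a
        using that nonneg_cone_superset[of a "A - {\<beta>}"] by (cases "a = \<beta>") auto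
      then have "A \<subseteq> nonneg_cone (A - {\<beta>})" by blast
      then have "gen (A - {\<beta>})" using A nonneg_cone_subset[of A "A - {\<beta>}"] by (auto simp: gen_def)
      then have "card A \<le> card (A - {\<beta>})" by (rule minimal)
      moreover have "finite A" using A finite_inversion_set[OF w] finite_subset by (auto simp: gen_def)
      ultimately show False using \<beta> card_Diff1_less[of A \<beta>] by simp
    next
      case False
      then have "y' + (- m) *\<^sub>R \<beta> \<in> pos_cone" using ypos by (intro nonneg_cone_add nonneg_cone_scale) auto
      moreover have "y + (y' + (- m) *\<^sub>R \<beta>) = 0" using m by (simp add: add_diff_eq)
      ultimately have "y = 0" using pos_cone_salient ypos by blast
      then have "a = x *\<^sub>R \<beta>" using xy by simp
      then show False using proportional_pos_roots a \<beta>N inversion_set_pos by blast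
    qed
  qed
  then show ?thesis using that A by (auto simp: gen_def)
qed

section \<open>Dihedral chains of roots\<close>

text \<open>The values \<open>U\<^sub>n\<^sub>-\<^sub>1(c/2)\<close> of the Chebyshev polynomials of the second kind, which are the coefficients
  of the roots of a dihedral group with bond \<open>c\<close>.\<close>

fun dihedral_coeff :: "real \<Rightarrow> nat \<Rightarrow> real" where
  "dihedral_coeff c 0 = 0"
| "dihedral_coeff c (Suc 0) = 1"
| "dihedral_coeff c (Suc (Suc n)) = c * dihedral_coeff c (Suc n) - dihedral_coeff c n"

lemma dihedral_coeff_grows:
  assumes "2 \<le> c"
  shows "0 \<le> dihedral_coeff c n \<and> dihedral_coeff c n + 1 \<le> dihedral_coeff c (Suc n)"
proof (induction n)
  case (Suc n)
  have "2 * dihedral_coeff c (Suc n) \<le> c * dihedral_coeff c (Suc n)"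
    using Suc assms by (intro mult_right_mono) auto
  then show ?case using Suc unfolding dihedral_coeff.simps by linarith
qed simp

lemma dihedral_coeff_strict_mono: "2 \<le> c \<Longrightarrow> strict_mono (dihedral_coeff c)"
  unfolding strict_mono_Suc_iff using dihedral_coeff_grows[of c] by (meson less_add_one order_less_le_trans)

text \<open>The roots \<open>x, s\<^sub>x y, s\<^sub>x s\<^sub>y x, \<dots>\<close> of the dihedral group generated by the reflections in \<open>x\<close> and \<open>y\<close>, in
  the order in which they are met when turning from \<open>x\<close> towards \<open>y\<close>.\<close>

definition chain :: "'v \<Rightarrow> 'v \<Rightarrow> nat \<Rightarrow> 'v" where
  "chain x y n = dihedral_coeff (- 2 * B x y) (Suc n) *\<^sub>R x + dihedral_coeff (- 2 * B x y) n *\<^sub>R y"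

lemma chain_0 [simp]: "chain x y 0 = x"
  and chain_1: "chain x y (Suc 0) = y - (2 * B x y) *\<^sub>R x"
  and chain_Suc_Suc: "chain x y (Suc (Suc n)) = (- 2 * B x y) *\<^sub>R chain x y (Suc n) - chain x y n"
  by (simp_all add: chain_def algebra_simps)

lemma chain_props:
  assumes "x \<in> roots" "y \<in> roots"
  shows "chain x y n \<in> roots \<and> chain x y (Suc n) \<in> roots \<and>
    B (chain x y (Suc n)) (chain x y n) = - B x y"
proof (induction n)
  case 0
  have "B y x = B x y" by (rule B_symmetric)
  then show ?case using assms reflected_root[of x y] by (simp add: chain_1 root_unit)
next
  case (Suc n)
  let ?p = "chain x y"
  have eq: "?p (Suc (Suc n)) = - (?p n - (2 * B (?p (Suc n)) (?p n)) *\<^sub>R ?p (Suc n))"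
    using Suc by (simp add: chain_Suc_Suc)
  have "?p (Suc (Suc n)) \<in> roots"
    unfolding eq using Suc by (intro neg_root reflected_root) auto
  moreover have "B (?p (Suc (Suc n))) (?p (Suc n)) = - B x y"
    using Suc root_unit[of "?p (Suc n)"] B_symmetric[of "?p n" "?p (Suc n)"] by (simp add: chain_Suc_Suc)
  ultimately show ?case using Suc by simp
qed

lemma chain_root: "x \<in> roots \<Longrightarrow> y \<in> roots \<Longrightarrow> chain x y n \<in> roots"
  and chain_product: "x \<in> roots \<Longrightarrow> y \<in> roots \<Longrightarrow> B (chain x y (Suc n)) (chain x y n) = - B x y"
  using chain_props by blast+

lemma chain_reflect:
  "x \<in> roots \<Longrightarrow> y \<in> roots \<Longrightarrow>
    \<rho> (reflection (chain x y (Suc n))) (chain x y n) = - chain x y (Suc (Suc n))"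
  using chain_root[of x y "Suc n"] chain_product[of x y n] by (simp add: rep_reflection chain_Suc_Suc)

text \<open>Neighbours in a chain differ by a fixed rotation of the plane.\<close>

lemma chain_rotation:
  assumes "x \<in> roots" "y \<in> roots"
  shows "reflection (chain x y (Suc n)) \<otimes> reflection (chain x y n) = reflection x \<otimes> reflection y"
proof (induction n)
  case 0
  have "chain x y (Suc 0) = \<rho> (reflection x) y" using assms by (simp add: chain_1 rep_reflection)
  then show ?case using assms reflection_rep[of "reflection x" y] by (simp add: m_assoc)
next
  case (Suc n)
  let ?r = "\<lambda>n. reflection (chain x y n)"
  have roots: "chain x y m \<in> roots" for m using chain_root assms by blast
  have "?r (Suc (Suc n)) = reflection (\<rho> (?r (Suc n)) (chain x y n))"
    unfolding chain_reflect[OF assms] using reflection_neg roots by simp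
  also have "\<dots> = ?r (Suc n) \<otimes> ?r n \<otimes> ?r (Suc n)" using reflection_rep roots by simp
  finally have "?r (Suc (Suc n)) \<otimes> ?r (Suc n) = ?r (Suc n) \<otimes> ?r n"
    using roots by (simp add: m_assoc)
  then show ?case using Suc by simp
qed

lemma inj_chain:
  assumes xy: "x \<in> roots" "y \<in> roots" "y \<noteq> - x" and B: "B x y \<le> -1"
  shows "inj (chain x y)"
proof (rule linorder_injI)
  fix i j :: nat assume "i < j"
  show "chain x y i \<noteq> chain x y j"
  proof
    assume eq: "chain x y i = chain x y j"
    let ?t = "dihedral_coeff (- 2 * B x y)"
    have mono: "strict_mono ?t" using dihedral_coeff_strict_mono B by simp
    have "?t i < ?t j" "?t (Suc i) < ?t (Suc j)" using mono \<open>i < j\<close> by (simp_all add: strict_mono_less)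
    moreover define k l where "k = ?t j - ?t i" "l = ?t (Suc j) - ?t (Suc i)"
    ultimately have kl: "0 < k" "0 < l" by auto
    have "l *\<^sub>R x + k *\<^sub>R y = 0" using eq by (simp add: chain_def k_l_def algebra_simps)
    then have "k *\<^sub>R y = - (l *\<^sub>R x)" by (simp add: add_eq_0_iff)
    then have "(1/k) *\<^sub>R (k *\<^sub>R y) = - ((l/k) *\<^sub>R x)" by simp
    then have y: "y = - ((l/k) *\<^sub>R x)" using kl by simp
    have "B y y = (l/k) * (l/k)" using root_unit[OF xy(1)] by (subst (1 2) y) simp
    then have "(l/k) * (l/k) = 1" using root_unit[OF xy(2)] by metis
    then have "l/k = 1 \<or> l/k = -1" by (simp only: square_eq_1_iff)
    moreover have "0 < l/k" using kl by simp
    ultimately have "l/k = 1" by linarith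
    then show False using y xy(3) by simp
  qed
qed

text \<open>Otherwise the chain from \<open>x\<close> to \<open>y\<close> would consist of infinitely many inversions.\<close>

lemma inversion_product:
  assumes w: "w \<in> carrier W" and xy: "x \<in> inversion_set w" "y \<in> inversion_set w"
  shows "-1 < B x y"
proof (rule ccontr)
  assume "\<not> -1 < B x y"
  then have B: "B x y \<le> -1" by simp
  have roots: "x \<in> roots" "y \<in> roots" using xy inversion_set_root by auto
  have "y \<noteq> - x" using xy inversion_set_pos not_pos_and_neg by blast
  then have "infinite (range (chain x y))" using inj_chain[OF roots _ B] range_inj_infinite by blast
  moreover have "chain x y n \<in> inversion_set w" for n
  proof -
    have "x \<in> nonneg_cone {x, y}" "y \<in> nonneg_cone {x, y}" by (auto intro: nonneg_cone_superset)
    then have "chain x y n \<in> nonneg_cone {x, y}"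
      unfolding chain_def using dihedral_coeff_grows[of "- 2 * B x y"] B
      by (intro nonneg_cone_add nonneg_cone_scale) auto
    then have "chain x y n \<in> root_cone {x, y}" using chain_root roots by (simp add: root_cone_def)
    then show ?thesis using inversion_set_root_cone[OF w, of "{x, y}"] xy by auto
  qed
  ultimately show False using finite_inversion_set[OF w] by (meson finite_subset image_subsetI)
qed

section \<open>Joins\<close>

lemma root_cone_mono: "A \<subseteq> D \<Longrightarrow> root_cone A \<subseteq> root_cone D"
  using nonneg_cone_mono by (auto simp: root_cone_def)

lemma root_cone_subset: "A \<subseteq> nonneg_cone D \<Longrightarrow> root_cone A \<subseteq> root_cone D"
  using nonneg_cone_subset by (auto simp: root_cone_def)

lemma inversion_set_subset_root_cone: "inversion_set u \<subseteq> D \<Longrightarrow> inversion_set u \<subseteq> root_cone D"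
  by (auto simp: root_cone_def dest: inversion_set_root intro!: nonneg_cone_superset)

text \<open>The induction step for joins: if \<open>z\<close> realises the cone of \<open>r x\<close> and \<open>r y\<close>, then \<open>r z\<close> realises that
  of \<open>x\<close> and \<open>y\<close>. The bound \<open>g\<close> ensures that \<open>r z\<close> is longer than \<open>z\<close>. One inclusion holds because the
  inversion set of \<open>r z\<close> is closed under non-negative combinations, the other because \<open>r\<close> is linear.\<close>

lemma join_lift:
  assumes r: "r \<in> S" and c: "x \<in> carrier W" "y \<in> carrier W" "g \<in> carrier W"
    and asc: "\<alpha> r \<in> inversion_set x" "\<alpha> r \<in> inversion_set y"
    and le: "inversion_set x \<subseteq> inversion_set g" "inversion_set y \<subseteq> inversion_set g"
    and z: "z \<in> carrier W"
      "inversion_set z = root_cone (inversion_set (r \<otimes> x) \<union> inversion_set (r \<otimes> y))"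
  shows "inversion_set (r \<otimes> z) = root_cone (inversion_set x \<union> inversion_set y)"
proof -
  have sub: "inversion_set (r \<otimes> u) \<subseteq> inversion_set (r \<otimes> g)"
    if "u \<in> carrier W" "inversion_set u \<subseteq> inversion_set g" "\<alpha> r \<in> inversion_set u" for u
    using inversion_set_left[of u r] inversion_set_left[of g r] that r c
    by (auto split: if_splits)
  have "inversion_set z \<subseteq> inversion_set (r \<otimes> g)"
    unfolding z(2) by (rule inversion_set_root_cone) (use sub le asc c r in auto)
  moreover have "\<alpha> r \<notin> inversion_set (r \<otimes> g)" using descent_iff asc le c r by blast
  ultimately have notin: "\<alpha> r \<notin> inversion_set z" by blast
  have z': "inversion_set (r \<otimes> z) = insert (\<alpha> r) (\<rho> r ` inversion_set z)"
    using inversion_set_left_insert[OF z(1) r notin] by simp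
  have x': "inversion_set x = insert (\<alpha> r) (\<rho> r ` inversion_set (r \<otimes> x))"
    and y': "inversion_set y = insert (\<alpha> r) (\<rho> r ` inversion_set (r \<otimes> y))"
    using descent_length(2) c r asc by auto
  have gen: "inversion_set (r \<otimes> x) \<union> inversion_set (r \<otimes> y) \<subseteq> inversion_set z"
    unfolding z(2) by (intro Un_least inversion_set_subset_root_cone) auto
  show ?thesis
  proof
    show "root_cone (inversion_set x \<union> inversion_set y) \<subseteq> inversion_set (r \<otimes> z)"
      by (rule inversion_set_root_cone) (use z' x' y' gen z r in auto)
    show "inversion_set (r \<otimes> z) \<subseteq> root_cone (inversion_set x \<union> inversion_set y)"
    proof
      fix \<gamma> assume \<gamma>: "\<gamma> \<in> inversion_set (r \<otimes> z)"
      have "\<gamma> \<in> nonneg_cone (inversion_set x \<union> inversion_set y)"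
      proof (cases "\<gamma> = \<alpha> r")
        case True
        then show ?thesis using asc by (simp add: nonneg_cone_superset)
      next
        case False
        then obtain \<delta> where \<delta>: "\<delta> \<in> inversion_set z" "\<gamma> = \<rho> r \<delta>" using \<gamma> z' by blast
        have "\<rho> r \<delta> \<in> nonneg_cone (inversion_set x \<union> inversion_set y)"
          by (rule nonneg_cone_image[of _ "inversion_set (r \<otimes> x) \<union> inversion_set (r \<otimes> y)"])
            (use \<delta> z r x' y' in \<open>auto simp: root_cone_def rep_linear intro: nonneg_cone_superset\<close>)
        then show ?thesis using \<delta> by simp
      qed
      then show "\<gamma> \<in> root_cone (inversion_set x \<union> inversion_set y)"
        using \<gamma> inversion_set_root by (simp add: root_cone_def)
    qed
  qed
qed

text \<open>A bound forces the bond to be finite, and then the longest element of the dihedral subgroup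
  serves.\<close>

lemma simple_join:
  assumes rs: "r \<in> S" "s \<in> S" "r \<noteq> s" and g: "g \<in> carrier W"
    and le: "\<alpha> r \<in> inversion_set g" "\<alpha> s \<in> inversion_set g"
  shows "\<exists>h\<in>carrier W. \<alpha> r \<in> inversion_set h \<and> \<alpha> s \<in> inversion_set h \<and>
    inversion_set h \<subseteq> nonneg_cone {\<alpha> r, \<alpha> s}"
proof -
  have cone: "\<alpha> r \<in> nonneg_cone {\<alpha> r, \<alpha> s}" "\<alpha> s \<in> nonneg_cone {\<alpha> r, \<alpha> s}"
    by (auto intro: nonneg_cone_superset)
  have neq: "\<alpha> r \<noteq> \<alpha> s" using simple_inj rs by (auto simp: inj_on_def)
  have rs': "inversion_set (r \<otimes> s) = {\<alpha> r, \<alpha> s + bond r s *\<^sub>R \<alpha> r}"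
    using inversion_set_left_insert(1)[of s r] rs neq
    by (simp add: inversion_set_generator rep_simple_bond)
  show ?thesis
    using rs
  proof (cases rule: bond_cases)
    case 1
    then show ?thesis using rs rs' cone by (intro bexI[of _ "r \<otimes> s"]) auto
  next
    case 2
    have "\<alpha> s \<notin> inversion_set (r \<otimes> s)"
      using rs' 2 neq root_nonzero[OF simple_root[OF rs(1)]] by auto
    then have "inversion_set (s \<otimes> (r \<otimes> s)) = {\<alpha> s, \<alpha> r + \<alpha> s, \<alpha> r}"
      using inversion_set_left_insert(1)[of "r \<otimes> s" s] rs rs' 2
      by (simp add: rep_simple_bond bond_sym[of s r])
    then show ?thesis using rs cone nonneg_cone_add
      by (intro bexI[of _ "s \<otimes> (r \<otimes> s)"]) auto
  next
    case 3
    then show ?thesis using inversion_product[OF g le] by (simp add: simple_B_bond)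
  qed
qed

text \<open>The existence of the join and its inversion set come out of one induction on the length of the
  bound.\<close>

lemma join_of_two:
  assumes "g \<in> carrier W" "x \<in> carrier W" "y \<in> carrier W"
    "inversion_set x \<subseteq> inversion_set g" "inversion_set y \<subseteq> inversion_set g"
  shows "\<exists>w\<in>carrier W. inversion_set w = root_cone (inversion_set x \<union> inversion_set y)"
  using assms
proof (induction "cox_length g" arbitrary: g x y rule: less_induct)
  case less
  let ?N = inversion_set
  have closed: "root_cone (?N u) = ?N u" if "u \<in> carrier W" for u
  proof
    show "root_cone (?N u) \<subseteq> ?N u" using inversion_set_root_cone that by blast
    show "?N u \<subseteq> root_cone (?N u)" using inversion_set_root nonneg_cone_superset by (auto simp: root_cone_def)
  qed
  have lift: "\<exists>w\<in>carrier W. ?N w = root_cone (?N u \<union> ?N v)"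
    if r: "r \<in> S" and uv: "u \<in> carrier W" "v \<in> carrier W" "?N u \<subseteq> ?N g" "?N v \<subseteq> ?N g"
      "\<alpha> r \<in> ?N u" "\<alpha> r \<in> ?N v" for r u v
  proof -
    have sub: "?N (r \<otimes> t) \<subseteq> ?N (r \<otimes> g)"
      if "t \<in> carrier W" "?N t \<subseteq> ?N g" "\<alpha> r \<in> ?N t" for t
      using inversion_set_left[of t r] inversion_set_left[of g r] that r less.prems
      by (auto split: if_splits)
    have "cox_length (r \<otimes> g) < cox_length g"
      using descent_length(1)[of g r] less.prems r uv by auto
    then obtain z where "z \<in> carrier W" "?N z = root_cone (?N (r \<otimes> u) \<union> ?N (r \<otimes> v))"
      using less.hyps[of "r \<otimes> g" "r \<otimes> u" "r \<otimes> v"] sub uv r less.prems by auto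
    then show ?thesis using join_lift[OF r uv(1,2) less.prems(1) uv(5,6) uv(3,4)] r
      by (intro bexI[of _ "r \<otimes> z"]) auto
  qed
  show ?case
  proof (cases "x = \<one> \<or> y = \<one>")
    case True
    then show ?thesis using closed less.prems by auto
  next
    case False
    obtain r s where rs: "r \<in> S" "\<alpha> r \<in> ?N x" "s \<in> S" "\<alpha> s \<in> ?N y"
      using exists_descent False less.prems by meson
    show ?thesis
    proof (cases "r = s")
      case True
      then show ?thesis using lift rs less.prems by blast
    next
      case False
      \<comment> \<open>The element \<open>h\<close> gives \<open>x\<close> and \<open>h\<close> the common first letter \<open>r\<close>, gives \<open>y\<close> and \<open>h\<close> the common first
        letter \<open>s\<close>, and gives the two resulting joins the common first letter \<open>r\<close>.\<close>
      then obtain h where h: "h \<in> carrier W" "\<alpha> r \<in> ?N h" "\<alpha> s \<in> ?N h" "?N h \<subseteq> nonneg_cone {\<alpha> r, \<alpha> s}"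
        using simple_join[of r s g] rs less.prems by blast
      have "?N h \<subseteq> root_cone {\<alpha> r, \<alpha> s}" using h inversion_set_root by (auto simp: root_cone_def)
      then have hg: "?N h \<subseteq> ?N g" using inversion_set_root_cone[of g "{\<alpha> r, \<alpha> s}"] less.prems rs by blast
      obtain u where u: "u \<in> carrier W" "?N u = root_cone (?N x \<union> ?N h)"
        using lift[of r x h] rs h hg less.prems by blast
      obtain v where v: "v \<in> carrier W" "?N v = root_cone (?N y \<union> ?N h)"
        using lift[of s y h] rs h hg less.prems by blast
      have le: "?N u \<subseteq> ?N g" "?N v \<subseteq> ?N g"
        using u v inversion_set_root_cone[of g] less.prems hg by auto
      have "\<alpha> r \<in> ?N u" "\<alpha> r \<in> ?N v"
        using u v h rs simple_root by (auto simp: root_cone_def intro!: nonneg_cone_superset)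
      then obtain w where w: "w \<in> carrier W" "?N w = root_cone (?N u \<union> ?N v)"
        using lift[of r u v] rs u v le by blast
      have "root_cone (?N u \<union> ?N v) = root_cone (?N x \<union> ?N y)"
      proof
        have "{\<alpha> r, \<alpha> s} \<subseteq> nonneg_cone (?N x \<union> ?N y)"
          using rs by (auto intro!: nonneg_cone_superset)
        then have "?N h \<subseteq> nonneg_cone (?N x \<union> ?N y)" using h(4) nonneg_cone_subset by blast
        moreover have "?N x \<union> ?N y \<subseteq> nonneg_cone (?N x \<union> ?N y)" using nonneg_cone_superset by blast
        ultimately have "nonneg_cone (?N x \<union> ?N h) \<subseteq> nonneg_cone (?N x \<union> ?N y)"
          "nonneg_cone (?N y \<union> ?N h) \<subseteq> nonneg_cone (?N x \<union> ?N y)"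
          by (intro nonneg_cone_subset; blast)+
        then have "?N u \<union> ?N v \<subseteq> nonneg_cone (?N x \<union> ?N y)"
          unfolding u(2) v(2) root_cone_def by blast
        then show "root_cone (?N u \<union> ?N v) \<subseteq> root_cone (?N x \<union> ?N y)" by (rule root_cone_subset)
        have "?N x \<subseteq> ?N u" "?N y \<subseteq> ?N v"
          unfolding u(2) v(2) by (intro inversion_set_subset_root_cone; blast)+
        then show "root_cone (?N x \<union> ?N y) \<subseteq> root_cone (?N u \<union> ?N v)" by (intro root_cone_mono) auto
      qed
      then show ?thesis using w by auto
    qed
  qed
qed

lemma join_of_finite:
  assumes g: "g \<in> carrier W" and X: "finite X" "X \<subseteq> carrier W" "\<And>x. x \<in> X \<Longrightarrow> inversion_set x \<subseteq> inversion_set g"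
  shows "\<exists>w\<in>carrier W. inversion_set w = root_cone (\<Union>x\<in>X. inversion_set x)"
  using X
proof (induction X)
  case empty
  have "x \<notin> root_cone {}" for x
  proof
    assume x: "x \<in> root_cone {}"
    then have "x \<in> nonneg_cone {}" by (simp add: root_cone_def)
    then have "x = 0" by (induction rule: nonneg_cone_induct) auto
    then show False using x root_nonzero by (auto simp: root_cone_def)
  qed
  then show ?case by (intro bexI[of _ \<one>]) auto
next
  case (insert x X)
  let ?N = inversion_set
  obtain u where u: "u \<in> carrier W" "?N u = root_cone (\<Union>x\<in>X. ?N x)" using insert by auto
  have "?N u \<subseteq> ?N g" unfolding u(2) by (rule inversion_set_root_cone[OF g]) (use insert in auto)
  then obtain w where w: "w \<in> carrier W" "?N w = root_cone (?N x \<union> ?N u)"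
    using join_of_two[OF g, of x u] insert u by auto
  have "root_cone (?N x \<union> ?N u) = root_cone (\<Union>x\<in>insert x X. ?N x)"
  proof
    show "root_cone (?N x \<union> ?N u) \<subseteq> root_cone (\<Union>x\<in>insert x X. ?N x)"
      unfolding u(2) using nonneg_cone_superset nonneg_cone_mono[of "\<Union>x\<in>X. ?N x" "\<Union>x\<in>insert x X. ?N x"]
      by (intro root_cone_subset) (auto simp: root_cone_def)
    show "root_cone (\<Union>x\<in>insert x X. ?N x) \<subseteq> root_cone (?N x \<union> ?N u)"
      unfolding u(2) using inversion_set_subset_root_cone[of _ "\<Union>x\<in>X. ?N x"]
      by (intro root_cone_mono) blast
  qed
  then show ?case using w by auto
qed

lemma join_inversion_set:
  assumes X: "X \<subseteq> carrier W" and bounded: "bounded_above X"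
  shows "\<Squnion>\<^bsub>right_weak_order\<^esub> X \<in> carrier W"
    and "inversion_set (\<Squnion>\<^bsub>right_weak_order\<^esub> X) = root_cone (\<Union>x\<in>X. inversion_set x)"
proof -
  let ?L = right_weak_order and ?N = inversion_set
  have carr: "carrier ?L = carrier W" and le: "le ?L = is_prefix" by (auto simp: right_weak_order_def)
  have Upper: "u \<in> Upper ?L X \<longleftrightarrow> u \<in> carrier W \<and> (\<forall>x\<in>X. ?N x \<subseteq> ?N u)" for u
    using X prefix_iff_inversion_set_subset unfolding Upper_def carr le by blast
  obtain g where g: "g \<in> carrier W" "\<And>x. x \<in> X \<Longrightarrow> ?N x \<subseteq> ?N g"
    using bounded unfolding bounded_above_def using Upper by blast
  have "finite X"
  proof (rule finite_imageD[of ?N])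
    show "finite (?N ` X)"
      by (rule finite_subset[of _ "Pow (?N g)"]) (use g finite_inversion_set in auto)
    show "inj_on ?N X" using inversion_set_inj X by (auto simp: inj_on_def)
  qed
  then obtain w where w: "w \<in> carrier W" "?N w = root_cone (\<Union>x\<in>X. ?N x)"
    using join_of_finite[OF g(1) _ X g(2)] by auto
  have "?N x \<subseteq> ?N w" if "x \<in> X" for x
    unfolding w(2) using that by (intro inversion_set_subset_root_cone) blast
  then have wU: "w \<in> Upper ?L X" using Upper w by blast
  have wle: "?N w \<subseteq> ?N u" if "u \<in> Upper ?L X" for u
    unfolding w(2) using that Upper by (intro inversion_set_root_cone) auto
  have "is_prefix w u" if "u \<in> Upper ?L X" for u
    using inversion_set_subset_prefix[OF w(1) _ wle[OF that]] that Upper by simp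
  then have "least ?L w (Upper ?L X)"
    using wU Upper by (auto simp: least_def carr le)
  then have "least ?L (\<Squnion>\<^bsub>?L\<^esub> X) (Upper ?L X)" unfolding sup_def by (rule someI)
  then have j: "\<Squnion>\<^bsub>?L\<^esub> X \<in> Upper ?L X" "is_prefix (\<Squnion>\<^bsub>?L\<^esub> X) w"
    unfolding least_def le using wU by auto
  then show "\<Squnion>\<^bsub>?L\<^esub> X \<in> carrier W" using Upper by blast
  moreover have "?N (\<Squnion>\<^bsub>?L\<^esub> X) = ?N w"
    using j wle prefix_iff_inversion_set_subset calculation w(1) by blast
  ultimately show "?N (\<Squnion>\<^bsub>?L\<^esub> X) = root_cone (\<Union>x\<in>X. ?N x)" using w by simp
qed

section \<open>Inner products of roots\<close>

lemma rep_B_simple: "s \<in> S \<Longrightarrow> B (\<alpha> t) (\<rho> s x) = B (\<alpha> t) x + bond s t * B (\<alpha> s) x"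
  by (simp add: rep_simple bond_def B_symmetric[of "\<alpha> t" "\<alpha> s"])

lemma rep_B_simple_self: "s \<in> S \<Longrightarrow> B (\<alpha> s) (\<rho> s x) = - B (\<alpha> s) x"
  by (simp add: rep_simple simple_unit)

text \<open>The length of the reflection is a depth on positive roots that is suited to induction: with \<open>r\<close>
  as in the statement, \<open>r\<close> is both a first and a last letter of \<open>s\<^sub>\<gamma>\<close>, and removing both gives the
  reflection in \<open>r \<gamma>\<close>.\<close>

lemma reflection_length_decreases:
  assumes r: "r \<in> S" and \<gamma>: "\<gamma> \<in> pos_roots" "\<gamma> \<noteq> \<alpha> r" and B: "0 < B (\<alpha> r) \<gamma>"
  shows "cox_length (reflection (\<rho> r \<gamma>)) < cox_length (reflection \<gamma>)"
proof -
  have root: "\<gamma> \<in> roots" using \<gamma> pos_root_root by blast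
  define k where "k = 2 * B \<gamma> (\<alpha> r)"
  have k: "0 < k" using B B_symmetric by (simp add: k_def)
  define \<kappa> where "\<kappa> = k *\<^sub>R \<gamma> - \<alpha> r"
  have R: "\<rho> (reflection \<gamma>) (\<alpha> r) = - \<kappa>" using root by (simp add: rep_reflection \<kappa>_def k_def)
  have \<kappa>root: "\<kappa> \<in> roots"
    using rep_root[of "reflection \<gamma>" "\<alpha> r"] root r simple_root R by simp
  have r\<gamma>: "\<rho> r \<gamma> \<in> pos_cone" using simple_reflection_permutes r \<gamma> pos_root_cone by blast
  have \<kappa>: "\<kappa> \<in> pos_roots"
  proof (rule ccontr)
    assume "\<kappa> \<notin> pos_roots"
    then have neg: "- \<kappa> \<in> pos_roots" using \<kappa>root pos_or_neg by blast
    have "- \<kappa> \<noteq> \<alpha> r" using k root root_nonzero by (auto simp: \<kappa>_def)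
    then have "\<rho> r (- \<kappa>) \<in> pos_cone" using simple_reflection_permutes r neg pos_root_cone by blast
    then have "\<rho> r (- \<kappa>) + k *\<^sub>R \<rho> r \<gamma> \<in> pos_cone"
      using r\<gamma> k by (intro nonneg_cone_add nonneg_cone_scale) auto
    moreover have "\<rho> r (- \<kappa>) + k *\<^sub>R \<rho> r \<gamma> = - \<alpha> r"
      using r by (simp add: \<kappa>_def)
    ultimately show False
      using pos_cone_neg_eq_0 simple_pos_cone r root_nonzero simple_root by metis
  qed
  have "\<kappa> \<noteq> \<alpha> r"
  proof
    assume "\<kappa> = \<alpha> r"
    then have "\<alpha> r + \<alpha> r = k *\<^sub>R \<gamma>" unfolding \<kappa>_def by (metis diff_add_cancel)
    then have "(1/2) *\<^sub>R (\<alpha> r + \<alpha> r) = (k/2) *\<^sub>R \<gamma>" by simp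
    then have "\<alpha> r = (k/2) *\<^sub>R \<gamma>" by (simp flip: scaleR_2)
    then show False using proportional_pos_roots simple_pos_root r \<gamma> by metis
  qed
  then have r\<kappa>: "\<rho> r \<kappa> \<in> pos_roots" using simple_reflection_permutes r \<kappa> by blast
  let ?g = "reflection \<gamma>" and ?x = "r \<otimes> reflection \<gamma>"
  have x: "?x \<in> carrier W" using r root by simp
  have "\<alpha> r \<in> inversion_set ?g"
    using mem_inversion_set[of ?g "\<alpha> r"] root R \<kappa> r simple_pos_root by simp
  then have "cox_length ?g = Suc (cox_length ?x)" using descent_length(1) r root by simp
  moreover have "cox_length (?x \<otimes> r) < cox_length ?x"
  proof (rule ccontr)
    assume "\<not> ?thesis"
    then have "\<rho> ?x (\<alpha> r) \<in> pos_cone" using length_increasing_positive[OF x] r by simp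
    then have "- \<rho> r \<kappa> \<in> pos_cone" using R r root by (simp add: rep_mult)
    then show False using r\<kappa> pos_cone_neg_eq_0 pos_root_cone pos_root_root root_nonzero by blast
  qed
  ultimately show ?thesis using reflection_rep[of r \<gamma>] r root by simp
qed

text \<open>The possible products of two roots: a finite dihedral subgroup that they generate has type
  \<open>A\<^sub>1 \<times> A\<^sub>1\<close> or \<open>A\<^sub>2\<close>.\<close>

definition crystallographic :: "real \<Rightarrow> bool" where
  "crystallographic x \<longleftrightarrow> x \<in> {0, 1/2, -1/2} \<or> 1 \<le> \<bar>x\<bar>"

text \<open>An invariant for climbing down along an infinite bond with \<open>B \<alpha>\<^sub>s \<gamma> > 0\<close>: passing from \<open>\<gamma>\<close> to \<open>s \<gamma>\<close>
  exchanges the roles of \<open>r\<close> and \<open>s\<close> and replaces the coefficients \<open>(a, b)\<close> by \<open>(a c - b, a)\<close>, again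
  with the first one larger by at least one. It ends when both products are non-positive, and then
  the first term alone is at most \<open>-1\<close>, or when \<open>\<gamma>\<close> is simple.\<close>

lemma infinite_bond_combination:
  assumes "\<gamma> \<in> pos_roots"
    and "\<And>\<gamma>' s. \<gamma>' \<in> pos_roots \<Longrightarrow> s \<in> S \<Longrightarrow>
      cox_length (reflection \<gamma>') \<le> cox_length (reflection \<gamma>) \<Longrightarrow> crystallographic (B (\<alpha> s) \<gamma>')"
    and "r \<in> S" "s \<in> S" "r \<noteq> s" "2 \<le> bond s r" "B (\<alpha> r) \<gamma> < 0" "2 \<le> a" "0 \<le> b" "b + 1 \<le> a"
  shows "a * B (\<alpha> r) \<gamma> + b * B (\<alpha> s) \<gamma> \<le> -1"
  using assms
proof (induction "cox_length (reflection \<gamma>)" arbitrary: \<gamma> r s a b rule: less_induct)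
  case less
  define X Y c where "X = B (\<alpha> s) \<gamma>" "Y = B (\<alpha> r) \<gamma>" "c = bond s r"
  have "crystallographic Y" using less.prems by (simp add: X_Y_c_def)
  then have Y: "Y \<le> -1/2" using less.prems(7) by (auto simp: crystallographic_def X_Y_c_def)
  have aY: "a * Y \<le> -1" using mult_mono[of 2 a "1/2" "- Y"] Y less.prems by simp
  show ?case
  proof (cases "X \<le> 0")
    case True
    then have "b * X \<le> 0" using less.prems by (simp add: mult_nonneg_nonpos)
    then show ?thesis using aY by (simp flip: X_Y_c_def)
  next
    case False
    show ?thesis
    proof (cases "\<gamma> = \<alpha> s")
      case True
      then have XY: "X = 1" "Y = - c / 2"
        using less.prems simple_unit bond_sym by (simp_all add: X_Y_c_def simple_B_bond)
      have "a * 1 \<le> a * (c / 2)" using less.prems by (intro mult_left_mono) (auto simp: X_Y_c_def)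
      then have "a * Y \<le> - a" using XY(2) by simp
      then have "a * Y + b * X \<le> -1" using XY(1) less.prems(10) by simp
      then show ?thesis by (simp only: X_Y_c_def)
    next
      case neq: False
      let ?\<gamma> = "\<rho> s \<gamma>"
      have lt: "cox_length (reflection ?\<gamma>) < cox_length (reflection \<gamma>)"
        using reflection_length_decreases less.prems neq False by (simp add: X_Y_c_def)
      have pos: "?\<gamma> \<in> pos_roots" using simple_reflection_permutes less.prems neq by blast
      have "2 * a \<le> c * a" using less.prems by (intro mult_right_mono) (auto simp: X_Y_c_def)
      then have "a + 1 \<le> a * bond s r - b"
        using less.prems(10) by (simp add: X_Y_c_def mult.commute)
      then have "(a * c - b) * B (\<alpha> s) ?\<gamma> + a * B (\<alpha> r) ?\<gamma> \<le> -1"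
        using less.hyps[OF lt pos _ less.prems(4,3), of "a * c - b" a] less.prems lt pos False
        by (auto simp: bond_sym[of r s] rep_B_simple_self X_Y_c_def mult.commute)
      moreover have "B (\<alpha> s) ?\<gamma> = - X" "B (\<alpha> r) ?\<gamma> = Y + c * X"
        unfolding X_Y_c_def using rep_B_simple rep_B_simple_self less.prems(4) by blast+
      ultimately show ?thesis by (simp add: algebra_simps flip: X_Y_c_def)
    qed
  qed
qed

text \<open>Induction on depth. Choose \<open>r\<close> with \<open>r \<gamma>\<close> of smaller depth, and let \<open>X, Y\<close> be the products of \<open>r \<gamma>\<close> with
  \<open>\<alpha>\<^sub>s\<close> and \<open>\<alpha>\<^sub>r\<close>, so that the product of \<open>\<gamma>\<close> with \<open>\<alpha>\<^sub>s\<close> is \<open>X + c Y\<close> with \<open>c\<close> the bond and \<open>Y < 0\<close>. The case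
  that needs care is \<open>c = 1\<close> and \<open>X > 0\<close>: then \<open>s r \<gamma>\<close> has still smaller depth, and \<open>X + Y\<close> is its
  product with \<open>\<alpha>\<^sub>r\<close>. For \<open>c \<ge> 2\<close> the value is at most \<open>-1\<close> by the preceding lemma.\<close>

lemma simple_root_product_crystallographic:
  assumes "\<gamma> \<in> pos_roots" "s \<in> S"
  shows "crystallographic (B (\<alpha> s) \<gamma>)"
  using assms
proof (induction "cox_length (reflection \<gamma>)" arbitrary: \<gamma> s rule: less_induct)
  case less
  show ?case
  proof (cases "\<exists>r\<in>S. \<gamma> = \<alpha> r")
    case True
    then obtain r where r: "r \<in> S" "\<gamma> = \<alpha> r" by blast
    show ?thesis
    proof (cases "s = r")
      case True
      then show ?thesis using r simple_unit by (simp add: crystallographic_def)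
    next
      case False
      from less.prems(2) r(1) False show ?thesis
        by (cases rule: bond_cases) (use r in \<open>simp_all add: crystallographic_def simple_B_bond\<close>)
    qed
  next
    case nonsimple: False
    obtain r where r: "r \<in> S" "0 < B (\<alpha> r) \<gamma>" using exists_positive_simple_product less.prems by blast
    let ?\<gamma> = "\<rho> r \<gamma>"
    have pos: "?\<gamma> \<in> pos_roots" using simple_reflection_permutes r nonsimple less.prems by blast
    have lt: "cox_length (reflection ?\<gamma>) < cox_length (reflection \<gamma>)"
      using reflection_length_decreases r nonsimple less.prems by blast
    define X Y c where "X = B (\<alpha> s) ?\<gamma>" "Y = B (\<alpha> r) ?\<gamma>" "c = bond s r"
    have cr: "crystallographic X" "crystallographic Y"
      using less.hyps[OF lt pos] less.prems r by (simp_all add: X_Y_c_def)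
    have Y: "Y < 0" using r by (simp add: X_Y_c_def rep_B_simple_self)
    have \<gamma>: "\<gamma> = \<rho> r ?\<gamma>" using r by simp
    show ?thesis
    proof (cases "s = r")
      case True
      then have "B (\<alpha> s) \<gamma> = - Y" using r by (simp add: X_Y_c_def rep_B_simple_self)
      then show ?thesis using cr by (auto simp: crystallographic_def)
    next
      case neq: False
      have val: "B (\<alpha> s) \<gamma> = X + c * Y"
        using rep_B_simple[of r s ?\<gamma>] r by (simp add: X_Y_c_def bond_sym[of r s])
      from less.prems(2) r(1) neq show ?thesis
      proof (cases rule: bond_cases)
        case 1
        then show ?thesis using val cr by (simp add: X_Y_c_def)
      next
        case 2
        show ?thesis
        proof (cases "X \<le> 0")
          case True
          then show ?thesis using val cr 2 Y by (auto simp: X_Y_c_def(3) crystallographic_def)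
        next
          case X: False
          show ?thesis
          proof (cases "?\<gamma> = \<alpha> s")
            case True
            have "X = 1" unfolding X_Y_c_def True using less.prems(2) by (rule simple_unit)
            moreover have "Y = - 1 / 2"
              unfolding X_Y_c_def True using simple_B_bond[of r s] bond_sym[of r s] 2 by simp
            ultimately
            show ?thesis using val 2 by (simp add: X_Y_c_def(3) crystallographic_def)
          next
            case False
            have "cox_length (reflection (\<rho> s ?\<gamma>)) < cox_length (reflection ?\<gamma>)"
              using reflection_length_decreases less.prems pos False X by (simp add: X_Y_c_def(1))
            then have "crystallographic (B (\<alpha> r) (\<rho> s ?\<gamma>))"
              using less.hyps[of "\<rho> s ?\<gamma>" r] lt simple_reflection_permutes pos False less.prems r by simp
            moreover have "B (\<alpha> r) (\<rho> s ?\<gamma>) = Y + c * X"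
              using less.prems by (simp add: rep_B_simple X_Y_c_def)
            ultimately show ?thesis using val 2 by (simp add: X_Y_c_def(3) add.commute)
          qed
        qed
      next
        case 3
        have "crystallographic (B (\<alpha> t) \<gamma>')"
          if "\<gamma>' \<in> pos_roots" "t \<in> S" "cox_length (reflection \<gamma>') \<le> cox_length (reflection ?\<gamma>)" for \<gamma>' t
          using less.hyps[of \<gamma>' t] that lt by simp
        then have "c * Y + 1 * X \<le> -1"
          unfolding X_Y_c_def using infinite_bond_combination[OF pos, of r s "bond s r" 1] r less.prems neq 3 Y
          by (simp add: X_Y_c_def)
        then show ?thesis using val by (simp add: crystallographic_def)
      qed
    qed
  qed
qed

section \<open>Dominance\<close>

lemma dominates_refl: "dominates \<beta> \<beta>"
  by (simp add: dominates_def)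

lemma dominates_trans: "dominates \<beta> \<gamma> \<Longrightarrow> dominates \<gamma> \<delta> \<Longrightarrow> dominates \<beta> \<delta>"
  by (simp add: dominates_def)

text \<open>A root \<open>\<beta> = u \<alpha>\<^sub>s\<close> is the only root in which the inversion sets of \<open>u\<close> and \<open>u s\<close> differ.\<close>

lemma dominates_antisym:
  assumes "\<beta> \<in> pos_roots" "dominates \<beta> \<gamma>" "dominates \<gamma> \<beta>"
  shows "\<beta> = \<gamma>"
proof -
  obtain u s where us: "u \<in> carrier W" "s \<in> S" "\<beta> = \<rho> u (\<alpha> s)"
    using pos_root_root[OF assms(1)] unfolding roots_def by blast
  then have N: "inversion_set (u \<otimes> s) = insert \<beta> (inversion_set u)" "\<beta> \<notin> inversion_set u"
    using inversion_set_right assms(1) by auto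
  then have "\<gamma> \<in> insert \<beta> (inversion_set u)" using assms(2) us by (auto simp: dominates_def)
  then show ?thesis using N assms(3) us by (auto simp: dominates_def)
qed

text \<open>The reflection in \<open>\<beta>\<close> has \<open>\<beta>\<close> but not \<open>\<alpha>\<^sub>s\<close> as an inversion.\<close>

lemma not_dominates_nonpos:
  assumes s: "s \<in> S" and \<beta>: "\<beta> \<in> pos_roots" and B: "B (\<alpha> s) \<beta> \<le> 0"
  shows "\<not> dominates \<beta> (\<alpha> s)"
proof -
  let ?g = "reflection \<beta>"
  have root: "\<beta> \<in> roots" using \<beta> pos_root_root by blast
  have "\<beta> \<in> inversion_set ?g" using \<beta> root mem_inversion_set[of ?g \<beta>] by (simp add: reflection_self)
  moreover have "\<alpha> s \<notin> inversion_set ?g"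
  proof -
    have "\<alpha> s + (- 2 * B (\<alpha> s) \<beta>) *\<^sub>R \<beta> \<in> pos_cone"
      using B pos_root_cone[OF \<beta>] simple_pos_cone[OF s] by (intro nonneg_cone_add nonneg_cone_scale) auto
    then have "\<rho> ?g (\<alpha> s) \<in> pos_cone" using root by (simp add: rep_reflection B_symmetric[of \<beta>])
    then have "\<rho> ?g (\<alpha> s) \<in> pos_roots" using pos_rootI rep_root root s simple_root by simp
    then show ?thesis using mem_inversion_set_not_pos[of ?g "\<alpha> s"] root s simple_pos_root by simp
  qed
  ultimately show ?thesis using root by (auto simp: dominates_def)
qed

text \<open>In the plane of \<open>\<alpha>\<^sub>s\<close> and \<open>\<beta>\<close> the positive roots are \<open>\<alpha>\<^sub>s, \<beta>, \<kappa> = s \<beta>\<close> of a system of type \<open>A\<^sub>2\<close> with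
  simple roots \<open>\<alpha>\<^sub>s\<close> and \<open>\<kappa>\<close>; among these three the element \<open>s\<^sub>\<kappa> s\<close> inverts \<open>\<kappa>\<close> and \<open>\<beta>\<close> only.\<close>

lemma not_dominates_half:
  assumes s: "s \<in> S" and \<beta>: "\<beta> \<in> pos_roots" and B: "B (\<alpha> s) \<beta> = 1 / 2"
  shows "\<not> dominates \<beta> (\<alpha> s)"
proof -
  define \<kappa> where "\<kappa> = \<rho> s \<beta>"
  have "\<beta> \<noteq> \<alpha> s" using B s simple_unit by auto
  then have \<kappa>: "\<kappa> \<in> pos_roots" using simple_reflection_permutes s \<beta> by (simp add: \<kappa>_def)
  then have root: "\<kappa> \<in> roots" using pos_root_root by blast
  have eq: "\<kappa> = \<beta> - \<alpha> s" unfolding \<kappa>_def rep_simple[OF s] B by simp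
  let ?w = "reflection \<kappa> \<otimes> s"
  have w: "?w \<in> carrier W" using root s by simp
  have rep: "\<rho> (inv ?w) v = \<rho> s (v - (2 * B \<kappa> v) *\<^sub>R \<kappa>)" for v
    using root s by (simp add: inv_mult_group rep_mult rep_reflection)
  have "B \<kappa> \<beta> = 1/2" "B \<kappa> (\<alpha> s) = - 1/2"
    using B root_unit[OF pos_root_root[OF \<beta>]] s simple_unit B_symmetric[of \<beta> "\<alpha> s"] by (simp_all add: eq)
  then have "\<rho> (inv ?w) \<beta> = - \<alpha> s" "\<rho> (inv ?w) (\<alpha> s) = \<kappa>"
    using rep[of \<beta>] rep[of "\<alpha> s"] s by (simp_all add: eq) (simp_all add: rep_simple B)
  then have "\<beta> \<in> inversion_set ?w" "\<alpha> s \<notin> inversion_set ?w"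
    using mem_inversion_set[OF w] \<beta> \<kappa> s simple_pos_root not_pos_and_neg[OF \<kappa>] by auto
  then show ?thesis using w by (auto simp: dominates_def)
qed

text \<open>If neither dominates the other, then there are \<open>u\<close> inverting \<open>\<beta>\<close> but not \<open>\<gamma>\<close>, and \<open>v\<close> inverting
  \<open>\<gamma>\<close> but not \<open>\<beta>\<close>. The chain from \<open>\<beta>\<close> to \<open>- \<gamma>\<close> is infinite; each of its roots is either positive and
  an inversion of \<open>u\<close>, or the negative of an inversion of \<open>v\<close>, but \<open>u\<close> and \<open>v\<close> have only finitely many.\<close>

lemma dominance_dichotomy:
  assumes \<beta>: "\<beta> \<in> pos_roots" and \<gamma>: "\<gamma> \<in> pos_roots" and neq: "\<beta> \<noteq> \<gamma>" and B: "1 \<le> B \<beta> \<gamma>"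
  shows "dominates \<beta> \<gamma> \<or> dominates \<gamma> \<beta>"
proof (rule ccontr)
  assume "\<not> ?thesis"
  then obtain u v where u: "u \<in> carrier W" "\<beta> \<in> inversion_set u" "\<gamma> \<notin> inversion_set u"
    and v: "v \<in> carrier W" "\<gamma> \<in> inversion_set v" "\<beta> \<notin> inversion_set v"
    by (auto simp: dominates_def)
  let ?p = "chain \<beta> (- \<gamma>)" and ?t = "dihedral_coeff (2 * B \<beta> \<gamma>)"
  have roots: "\<beta> \<in> roots" "- \<gamma> \<in> roots" using \<beta> \<gamma> pos_root_root by auto
  have t: "0 \<le> ?t n" for n using dihedral_coeff_grows B by simp
  have inj: "inj ?p" using inj_chain[OF roots] neq B by simp
  have uc: "- \<rho> (inv u) \<beta> \<in> pos_cone" "\<rho> (inv u) \<gamma> \<in> pos_cone"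
    and vc: "\<rho> (inv v) \<beta> \<in> pos_cone" "- \<rho> (inv v) \<gamma> \<in> pos_cone"
    using u v mem_inversion_set mem_inversion_set_not_pos \<beta> \<gamma> pos_root_cone by blast+
  have "?p n \<in> inversion_set u \<union> uminus ` inversion_set v" for n
  proof (cases "?p n \<in> pos_roots")
    case True
    have "?t (Suc n) *\<^sub>R (- \<rho> (inv u) \<beta>) + ?t n *\<^sub>R \<rho> (inv u) \<gamma> \<in> pos_cone"
      by (intro nonneg_cone_add nonneg_cone_scale t uc)
    then have "- \<rho> (inv u) (?p n) \<in> pos_cone" using u(1) by (simp add: chain_def)
    then have "?p n \<in> inversion_set u"
      using True mem_inversion_set[OF u(1)] pos_rootI rep_root chain_root roots u(1) by simp
    then show ?thesis by blast
  next
    case False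
    then have neg: "- ?p n \<in> pos_roots" using pos_or_neg chain_root roots by blast
    have "?t (Suc n) *\<^sub>R \<rho> (inv v) \<beta> + ?t n *\<^sub>R (- \<rho> (inv v) \<gamma>) \<in> pos_cone"
      by (intro nonneg_cone_add nonneg_cone_scale t vc)
    then have "\<rho> (inv v) (?p n) \<in> pos_cone" using v(1) by (simp add: chain_def)
    then have "- ?p n \<in> inversion_set v"
      using neg mem_inversion_set[OF v(1)] pos_rootI rep_root chain_root roots v(1) by simp
    then show ?thesis by (metis UnI2 image_eqI minus_minus)
  qed
  then have "finite (range ?p)"
    using finite_inversion_set[OF u(1)] finite_inversion_set[OF v(1)]
    by (meson finite_UnI finite_imageI finite_subset image_subsetI)
  then show False using inj range_inj_infinite by blast
qed

text \<open>A chain restarted at a later pair of neighbours; its members beyond the pair lie in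
  \<open>cone(p\<^sub>n\<^sub>+\<^sub>1, - p\<^sub>n)\<close>.\<close>

lemma chain_shift:
  "chain x y (Suc n + j) = dihedral_coeff (- 2 * B x y) (Suc j) *\<^sub>R chain x y (Suc n)
    - dihedral_coeff (- 2 * B x y) j *\<^sub>R chain x y n"
proof (induction j rule: induct_nat_012)
  case (ge2 j)
  have "chain x y (Suc n + Suc (Suc j))
      = (- 2 * B x y) *\<^sub>R chain x y (Suc n + Suc j) - chain x y (Suc n + j)"
    by (simp add: chain_Suc_Suc)
  then show ?case unfolding ge2 by (simp add: algebra_simps)
qed (simp_all add: chain_Suc_Suc)

lemma chain_pos:
  assumes "x \<in> pos_roots" "y \<in> pos_roots" "B x y \<le> -1"
  shows "chain x y n \<in> pos_roots"
proof -
  have "chain x y n \<in> pos_cone"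
    unfolding chain_def using dihedral_coeff_grows[of "- 2 * B x y"] assms pos_root_cone
    by (intro nonneg_cone_add nonneg_cone_scale) auto
  then show ?thesis using pos_rootI chain_root assms pos_root_root by blast
qed

text \<open>An element inverting \<open>p\<^sub>n\<^sub>+\<^sub>1\<close> but not \<open>p\<^sub>n\<close> would invert all later roots of the chain.\<close>

lemma chain_dominates_Suc:
  assumes x: "x \<in> pos_roots" and y: "y \<in> pos_roots" and B: "B x y \<le> -1"
  shows "dominates (chain x y (Suc n)) (chain x y n)"
  unfolding dominates_def
proof (intro ballI impI, rule ccontr)
  let ?p = "chain x y" and ?t = "dihedral_coeff (- 2 * B x y)"
  fix w assume w: "w \<in> carrier W" "?p (Suc n) \<in> inversion_set w" "?p n \<notin> inversion_set w"
  have t: "0 \<le> ?t j" for j using dihedral_coeff_grows B by simp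
  have c: "- \<rho> (inv w) (?p (Suc n)) \<in> pos_cone" "\<rho> (inv w) (?p n) \<in> pos_cone"
    using w mem_inversion_set mem_inversion_set_not_pos chain_pos[OF x y B] pos_root_cone by blast+
  have "?p (Suc n + j) \<in> inversion_set w" for j
  proof -
    have "?t (Suc j) *\<^sub>R (- \<rho> (inv w) (?p (Suc n))) + ?t j *\<^sub>R \<rho> (inv w) (?p n) \<in> pos_cone"
      by (intro nonneg_cone_add nonneg_cone_scale t c)
    then have "- \<rho> (inv w) (?p (Suc n + j)) \<in> pos_cone" unfolding chain_shift using w(1) by simp
    then show ?thesis using w(1) chain_pos[OF x y B, of "Suc n + j"] mem_inversion_set[OF w(1)]
        pos_rootI rep_root pos_root_root by simp
  qed
  then have "(\<lambda>j. ?p (Suc n + j)) ` UNIV \<subseteq> inversion_set w" by blast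
  then have "finite (range (\<lambda>j. ?p (Suc n + j)))" using finite_inversion_set[OF w(1)] finite_subset by blast
  moreover have "inj (\<lambda>j. ?p (Suc n + j))"
  proof -
    have "y \<noteq> - x" using x y not_pos_and_neg by blast
    then have "inj ?p" using inj_chain B x y pos_root_root by blast
    then show ?thesis by (auto intro!: injI dest!: injD)
  qed
  ultimately show False using range_inj_infinite by blast
qed

lemma chain_dominates:
  assumes "x \<in> pos_roots" "y \<in> pos_roots" "B x y \<le> -1" "m \<le> n"
  shows "dominates (chain x y n) (chain x y m)"
  using assms(4)
  by (induction rule: dec_induct) (use assms chain_dominates_Suc dominates_refl dominates_trans in blast)+

lemma small_roots_iff:
  "\<beta> \<in> small_roots n \<longleftrightarrow>
    \<beta> \<in> pos_roots \<and> finite (strictly_dominated \<beta>) \<and> card (strictly_dominated \<beta>) \<le> n"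
  by (auto simp: small_roots_def inf_depth_def)

lemma strictly_dominated_mono:
  assumes "\<beta> \<in> pos_roots" "dominates \<beta> \<gamma>"
  shows "strictly_dominated \<gamma> \<subseteq> strictly_dominated \<beta>"
proof
  fix \<delta> assume \<delta>: "\<delta> \<in> strictly_dominated \<gamma>"
  then have "dominates \<beta> \<delta>" using assms dominates_trans by (auto simp: strictly_dominated_def)
  moreover have "\<delta> \<noteq> \<beta>" using \<delta> dominates_antisym[OF assms] by (auto simp: strictly_dominated_def)
  ultimately show "\<delta> \<in> strictly_dominated \<beta>" using \<delta> by (simp add: strictly_dominated_def)
qed

lemma small_roots_dominated:
  assumes "\<beta> \<in> small_roots n" "\<gamma> \<in> pos_roots" "dominates \<beta> \<gamma>"
  shows "\<gamma> \<in> small_roots n"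
proof -
  have "strictly_dominated \<gamma> \<subseteq> strictly_dominated \<beta>"
    using assms strictly_dominated_mono by (simp add: small_roots_iff)
  then show ?thesis using assms by (auto simp: small_roots_iff intro: finite_subset dest: card_mono)
qed

lemma strictly_dominated_transport:
  assumes s: "s \<in> S" and \<beta>: "\<beta> \<in> pos_roots" "\<beta> \<noteq> \<alpha> s" and nd: "\<not> dominates \<beta> (\<alpha> s)"
  shows "\<rho> s ` strictly_dominated \<beta> \<subseteq> strictly_dominated (\<rho> s \<beta>)"
proof
  fix \<delta> assume "\<delta> \<in> \<rho> s ` strictly_dominated \<beta>"
  then obtain \<kappa> where \<kappa>: "\<delta> = \<rho> s \<kappa>" "\<kappa> \<in> pos_roots" "dominates \<beta> \<kappa>" "\<kappa> \<noteq> \<beta>"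
    by (auto simp: strictly_dominated_def)
  then have "\<kappa> \<noteq> \<alpha> s" using nd by blast
  moreover have "dominates (\<rho> s \<beta>) (\<rho> s \<kappa>)"
    unfolding dominates_def
  proof (intro ballI impI)
    fix w assume w: "w \<in> carrier W" "\<rho> s \<beta> \<in> inversion_set w"
    then have "\<beta> \<in> inversion_set (s \<otimes> w)" using inversion_set_left s \<beta> by simp
    then have "\<kappa> \<in> inversion_set (s \<otimes> w)" using \<kappa> w s by (simp add: dominates_def)
    then show "\<rho> s \<kappa> \<in> inversion_set w" using inversion_set_left[OF w(1) s] \<open>\<kappa> \<noteq> \<alpha> s\<close> by simp
  qed
  ultimately show "\<delta> \<in> strictly_dominated (\<rho> s \<beta>)"
    using \<kappa> simple_reflection_permutes s by (auto simp: strictly_dominated_def)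
qed

text \<open>If \<open>\<beta>\<close> does not dominate \<open>\<alpha>\<^sub>s\<close>, then \<open>s\<close> maps the roots dominated by \<open>\<beta>\<close> injectively to those dominated
  by \<open>s \<beta>\<close>, so the depth of \<open>\<beta>\<close> is at most that of \<open>s \<beta>\<close>.\<close>

lemma small_roots_transport:
  assumes s: "s \<in> S" and \<beta>: "\<beta> \<in> pos_roots" "\<beta> \<noteq> \<alpha> s" and nd: "\<not> dominates \<beta> (\<alpha> s)"
    and small: "\<rho> s \<beta> \<in> small_roots n"
  shows "\<beta> \<in> small_roots n"
proof -
  have inj: "inj_on (\<rho> s) A" for A using s by (auto simp: inj_on_def)
  have sub: "\<rho> s ` strictly_dominated \<beta> \<subseteq> strictly_dominated (\<rho> s \<beta>)"
    by (rule strictly_dominated_transport) fact+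
  moreover have fin: "finite (strictly_dominated (\<rho> s \<beta>))" using small by (simp add: small_roots_iff)
  ultimately have "finite (strictly_dominated \<beta>)" using finite_subset finite_imageD inj by metis
  moreover have "card (strictly_dominated \<beta>) \<le> card (strictly_dominated (\<rho> s \<beta>))"
    using card_mono[OF fin sub] card_image[OF inj] by metis
  ultimately show ?thesis using small \<beta> by (simp add: small_roots_iff)
qed

lemma simple_root_small: "s \<in> S \<Longrightarrow> \<alpha> s \<in> small_roots n"
proof -
  assume s: "s \<in> S"
  then have "strictly_dominated (\<alpha> s) = {}"
    using inversion_set_generator[OF s] by (auto simp: strictly_dominated_def dominates_def)
  then show ?thesis using s simple_pos_root by (simp add: small_roots_iff)
qed

section \<open>Finiteness of the sets of small roots\<close>

lemma card_strictly_dominated_less: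
  assumes "\<beta> \<in> pos_roots" "\<gamma> \<in> pos_roots" "\<beta> \<noteq> \<gamma>" "dominates \<beta> \<gamma>" "finite (strictly_dominated \<beta>)"
  shows "card (strictly_dominated \<gamma>) < card (strictly_dominated \<beta>)"
proof (rule psubset_card_mono[OF assms(5)])
  have "\<gamma> \<in> strictly_dominated \<beta>" "\<gamma> \<notin> strictly_dominated \<gamma>"
    using assms by (auto simp: strictly_dominated_def)
  moreover have "strictly_dominated \<gamma> \<subseteq> strictly_dominated \<beta>"
    using assms strictly_dominated_mono by blast
  ultimately show "strictly_dominated \<gamma> \<subset> strictly_dominated \<beta>" by blast
qed

text \<open>A reflection with product at most \<open>-1\<close> adds \<open>\<alpha>\<^sub>s\<close> to the dominated roots, by \<open>dominance_dichotomy\<close>.\<close>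

lemma depth_mono:
  assumes s: "s \<in> S" and \<beta>: "\<beta> \<in> pos_roots" and neg: "B (\<alpha> s) \<beta> < 0"
    and fin: "finite (strictly_dominated (\<rho> s \<beta>))"
  shows "card (strictly_dominated \<beta>) \<le> card (strictly_dominated (\<rho> s \<beta>))"
    and "B (\<alpha> s) \<beta> \<le> -1 \<Longrightarrow> card (strictly_dominated \<beta>) < card (strictly_dominated (\<rho> s \<beta>))"
proof -
  have neq: "\<beta> \<noteq> \<alpha> s" using neg s simple_unit by auto
  have inj: "inj_on (\<rho> s) A" for A using s by (auto simp: inj_on_def)
  have sub: "\<rho> s ` strictly_dominated \<beta> \<subseteq> strictly_dominated (\<rho> s \<beta>)"
    using strictly_dominated_transport not_dominates_nonpos s \<beta> neq neg by simp
  then show "card (strictly_dominated \<beta>) \<le> card (strictly_dominated (\<rho> s \<beta>))"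
    using card_mono[OF fin sub] card_image[OF inj] by metis
  assume B: "B (\<alpha> s) \<beta> \<le> -1"
  have s\<beta>: "\<rho> s \<beta> \<in> pos_roots" "\<rho> s \<beta> \<noteq> \<alpha> s"
    using simple_reflection_permutes s \<beta> neq not_pos_and_neg rep_S_self rep_S_twice simple_pos_root
    by (blast, metis)
  have "1 \<le> B (\<rho> s \<beta>) (\<alpha> s)"
    using B B_symmetric[of "\<rho> s \<beta>" "\<alpha> s"] rep_B_simple_self[OF s] by simp
  moreover have "\<not> dominates (\<alpha> s) (\<rho> s \<beta>)"
    using inversion_set_generator[OF s] s s\<beta>(2) by (auto simp: dominates_def)
  ultimately have "\<alpha> s \<in> strictly_dominated (\<rho> s \<beta>)"
    using dominance_dichotomy[OF s\<beta>(1) simple_pos_root[OF s]] s\<beta> s simple_pos_root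
    by (auto simp: strictly_dominated_def)
  moreover have "\<alpha> s \<notin> \<rho> s ` strictly_dominated \<beta>"
  proof
    assume "\<alpha> s \<in> \<rho> s ` strictly_dominated \<beta>"
    then obtain \<kappa> where \<kappa>: "\<alpha> s = \<rho> s \<kappa>" "\<kappa> \<in> pos_roots"
      by (auto simp: strictly_dominated_def)
    then have "\<kappa> = - \<alpha> s" using rep_S_twice rep_S_self s by metis
    then show False using s simple_pos_root not_pos_and_neg \<kappa> by blast
  qed
  ultimately have "\<rho> s ` strictly_dominated \<beta> \<subset> strictly_dominated (\<rho> s \<beta>)" using sub by blast
  then show "card (strictly_dominated \<beta>) < card (strictly_dominated (\<rho> s \<beta>))"
    using psubset_card_mono[OF fin] card_image[OF inj] by metis
qed

definition ascends :: "nat \<Rightarrow> 'v \<Rightarrow> 'v \<Rightarrow> bool" where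
  "ascends n \<beta> \<gamma> \<longleftrightarrow> \<beta> \<in> small_roots n \<and> \<gamma> \<in> small_roots n \<and>
    (\<exists>s\<in>S. B (\<alpha> s) \<beta> < 0 \<and> \<gamma> = \<rho> s \<beta>)"

lemma small_root_reachable:
  assumes "\<gamma> \<in> small_roots n"
  shows "\<exists>s\<in>S. (ascends n)\<^sup>*\<^sup>* (\<alpha> s) \<gamma>"
  using assms
proof (induction "cox_length (reflection \<gamma>)" arbitrary: \<gamma> rule: less_induct)
  case less
  have pos: "\<gamma> \<in> pos_roots" using less.prems by (simp add: small_roots_iff)
  show ?case
  proof (cases "\<exists>s\<in>S. \<gamma> = \<alpha> s")
    case False
    obtain r where r: "r \<in> S" "0 < B (\<alpha> r) \<gamma>" using exists_positive_simple_product pos by blast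
    let ?\<gamma> = "\<rho> r \<gamma>"
    have \<gamma>: "?\<gamma> \<in> pos_roots" "B (\<alpha> r) ?\<gamma> < 0" "\<rho> r ?\<gamma> = \<gamma>"
      using simple_reflection_permutes r False pos by (auto simp: rep_B_simple_self)
    then have "?\<gamma> \<noteq> \<alpha> r" using r simple_unit by auto
    then have small: "?\<gamma> \<in> small_roots n"
      using small_roots_transport[of r ?\<gamma>] not_dominates_nonpos[of r ?\<gamma>] r \<gamma> less.prems by simp
    have "cox_length (reflection ?\<gamma>) < cox_length (reflection \<gamma>)"
      using reflection_length_decreases r pos False by blast
    then obtain s where "s \<in> S" "(ascends n)\<^sup>*\<^sup>* (\<alpha> s) ?\<gamma>" using less.hyps small by blast
    moreover have "ascends n ?\<gamma> \<gamma>" using small less.prems \<gamma> r unfolding ascends_def by metis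
    ultimately show ?thesis by (meson rtranclp.rtrancl_into_rtrancl)
  qed blast
qed

lemma infinite_ascending_path:
  assumes "infinite (small_roots n)"
  shows "\<exists>b. \<forall>i::nat. ascends n (b i) (b (Suc i))"
proof -
  define R where "R \<beta> = {\<gamma>. (ascends n)\<^sup>*\<^sup>* \<beta> \<gamma>}" for \<beta>
  have "small_roots n \<subseteq> (\<Union>s\<in>S. R (\<alpha> s))" using small_root_reachable by (auto simp: R_def)
  then have start: "\<exists>s\<in>S. infinite (R (\<alpha> s))"
    using assms finite_S finite_subset by (metis (no_types, lifting) finite_UN)
  have step: "\<exists>\<gamma>. infinite (R \<gamma>) \<and> ascends n \<beta> \<gamma>" if inf: "infinite (R \<beta>)" for \<beta>
  proof (rule ccontr)
    assume no: "\<not> ?thesis"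
    have "{\<gamma>. ascends n \<beta> \<gamma>} \<subseteq> (\<lambda>s. \<rho> s \<beta>) ` S" by (auto simp: ascends_def)
    then have "finite {\<gamma>. ascends n \<beta> \<gamma>}" using finite_S finite_subset by blast
    then have "finite (\<Union>\<gamma>\<in>{\<gamma>. ascends n \<beta> \<gamma>}. R \<gamma>)" using no by blast
    moreover have "R \<beta> \<subseteq> insert \<beta> (\<Union>\<gamma>\<in>{\<gamma>. ascends n \<beta> \<gamma>}. R \<gamma>)"
      unfolding R_def by (auto elim: converse_rtranclpE)
    ultimately show False using inf finite_subset by blast
  qed
  have "\<exists>b. \<forall>i::nat. infinite (R (b i)) \<and> ascends n (b i) (b (Suc i))"
    by (rule dependent_nat_choice) (use start step in auto)
  then show ?thesis by blast
qed

text \<open>The theorem of Brink and Howlett for \<open>n = 0\<close>, and its extension to all depths.\<close>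

theorem finite_small_roots: "finite (small_roots n)"
proof (rule ccontr)
  assume "infinite (small_roots n)"
  then obtain b where b: "\<And>i::nat. ascends n (b i) (b (Suc i))" using infinite_ascending_path by blast
  then have small: "b i \<in> small_roots n" for i by (simp add: ascends_def)
  then have pos: "b i \<in> pos_roots" and fin: "finite (strictly_dominated (b i))"
    and bound: "card (strictly_dominated (b i)) \<le> n" for i by (simp_all add: small_roots_iff)
  have "\<forall>i. \<exists>s. s \<in> S \<and> B (\<alpha> s) (b i) < 0 \<and> b (Suc i) = \<rho> s (b i)"
    using b unfolding ascends_def by blast
  then obtain l where l: "\<And>i. l i \<in> S" "\<And>i. B (\<alpha> (l i)) (b i) < 0" "\<And>i. b (Suc i) = \<rho> (l i) (b i)"
    by metis
  define d where "d i = card (strictly_dominated (b i))" for i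
  have "mono d"
    unfolding d_def by (rule incseq_SucI) (metis depth_mono(1) fin l pos)
  \<comment> \<open>From \<open>N\<close> on the depth is constant, so every step adds the simple root itself.\<close>
  obtain N where N: "\<And>i. d i \<le> d N"
    using ex_has_greatest_nat[of "\<lambda>_. True" 0 d "Suc n"] bound by (auto simp: d_def less_Suc_eq_le)
  then have const: "d i = d N" if "N \<le> i" for i using that \<open>mono d\<close> by (simp add: le_antisym monoD)
  have half: "B (\<alpha> (l i)) (b i) = - 1 / 2" if "N \<le> i" for i
  proof -
    have "-1 < B (\<alpha> (l i)) (b i)"
      using depth_mono(2)[OF l(1) pos l(2), of i] fin[of "Suc i"] const[of i] const[of "Suc i"] that
      unfolding l(3)[symmetric] by (fastforce simp: d_def)
    then show ?thesis
      using simple_root_product_crystallographic[OF pos l(1), of i i] l(2)[of i]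
      by (auto simp: crystallographic_def)
  qed
  have succ: "b (Suc i) = b i + \<alpha> (l i)" if "N \<le> i" for i
    using half[OF that] l(1)[of i] by (simp add: l(3) rep_simple)
  \<comment> \<open>The letters used infinitely often; from \<open>M\<close> on no other letter occurs.\<close>
  define J where "J = {t \<in> S. infinite {i. l i = t}}"
  have J: "finite J" "J \<subseteq> S" using finite_S by (auto simp: J_def)
  have "finite (\<Union>t\<in>S - J. {i. l i = t})" using finite_S by (auto simp: J_def)
  then obtain M0 where M0: "\<And>t i. t \<in> S - J \<Longrightarrow> l i = t \<Longrightarrow> i < M0"
    unfolding finite_nat_set_iff_bounded by blast
  define M where "M = max N M0"
  have lJ: "l i \<in> J" if "M \<le> i" for i using M0[of "l i" i] l(1)[of i] that by (auto simp: M_def)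
  have MN: "N \<le> M" by (simp add: M_def)
  have bounded: "eventually (\<lambda>i. B (\<alpha> t) (b i) \<in> {0, 1/2, -1/2}) sequentially" if t: "t \<in> J" for t
  proof -
    have tS: "t \<in> S" and inf: "infinite {i. l i = t}" using t by (auto simp: J_def)
    have drop: "B (\<alpha> t) (b (Suc i)) \<le> B (\<alpha> t) (b i)" if "N \<le> i" "l i \<noteq> t" for i
      using succ[OF that(1)] simple_B_le_0[of t "l i"] tS l(1) that by auto
    obtain k where k: "M \<le> k" "l k = t" using inf unfolding infinite_nat_iff_unbounded_le by blast
    \<comment> \<open>Using the letter \<open>t\<close> changes the product from \<open>-1/2\<close> to \<open>1/2\<close>, and the other letters only decrease it.\<close>
    have upper: "B (\<alpha> t) (b i) \<le> 1/2" if "Suc k \<le> i" for i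
      using that
    proof (induction rule: dec_induct)
      case base
      then show ?case using half[of k] succ[of k] k MN simple_unit[OF tS] by simp
    next
      case (step i)
      show ?case
      proof (cases "l i = t")
        case True
        then show ?thesis using half[of i] succ[of i] k MN step simple_unit[OF tS] by simp
      next
        case False
        then show ?thesis using drop[of i] step k MN by simp
      qed
    qed
    \<comment> \<open>Once at most \<open>-1\<close>, the product would stay there, and \<open>t\<close> could not be used again.\<close>
    have lower: "-1 < B (\<alpha> t) (b i)" if i: "N \<le> i" for i
    proof (rule ccontr)
      assume start: "\<not> ?thesis"
      have low: "B (\<alpha> t) (b j) \<le> -1" if "i \<le> j" for j
        using that
      proof (induction rule: dec_induct)
        case (step j)
        then have "l j \<noteq> t" using half[of j] i by auto
        then show ?case using drop[of j] step i by simp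
      qed (use start in simp)
      obtain j where "i \<le> j" "l j = t" using inf unfolding infinite_nat_iff_unbounded_le by blast
      then show False using low[of j] half[of j] i by simp
    qed
    have "B (\<alpha> t) (b i) \<in> {0, 1/2, -1/2}" if "Suc k \<le> i" for i
      using upper[OF that] lower[of i] simple_root_product_crystallographic[OF pos tS, of i] that k MN
      by (auto simp: crystallographic_def)
    then show ?thesis unfolding eventually_sequentially by blast
  qed
  then have "eventually (\<lambda>i. \<forall>t\<in>J. B (\<alpha> t) (b i) \<in> {0, 1/2, -1/2}) sequentially"
    using J by (intro eventually_ball_finite) auto
  then obtain K0 where K0: "\<And>i t. K0 \<le> i \<Longrightarrow> t \<in> J \<Longrightarrow> B (\<alpha> t) (b i) \<in> {0, 1/2, -1/2}"
    unfolding eventually_sequentially by blast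
  define K where "K = max K0 M"
  define F where "F i = restrict (\<lambda>t. B (\<alpha> t) (b i)) J" for i
  have "F ` {K..} \<subseteq> J \<rightarrow>\<^sub>E {0, 1/2, -1/2}"
    unfolding image_subset_iff F_def restrict_PiE_iff K_def using K0
    by (metis atLeast_iff max.bounded_iff)
  moreover have "finite (J \<rightarrow>\<^sub>E {0, 1/2, -1/2 :: real})" using J by (intro finite_PiE) auto
  ultimately have "finite (F ` {K..})" by (rule finite_subset)
  then have "\<not> inj_on F {K..}" using finite_imageD infinite_Ici by blast
  then obtain i j where ij: "K \<le> i" "i < j" "F i = F j"
    unfolding inj_on_def by (metis atLeast_iff linorder_neqE_nat)
  \<comment> \<open>The difference of two roots with the same products is orthogonal to \<open>\<alpha>(J)\<close>, in whose cone it lies.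
    As both roots have norm one, it is orthogonal to them as well.\<close>
  define \<delta> where "\<delta> = b j - b i"
  have orth: "B (\<alpha> t) \<delta> = 0" if "t \<in> J" for t
    using fun_cong[OF ij(3), of t] that by (simp add: F_def \<delta>_def)
  have diff: "b q - b p \<in> nonneg_cone (\<alpha> ` J)" if "M \<le> p" "p \<le> q" for p q
    using that(2)
  proof (induction rule: dec_induct)
    case base
    then show ?case by (simp add: zero_mem_nonneg_cone)
  next
    case (step q)
    have eq: "b (Suc q) - b p = 1 *\<^sub>R \<alpha> (l q) + (b q - b p)" using succ[of q] step that MN by simp
    show ?case unfolding eq
      by (rule nonneg_cone_insert_term[OF step(3)]) (use lJ[of q] step that in simp_all)
  qed
  have Mi: "M \<le> i" using ij by (simp add: K_def)
  have "B x \<delta> = 0" if "x \<in> nonneg_cone (\<alpha> ` J)" for x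
    using that by (induction rule: nonneg_cone_induct) (use orth in auto)
  moreover have "\<delta> \<in> nonneg_cone (\<alpha> ` J)" using diff[of i j] Mi ij by (simp add: \<delta>_def)
  ultimately have "B \<delta> \<delta> = 0" by blast
  moreover have bj: "b j = b i + \<delta>" by (simp add: \<delta>_def)
  moreover have unit: "B (b i) (b i) = 1" "B (b j) (b j) = 1" using pos pos_root_root root_unit by blast+
  ultimately have "B (b i) \<delta> = 0" using B_symmetric[of \<delta> "b i"] by simp
  then have one: "B (b i) (b j) = 1" using bj unit by simp
  have "b i \<noteq> b j"
  proof
    assume eq: "b i = b j"
    have "\<alpha> (l i) + (b j - b (Suc i)) = 0" using succ[of i] eq Mi MN by simp
    moreover have "b j - b (Suc i) \<in> pos_cone"
      using diff[of "Suc i" j] Mi ij nonneg_cone_mono[of "\<alpha> ` J" "\<alpha> ` S"] J by auto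
    ultimately have "\<alpha> (l i) = 0" using pos_cone_salient simple_pos_cone l(1) by blast
    then show False using root_nonzero simple_root l(1) by blast
  qed
  then have "d i \<noteq> d j"
    using dominance_dichotomy[of "b i" "b j"] one pos fin
      card_strictly_dominated_less[of "b i" "b j"] card_strictly_dominated_less[of "b j" "b i"]
    by (auto simp: d_def)
  then show False using const[of i] const[of j] Mi MN ij by simp
qed

section \<open>Low elements\<close>

lemma low_elements_iff:
  "w \<in> low_elements n \<longleftrightarrow> w \<in> carrier W \<and>
    (\<exists>A. A \<subseteq> inversion_set w \<and> A \<subseteq> small_roots n \<and> inversion_set w \<subseteq> nonneg_cone A)"
proof
  assume "w \<in> low_elements n"
  then obtain A where A: "w \<in> carrier W" "A \<subseteq> small_roots n" "inversion_set w = root_cone A"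
    by (auto simp: low_elements_def)
  then have "A \<subseteq> inversion_set w"
    using nonneg_cone_superset pos_root_root unfolding root_cone_def small_roots_iff[abs_def]
    by (auto simp: subset_iff small_roots_iff)
  then show "w \<in> carrier W \<and>
    (\<exists>A. A \<subseteq> inversion_set w \<and> A \<subseteq> small_roots n \<and> inversion_set w \<subseteq> nonneg_cone A)"
    using A by (auto simp: root_cone_def)
next
  assume *: "w \<in> carrier W \<and>
    (\<exists>A. A \<subseteq> inversion_set w \<and> A \<subseteq> small_roots n \<and> inversion_set w \<subseteq> nonneg_cone A)"
  then obtain A where A: "A \<subseteq> inversion_set w" "A \<subseteq> small_roots n" "inversion_set w \<subseteq> nonneg_cone A"
    by blast
  then have "inversion_set w = root_cone A"
    using inversion_set_root_cone[of w A] * inversion_set_root by (auto simp: root_cone_def)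
  then show "w \<in> low_elements n" using * A by (auto simp: low_elements_def)
qed

lemma finite_low_elements: "finite (low_elements n)"
proof (rule finite_imageD[of inversion_set])
  have "inversion_set ` low_elements n \<subseteq> root_cone ` Pow (small_roots n)"
    by (auto simp: low_elements_def)
  then show "finite (inversion_set ` low_elements n)"
    using finite_small_roots by (meson finite_Pow_iff finite_imageI finite_subset)
  show "inj_on inversion_set (low_elements n)"
    using inversion_set_inj by (auto simp: inj_on_def low_elements_def)
qed

text \<open>The heart of suffix closure. The case \<open>s \<beta> \<notin> A\<close> uses that \<open>s \<beta>\<close> is then decomposable for \<open>w\<close>
  although \<open>\<beta>\<close> is not for \<open>s w\<close>. As \<open>s\<close> carries all inversions of \<open>w\<close> but \<open>\<alpha>\<^sub>s\<close> to inversions of \<open>s w\<close>, the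
  decomposition must involve \<open>\<alpha>\<^sub>s\<close>, so the chain \<open>p\<^sub>0 = \<alpha>\<^sub>s, p\<^sub>1 = s \<beta>, p\<^sub>2, \<dots>\<close> has its first three roots
  in \<open>N(w)\<close>. Its last root in \<open>N(w)\<close> turns out to be indecomposable.\<close>

lemma low_elements_generators_small:
  assumes w: "w \<in> carrier W" and A: "A \<subseteq> inversion_set w" "inversion_set w \<subseteq> nonneg_cone A"
    and s: "s \<in> S" "\<alpha> s \<in> inversion_set w" and small: "A \<subseteq> small_roots n"
    and \<beta>: "\<beta> \<in> inversion_set (s \<otimes> w)" "\<not> decomposable \<beta> (s \<otimes> w)"
  shows "\<beta> \<in> small_roots n"
proof -
  let ?N = inversion_set and ?v = "s \<otimes> w"
  have v: "?v \<in> carrier W" "s \<otimes> ?v = w" using w s by auto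
  have sv: "\<alpha> s \<notin> ?N ?v" using descent_iff w s by blast
  have pos: "\<beta> \<in> pos_roots" and neq: "\<beta> \<noteq> \<alpha> s" and s\<beta>: "\<rho> s \<beta> \<in> ?N w"
    using \<beta> inversion_set_pos inversion_set_left[OF w s(1), of \<beta>] sv by (auto split: if_splits)
  have roots: "\<alpha> s \<in> roots" "\<beta> \<in> roots" using s simple_root pos pos_root_root by auto
  have Ntransfer: "\<rho> s a \<in> ?N ?v" if "a \<in> ?N w" "a \<noteq> \<alpha> s" for a
    using inversion_set_left[OF v(1) s(1), of a] that v by simp
  have indec: "\<delta> \<in> A" if "\<delta> \<in> ?N w" "\<not> decomposable \<delta> w" for \<delta>
    using cone_combination_decomposable[OF w that(1) A(1)] A(2) that by blast
  define c where "c = B (\<alpha> s) \<beta>"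
  have cr: "crystallographic c" using simple_root_product_crystallographic pos s by (simp add: c_def)
  have transport: "\<beta> \<in> small_roots n" if "\<rho> s \<beta> \<in> small_roots n" "c \<le> 1/2"
  proof -
    have "c \<le> 0 \<or> c = 1/2"
      using cr that(2) by (auto simp: crystallographic_def abs_if split: if_splits)
    then have "\<not> dominates \<beta> (\<alpha> s)"
      using not_dominates_nonpos[OF s(1) pos] not_dominates_half[OF s(1) pos] unfolding c_def by blast
    then show ?thesis using small_roots_transport s(1) pos neq that(1) by blast
  qed
  show ?thesis
  proof (cases "\<rho> s \<beta> \<in> A")
    case True
    have "c < 1" using inversion_product[OF w s(2) s\<beta>] rep_B_simple_self[OF s(1)] by (simp add: c_def)
    then show ?thesis using transport True small cr by (auto simp: crystallographic_def)
  next
    case False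
    then obtain a where a: "a \<in> ?N w" "a \<noteq> \<rho> s \<beta>" "- \<rho> (reflection (\<rho> s \<beta>)) a \<in> ?N w"
      using indec s\<beta> unfolding decomposable_def by blast
    let ?R = "\<rho> (reflection (\<rho> s \<beta>))" and ?p = "chain (\<alpha> s) \<beta>"
    have R: "?R x = \<rho> s (\<rho> (reflection \<beta>) (\<rho> s x))" for x
      using reflection_rep[of s \<beta>] s roots by (simp add: rep_mult)
    have "a = \<alpha> s \<or> - ?R a = \<alpha> s"
    proof (rule ccontr)
      assume "\<not> ?thesis"
      then have "\<rho> s a \<in> ?N ?v" "\<rho> s (- ?R a) \<in> ?N ?v" using Ntransfer a by auto
      moreover have "\<rho> s (- ?R a) = - \<rho> (reflection \<beta>) (\<rho> s a)" using s by (simp add: R)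
      moreover have "\<rho> s a \<noteq> \<beta>" using a(2) s by auto
      ultimately show False using \<beta>(2) unfolding decomposable_def by metis
    qed
    moreover have "- ?R (- ?R a) = a" using roots s rep_root by simp
    ultimately have "- ?R (\<alpha> s) \<in> ?N w" using a by metis
    moreover have p1: "?p (Suc 0) = \<rho> s \<beta>" using s by (simp add: chain_1 rep_simple)
    ultimately have p2: "?p (Suc (Suc 0)) \<in> ?N w"
      using chain_reflect[OF roots, of 0] by simp
    have cneg: "c < 0"
    proof (rule ccontr)
      assume "\<not> c < 0"
      have "?p (Suc (Suc 0)) + (\<alpha> s + (2 * c) *\<^sub>R \<rho> s \<beta>) = 0"
        using chain_Suc_Suc[of "\<alpha> s" \<beta> 0] p1 by (simp add: c_def)
      moreover have "\<alpha> s + (2 * c) *\<^sub>R \<rho> s \<beta> \<in> pos_cone"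
        using \<open>\<not> c < 0\<close> s s\<beta> inversion_set_pos pos_root_cone
        by (intro nonneg_cone_add nonneg_cone_scale) (auto simp: simple_pos_cone)
      ultimately have "?p (Suc (Suc 0)) = 0"
        using pos_cone_salient p2 inversion_set_pos pos_root_cone by blast
      then show False using p2 inversion_set_root root_nonzero by blast
    qed
    \<comment> \<open>Let \<open>y = s\<^sub>\<delta> w\<close> for \<open>\<delta> = p\<^sub>k\<^sub>+\<^sub>1\<close> and \<open>x = s\<^sub>\<beta> s w\<close>, which is two letters shorter than \<open>w\<close>. By
      \<open>chain_rotation\<close> also \<open>x = s\<^sub>\<epsilon> y\<close> with \<open>\<epsilon> = p\<^sub>k\<close>, and \<open>\<epsilon>\<close> is an inversion of \<open>y\<close> because the chain
      leaves \<open>N(w)\<close> after \<open>\<delta>\<close>. So \<open>y\<close> lies strictly between \<open>x\<close> and \<open>w\<close> in length, and \<open>\<delta>\<close> is indecomposable.\<close>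
    have end_small: "?p (Suc k) \<in> small_roots n"
      if k: "1 \<le> k" "?p k \<in> ?N w" "?p (Suc k) \<in> ?N w" "\<rho> (inv w) (?p (Suc (Suc k))) \<in> pos_roots" for k
    proof -
      let ?r = "\<lambda>j. reflection (?p j)"
      define y where "y = ?r (Suc k) \<otimes> w"
      have r: "?r j \<in> carrier W" "?r j \<otimes> ?r j = \<one>" "inv (?r j) = ?r j" for j
        using chain_root roots by simp_all
      have y: "y \<in> carrier W" using r w by (simp add: y_def)
      have "?r k \<otimes> ?r (Suc k) = inv (?r (Suc k) \<otimes> ?r k)" using r by (simp add: inv_mult_group)
      also have "\<dots> = reflection \<beta> \<otimes> s"
        unfolding chain_rotation[OF roots] using roots s by (simp add: inv_mult_group)
      finally have "?r k \<otimes> y = reflection \<beta> \<otimes> ?v"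
        using r w s roots by (simp add: y_def m_assoc[symmetric])
      moreover have "?p k \<in> ?N y"
      proof -
        have "\<rho> (inv y) (?p k) = - \<rho> (inv w) (?p (Suc (Suc k)))"
          using r w chain_reflect[OF roots, of k] by (simp add: y_def inv_mult_group rep_mult)
        then show ?thesis using k(2,4) inversion_set_pos mem_inversion_set[OF y] by simp
      qed
      then have "cox_length (?r k \<otimes> y) < cox_length y" by (rule length_reflection_less[OF y])
      moreover have "cox_length y < cox_length w" unfolding y_def by (rule length_reflection_less[OF w k(3)])
      moreover have "cox_length w = Suc (Suc (cox_length (reflection \<beta> \<otimes> ?v)))"
        using descent_length(1)[OF w s] decomposable_iff_length[OF v(1) \<beta>(1)] \<beta>(2) by simp
      ultimately have "cox_length w = Suc (cox_length (?r (Suc k) \<otimes> w))" by (simp add: y_def)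
      then have "?p (Suc k) \<in> A" using indec decomposable_iff_length w k(3) by blast
      then show ?thesis using small by blast
    qed
    have p01: "?p 0 \<in> ?N w" "?p (Suc 0) \<in> ?N w" using s s\<beta> p1 by simp_all
    show ?thesis
    proof (cases "c \<le> -1")
      case True
      have \<beta>neg: "\<beta> \<noteq> - \<alpha> s" using pos not_pos_and_neg simple_pos_root s by blast
      have "\<exists>j. ?p j \<notin> ?N w"
      proof (rule ccontr)
        assume "\<not> ?thesis"
        then have "range ?p \<subseteq> ?N w" by blast
        then show False using inj_chain[OF roots \<beta>neg] True range_inj_infinite finite_subset
            finite_inversion_set[OF w] by (metis c_def)
      qed
      then obtain m where m: "?p m \<notin> ?N w" "\<And>j. j < m \<Longrightarrow> ?p j \<in> ?N w"
        using exists_least_iff[of "\<lambda>j. ?p j \<notin> ?N w"] by blast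
      \<comment> \<open>The chain is infinite here, so it leaves \<open>N(w)\<close>; \<open>m\<close> is the first index where it does.\<close>
      have "m \<noteq> 0" "m \<noteq> Suc 0" "m \<noteq> Suc (Suc 0)" using m(1) p01 p2 by metis+
      then obtain k where k: "m = Suc (Suc k)" "1 \<le> k" by (metis One_nat_def Suc_le_eq gr0I old.nat.exhaust)
      have "?p m \<in> pos_roots" using chain_pos simple_pos_root s pos True by (simp add: c_def)
      then have "\<rho> (inv w) (?p m) \<in> pos_roots" using m(1) mem_inversion_set_not_pos[OF w] by blast
      then have "?p (Suc k) \<in> small_roots n" using end_small m(2) k by simp
      moreover have "dominates (?p (Suc k)) (?p (Suc 0))"
        using chain_dominates[OF simple_pos_root[OF s(1)] pos, of "Suc 0" "Suc k"] True by (simp add: c_def)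
      ultimately have "\<rho> s \<beta> \<in> small_roots n"
        using small_roots_dominated p1 s\<beta> inversion_set_pos by metis
      then show ?thesis using transport True by simp
    next
      case False
      \<comment> \<open>The plane is of type \<open>A\<^sub>2\<close>, the chain is \<open>\<alpha>\<^sub>s, \<alpha>\<^sub>s + \<beta>, \<beta>, - \<alpha>\<^sub>s\<close>, and its last positive root is \<open>\<beta>\<close>.\<close>
      then have half: "c = - 1 / 2" using cr cneg by (auto simp: crystallographic_def)
      then have "?p (Suc (Suc 0)) = \<beta>" "?p (Suc (Suc (Suc 0))) = - \<alpha> s"
        unfolding c_def by (simp_all add: chain_def)
      then show ?thesis
        using end_small[of "Suc 0"] p01 p2 mem_inversion_set[OF w] s w by simp
    qed
  qed
qed

lemma low_elements_descent:
  assumes w: "w \<in> low_elements n" and s: "s \<in> S" "\<alpha> s \<in> inversion_set w"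
  shows "s \<otimes> w \<in> low_elements n"
proof -
  obtain A where A: "w \<in> carrier W" "A \<subseteq> inversion_set w" "A \<subseteq> small_roots n"
    "inversion_set w \<subseteq> nonneg_cone A"
    using w unfolding low_elements_iff by blast
  then have v: "s \<otimes> w \<in> carrier W" using s by simp
  obtain D where D: "D \<subseteq> inversion_set (s \<otimes> w)" "inversion_set (s \<otimes> w) \<subseteq> nonneg_cone D"
    "\<And>\<beta>. \<beta> \<in> D \<Longrightarrow> \<not> decomposable \<beta> (s \<otimes> w)"
    using minimal_generators[OF v] by blast
  then have "D \<subseteq> small_roots n"
    using low_elements_generators_small[OF A(1,2,4) s A(3)] by blast
  then show ?thesis using v D low_elements_iff by blast
qed

lemma low_elements_suffix:
  assumes "w \<in> low_elements n" "is_suffix v w"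
  shows "v \<in> low_elements n"
proof -
  obtain u where u: "v \<in> carrier W" "u \<in> carrier W" "w = u \<otimes> v"
    "cox_length w = cox_length u + cox_length v"
    using assms by (auto simp: is_suffix_def)
  then show ?thesis
    using assms(1)
  proof (induction "cox_length u" arbitrary: u w)
    case 0
    then have "u = \<one>" using cox_length_eq_0[of u] by simp
    then show ?case using 0 by simp
  next
    case (Suc k)
    then have "u \<noteq> \<one>" by auto
    then obtain s x where s: "s \<in> S" "x \<in> carrier W" "u = s \<otimes> x" "cox_length u = Suc (cox_length x)"
      using exists_first_letter Suc by blast
    have xv: "x \<otimes> v \<in> carrier W" and w: "w = s \<otimes> (x \<otimes> v)" using s Suc by (auto simp: m_assoc)
    have l: "cox_length (x \<otimes> v) = cox_length x + cox_length v"
      using cox_length_mult_le[of x v] cox_length_mult_left_le[OF xv s(1)] s Suc w by simp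
    have "\<alpha> s \<in> inversion_set w"
    proof (rule ccontr)
      assume "\<alpha> s \<notin> inversion_set w"
      then have "cox_length (s \<otimes> w) = Suc (cox_length w)"
        using inversion_set_left_insert(2)[of w s] s xv w by simp
      then show False using w s xv l Suc by simp
    qed
    then have "s \<otimes> w \<in> low_elements n" using low_elements_descent Suc s by blast
    then have "x \<otimes> v \<in> low_elements n" using w s xv by simp
    then show ?case using Suc.hyps(1)[of x "x \<otimes> v"] l s Suc by simp
  qed
qed

lemma low_elements_join:
  assumes "X \<subseteq> low_elements n" "bounded_above X"
  shows "\<Squnion>\<^bsub>right_weak_order\<^esub> X \<in> low_elements n"
proof -
  let ?N = inversion_set and ?j = "\<Squnion>\<^bsub>right_weak_order\<^esub> X"
  have X: "X \<subseteq> carrier W" using assms low_elements_iff by blast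
  have "\<forall>x\<in>X. \<exists>A. A \<subseteq> ?N x \<and> A \<subseteq> small_roots n \<and> ?N x \<subseteq> nonneg_cone A"
    using assms low_elements_iff by blast
  then obtain A where A: "\<And>x. x \<in> X \<Longrightarrow> A x \<subseteq> ?N x" "\<And>x. x \<in> X \<Longrightarrow> A x \<subseteq> small_roots n"
    "\<And>x. x \<in> X \<Longrightarrow> ?N x \<subseteq> nonneg_cone (A x)"
    by metis
  let ?A = "\<Union>x\<in>X. A x"
  have j: "?j \<in> carrier W" "?N ?j = root_cone (\<Union>x\<in>X. ?N x)"
    using join_inversion_set[OF X assms(2)] by auto
  have "?N x \<subseteq> ?N ?j" if "x \<in> X" for x
    unfolding j(2) using that by (intro inversion_set_subset_root_cone) blast
  then have "?A \<subseteq> ?N ?j" using A(1) by blast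
  moreover have gen: "(\<Union>x\<in>X. ?N x) \<subseteq> nonneg_cone ?A"
  proof
    fix \<beta> assume "\<beta> \<in> (\<Union>x\<in>X. ?N x)"
    then obtain x where x: "x \<in> X" "\<beta> \<in> ?N x" by blast
    then have "\<beta> \<in> nonneg_cone (A x)" using A(3) by blast
    moreover have "nonneg_cone (A x) \<subseteq> nonneg_cone ?A" using x(1) by (intro nonneg_cone_mono) blast
    ultimately show "\<beta> \<in> nonneg_cone ?A" by blast
  qed
  then have "?N ?j \<subseteq> nonneg_cone ?A"
    unfolding j(2) using nonneg_cone_subset[OF gen] by (auto simp: root_cone_def)
  ultimately show ?thesis using low_elements_iff j(1) A(2) by blast
qed

lemma simple_low: "s \<in> S \<Longrightarrow> s \<in> low_elements n"
  unfolding low_elements_iff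
  using inversion_set_generator simple_root_small
  by (intro conjI exI[of _ "{\<alpha> s}"]) (auto intro: nonneg_cone_superset)

theorem low_elements_garside_shadow: "garside_shadow (low_elements n)"
  unfolding garside_shadow_def
  using simple_low low_elements_join low_elements_suffix low_elements_iff by blast

end

theorem theorem1p3:
  fixes W :: "('w, 'm) monoid_scheme"
    and S :: "'w set"
    and B :: "'v::real_vector \<Rightarrow> 'v \<Rightarrow> real"
    and \<alpha> :: "'w \<Rightarrow> 'v"
    and \<rho> :: "'w \<Rightarrow> 'v \<Rightarrow> 'v"
    and n :: nat
  assumes "coxeter_system W S"
    and "finite S"
    and "geometric_representation W S B \<alpha> \<rho>"
    and "\<And>s t. s \<in> S \<Longrightarrow> t \<in> S \<Longrightarrow> coxeter_matrix W s t \<in> {1, 2, 3, \<infinity>}"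
  shows "finite (geometric_representation.low_elements W S \<alpha> \<rho> n) \<and>
    coxeter_system.garside_shadow W S
      (geometric_representation.low_elements W S \<alpha> \<rho> n)"
proof -
  interpret geometric_representation W S B \<alpha> \<rho> by fact
  interpret three_infinity_representation W S B \<alpha> \<rho> by unfold_locales fact
  show ?thesis using finite_low_elements low_elements_garside_shadow by blast
qed

end
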